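(* Let $(G,+,p)$ be a reflexive metric Abelian group. Then: (A) the topology of $(G',\cdot,p')$ coincides with the topology of uniform convergence on weakly compact subsets of $G$; (B) the topological weights of $G$ and $G'$ coincide; (C) $G$ is topologically reflexive. In particular, if $G$ is Polish, so is $G'$.
   Context: $\mathbb{T}=\{z\in\mathbb{C}:|z|=1\}$ and $\lambda(z)=\min\{|t|: t\in\mathbb{R},\ e^{2\pi t i}=z\}$ for $z\in\mathbb{T}$. A value on a group $(G,\cdot)$ is a function $p\colon G\to[0,\infty)$ such that $(x,y)\mapsto p(x^{-1}y)$ is a metric on $G$. A metric Abelian group $(G,+,p)$ is an Abelian group with a value $p$, regarded as a topological group with the topology induced by $p$. $G'$ is the group of all continuous homomorphisms from $G$ into $\mathbb{T}$, equipped with the dual value $p'(\chi)=\inf\{M>0:\ \lambda(\chi(x))\le M p(x)\ \text{for all } x\in G\}$ and with the topology induced by $p'$. The second metric-dual group is $(G'',\cdot,p'')=(G',\cdot,p')'$. The canonical homomorphism $\kappa_G\colon G\to G''$ is $\kappa_G(x)=\mathfrak{e}_x$, $\mathfrak{e}_x(\chi)=\chi(x)$. $(G,+,p)$ is called reflexive if $\kappa_G$ is isometric and surjective. The weak topology on $G$ is the smallest topology making all $\chi\in G'$ continuous; weakly compact means compact in this topology. For a topological Abelian group $G$, the topological dual $\widehat{G}$ is the group of all continuous homomorphisms $G\to\mathbb{T}$ with the compact-open topology, and $\widehat{\widehat{G}}$ is the topological dual of $\widehat{G}$; $G$ is topologically reflexive if $G\ni x\mapsto\mathfrak{e}_x\in\widehat{\widehat{G}}$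 (with $\mathfrak{e}_x(\phi)=\phi(x)$) is an isomorphism of topological groups. *)

theory Defs
  imports "HOL-Analysis.Analysis" "HOL-Algebra.Group"
begin

unbundle cardinal_syntax

section \<open>The circle group\<close>

definition circle_group :: "complex monoid" where
  "circle_group = \<lparr>carrier = {z. cmod z = 1}, mult = (*), one = 1\<rparr>"

definition circle_topology :: "complex topology" where
  "circle_topology = top_of_set {z. cmod z = 1}"

definition circle_length :: "complex \<Rightarrow> real" where
  "circle_length z =
    (LEAST r. \<exists>t::real. r = \<bar>t\<bar> \<and> exp (2 * of_real pi * of_real t * \<i>) = z)"

section \<open>Metric Abelian groups\<close>

text \<open>The locale \<open>Metric_space\<close> of the library requires non-negativity and symmetry of the
  distance also for points outside the carrier, hence the default value 0 there.\<close>

definition value_dist :: "('a, 'b) monoid_scheme \<Rightarrow> ('a \<Rightarrow> real) \<Rightarrow> 'a \<Rightarrow> 'a \<Rightarrow> real" where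
  "value_dist G p x y =
    (if x \<in> carrier G \<and> y \<in> carrier G then p (inv\<^bsub>G\<^esub> x \<otimes>\<^bsub>G\<^esub> y) else 0)"

definition is_value :: "('a, 'b) monoid_scheme \<Rightarrow> ('a \<Rightarrow> real) \<Rightarrow> bool" where
  "is_value G p \<longleftrightarrow>
    (\<forall>x\<in>carrier G. 0 \<le> p x) \<and> Metric_space (carrier G) (value_dist G p)"

definition value_topology :: "('a, 'b) monoid_scheme \<Rightarrow> ('a \<Rightarrow> real) \<Rightarrow> 'a topology" where
  "value_topology G p = Metric_space.mtopology (carrier G) (value_dist G p)"

definition metric_abelian_group :: "('a, 'b) monoid_scheme \<Rightarrow> ('a \<Rightarrow> real) \<Rightarrow> bool" where
  "metric_abelian_group G p \<longleftrightarrow> comm_group G \<and> is_value G p"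

section \<open>Groups of continuous characters\<close>

text \<open>Characters are taken to be extensional (\<open>undefined\<close> outside the carrier), so that
  equality of characters is equality of their values on the group.\<close>

definition char_group ::
    "('a, 'b) monoid_scheme \<Rightarrow> 'a topology \<Rightarrow> ('a \<Rightarrow> complex) monoid" where
  "char_group G X =
    \<lparr>carrier = {\<phi> \<in> extensional (carrier G).
                 \<phi> \<in> hom G circle_group \<and> continuous_map X circle_topology \<phi>},
     mult = (\<lambda>\<phi> \<psi>. \<lambda>x\<in>carrier G. \<phi> x * \<psi> x),
     one = (\<lambda>x\<in>carrier G. 1)\<rparr>"

definition eval_map ::
    "('a, 'b) monoid_scheme \<Rightarrow> 'a topology \<Rightarrow> 'a \<Rightarrow> ('a \<Rightarrow> complex) \<Rightarrow> complex" where
  "eval_map G X x = (\<lambda>\<phi>\<in>carrier (char_group G X). \<phi> x)"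

section \<open>The metric dual\<close>

definition dual_group :: "('a, 'b) monoid_scheme \<Rightarrow> ('a \<Rightarrow> real) \<Rightarrow> ('a \<Rightarrow> complex) monoid" where
  "dual_group G p = char_group G (value_topology G p)"

definition dual_value ::
    "('a, 'b) monoid_scheme \<Rightarrow> ('a \<Rightarrow> real) \<Rightarrow> ('a \<Rightarrow> complex) \<Rightarrow> real" where
  "dual_value G p \<phi> =
    Inf {M. 0 < M \<and> (\<forall>x\<in>carrier G. circle_length (\<phi> x) \<le> M * p x)}"

definition bidual_group ::
    "('a, 'b) monoid_scheme \<Rightarrow> ('a \<Rightarrow> real) \<Rightarrow> (('a \<Rightarrow> complex) \<Rightarrow> complex) monoid" where
  "bidual_group G p = dual_group (dual_group G p) (dual_value G p)"

definition bidual_value ::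
    "('a, 'b) monoid_scheme \<Rightarrow> ('a \<Rightarrow> real) \<Rightarrow> (('a \<Rightarrow> complex) \<Rightarrow> complex) \<Rightarrow> real" where
  "bidual_value G p = dual_value (dual_group G p) (dual_value G p)"

definition canonical_hom ::
    "('a, 'b) monoid_scheme \<Rightarrow> ('a \<Rightarrow> real) \<Rightarrow> 'a \<Rightarrow> ('a \<Rightarrow> complex) \<Rightarrow> complex" where
  "canonical_hom G p = eval_map G (value_topology G p)"

definition metrically_reflexive :: "('a, 'b) monoid_scheme \<Rightarrow> ('a \<Rightarrow> real) \<Rightarrow> bool" where
  "metrically_reflexive G p \<longleftrightarrow>
    (\<forall>x\<in>carrier G. \<forall>y\<in>carrier G.
       value_dist (bidual_group G p) (bidual_value G p)
         (canonical_hom G p x) (canonical_hom G p y) = value_dist G p x y) \<and>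
    canonical_hom G p ` carrier G = carrier (bidual_group G p)"

section \<open>The topological dual\<close>

definition compact_open_topology ::
    "('a, 'b) monoid_scheme \<Rightarrow> 'a topology \<Rightarrow> ('a \<Rightarrow> complex) topology" where
  "compact_open_topology G X =
    topology_generated_by
      {{\<phi> \<in> carrier (char_group G X). \<phi> ` K \<subseteq> U} | K U.
         compactin X K \<and> openin circle_topology U}"

definition topologically_reflexive :: "('a, 'b) monoid_scheme \<Rightarrow> 'a topology \<Rightarrow> bool" where
  "topologically_reflexive G X \<longleftrightarrow>
    (let G1 = char_group G X; X1 = compact_open_topology G X;
         G2 = char_group G1 X1; X2 = compact_open_topology G1 X1
     in eval_map G X \<in> iso G G2 \<and> homeomorphic_map X X2 (eval_map G X))"

section \<open>Weak topology and uniform convergence\<close>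

definition weak_topology :: "('a, 'b) monoid_scheme \<Rightarrow> ('a \<Rightarrow> real) \<Rightarrow> 'a topology" where
  "weak_topology G p =
    topology_generated_by
      {{x \<in> carrier G. \<phi> x \<in> U} | \<phi> U.
         \<phi> \<in> carrier (dual_group G p) \<and> openin circle_topology U}"

text \<open>The topology on the function set \<open>F\<close> of uniform convergence on the members of \<open>\<K>\<close>. Finite
  subfamilies occur since \<open>\<K>\<close> is not required to be closed under finite unions.\<close>

definition uniform_convergence_topology ::
    "('a \<Rightarrow> 'b::metric_space) set \<Rightarrow> 'a set set \<Rightarrow> ('a \<Rightarrow> 'b) topology" where
  "uniform_convergence_topology F \<K> = topology (\<lambda>U. U \<subseteq> F \<and>
    (\<forall>\<phi>\<in>U. \<exists>\<K>' e. finite \<K>' \<and> \<K>' \<subseteq> \<K> \<and> 0 < e \<and>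
       {\<psi> \<in> F. \<forall>x\<in>\<Union>\<K>'. dist (\<psi> x) (\<phi> x) < e} \<subseteq> U))"

lemma openin_uniform_convergence_topology:
  "openin (uniform_convergence_topology F \<K>) U \<longleftrightarrow> U \<subseteq> F \<and>
    (\<forall>\<phi>\<in>U. \<exists>\<K>' e. finite \<K>' \<and> \<K>' \<subseteq> \<K> \<and> 0 < e \<and>
       {\<psi> \<in> F. \<forall>x\<in>\<Union>\<K>'. dist (\<psi> x) (\<phi> x) < e} \<subseteq> U)"
proof -
  define N where "N = (\<lambda>\<phi> \<K>' e. {\<psi> \<in> F. \<forall>x\<in>\<Union>\<K>'. dist (\<psi> x) (\<phi> x) < (e::real)})"
  define P where "P = (\<lambda>U. U \<subseteq> F \<and>
    (\<forall>\<phi>\<in>U. \<exists>\<K>' e. finite \<K>' \<and> \<K>' \<subseteq> \<K> \<and> 0 < e \<and> N \<phi> \<K>' e \<subseteq> U))"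
  have "P (S \<inter> T)" if PS: "P S" and PT: "P T" for S T
    unfolding P_def
  proof (intro conjI ballI)
    show "S \<inter> T \<subseteq> F" using PS by (auto simp: P_def)
    fix \<phi> assume "\<phi> \<in> S \<inter> T"
    then obtain A a B b where
      "finite A" "A \<subseteq> \<K>" "0 < a" "N \<phi> A a \<subseteq> S" "finite B" "B \<subseteq> \<K>" "0 < b" "N \<phi> B b \<subseteq> T"
      using PS PT unfolding P_def by (meson IntD1 IntD2)
    moreover have "N \<phi> (A \<union> B) (min a b) \<subseteq> N \<phi> A a \<inter> N \<phi> B b"
      unfolding N_def by auto
    ultimately show "\<exists>\<K>' e. finite \<K>' \<and> \<K>' \<subseteq> \<K> \<and> 0 < e \<and> N \<phi> \<K>' e \<subseteq> S \<inter> T"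
      by (intro exI[of _ "A \<union> B"] exI[of _ "min a b"]) auto
  qed
  moreover have "P (\<Union>\<S>)" if PS: "\<forall>S\<in>\<S>. P S" for \<S>
    unfolding P_def
  proof (intro conjI ballI)
    show "\<Union>\<S> \<subseteq> F" using PS by (auto simp: P_def)
    fix \<phi> assume "\<phi> \<in> \<Union>\<S>"
    then obtain S where "S \<in> \<S>" "\<phi> \<in> S" by blast
    moreover from this PS obtain A a where
      "finite A" "A \<subseteq> \<K>" "0 < a" "N \<phi> A a \<subseteq> S"
      unfolding P_def by meson
    ultimately show "\<exists>\<K>' e. finite \<K>' \<and> \<K>' \<subseteq> \<K> \<and> 0 < e \<and> N \<phi> \<K>' e \<subseteq> \<Union>\<S>"
      by (meson Union_upper order_trans)
  qed
  ultimately have "istopology P"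
    unfolding istopology_def by blast
  moreover have "uniform_convergence_topology F \<K> = topology P"
    by (simp add: uniform_convergence_topology_def P_def N_def)
  ultimately show ?thesis
    by (simp add: topology_inverse' P_def N_def)
qed

section \<open>Weight and Polish spaces\<close>

definition topology_base :: "'a topology \<Rightarrow> 'a set set \<Rightarrow> bool" where
  "topology_base X \<B> \<longleftrightarrow> (\<forall>V\<in>\<B>. openin X V) \<and>
    (\<forall>U x. openin X U \<and> x \<in> U \<longrightarrow> (\<exists>V\<in>\<B>. x \<in> V \<and> V \<subseteq> U))"

text \<open>The weight is the cardinality of a base of least cardinality. Weights of spaces over
  different types are to be compared by \<open>=o\<close>.\<close>

definition weight :: "'a topology \<Rightarrow> 'a set rel" where
  "weight X = |SOME \<B>. topology_base X \<B> \<and> (\<forall>\<B>'. topology_base X \<B>' \<longrightarrow> |\<B>| \<le>o |\<B>'| )|"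

lemma ex_least_topology_base:
  "\<exists>\<B>. topology_base X \<B> \<and> (\<forall>\<B>'. topology_base X \<B>' \<longrightarrow> |\<B>| \<le>o |\<B>'| )"
proof -
  have "topology_base X {U. openin X U}"
    by (auto simp: topology_base_def)
  then have "card_of ` {\<B>. topology_base X \<B>} \<noteq> {}"
    by blast
  from exists_minim_Card_order[OF this] show ?thesis
    by (auto simp: card_of_Card_order)
qed

definition polish_topology :: "'a topology \<Rightarrow> bool" where
  "polish_topology X \<longleftrightarrow> separable_space X \<and> completely_metrizable_space X"

end

theory Submission
  imports Defs "HOL-Algebra.Free_Abelian_Groups"
begin

text \<open>
  Write \<open>G'\<close> for the metric dual with its value \<open>p'\<close>, and \<open>\<lambda>\<close> for the length on the circle. Two
  facts carry the proof.

  The first is quantitative: the circle has no small subgroups. A point of the circle whose first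
  \<open>n\<close> powers are at distance less than \<open>1\<close> from \<open>1\<close> has length at most \<open>1/(4n)\<close>, and the multiples
  \<open>k x\<close> of an element stay in the ball of radius \<open>r\<close> as long as \<open>k p(x) \<le> r\<close>. Hence a character at
  distance less than \<open>1\<close> from \<open>1\<close> on the ball of radius \<open>r\<close> has value at most \<open>1/r\<close>
  (\<open>dual_value_le_of_near_one_on_ball\<close>). So closeness on a single large ball already controls \<open>p'\<close>.

  The second is a Banach-Alaoglu theorem: the balls of the dual of any metric Abelian group are
  compact for pointwise convergence (\<open>compactin_dual_ball_pointwise\<close>). A reflexive group is the dual
  of \<open>G'\<close>, so its own balls are weakly compact (\<open>weakly_compact_ball\<close>).

  (A) Uniform closeness on the weakly compact ball of radius \<open>r\<close> bounds \<open>p'\<close> by \<open>1/r\<close>. Conversely, a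
  weakly compact set is equicontinuous on \<open>G'\<close>, although it is not known in advance to be bounded.
  This is a uniform boundedness principle, proved by a gliding hump in the complete group \<open>G'\<close>
  (\<open>weakly_compact_equicontinuous\<close>).

  (B) Since \<open>G'\<close> is again reflexive (\<open>reflexive_group_dual\<close>) and \<open>G\<close> is isometric to its second dual,
  it suffices that the weight of \<open>G'\<close> is at most that of \<open>G\<close>. For infinite \<open>G\<close> this is a statement
  about dense sets. A dense set \<open>D\<close> gives a separating set \<open>S\<close> of at most \<open>|D|\<close> characters. By weak
  compactness each character is controlled on a given ball by finitely many members of \<open>S\<close>, up to
  finitely many tolerances, and the characters with a common control form a totally bounded set at
  the scale of that ball. There are only \<open>max |D| \<aleph>\<^sub>0\<close> controls (\<open>ex_dense_in_dual\<close>). The same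
  argument shows that \<open>G'\<close> is separable if \<open>G\<close> is, and \<open>G'\<close> is always complete. For finite \<open>G\<close> the
  topologies are discrete, and orthogonality of characters gives \<open>|G'| \<le> |G|\<close>.

  (C) The compact-open topology of \<open>G'\<close> is coarser than that of \<open>p'\<close>, so its continuous characters
  are evaluations by reflexivity. The canonical map is continuous since a convergent sequence with
  its limit is compact, and it is open since the balls of \<open>G'\<close> are compact in the compact-open
  topology and the first fact applies to \<open>G'\<close>.
\<close>

section \<open>Lengths on the circle\<close>

lemma cis_2pi_eq_iff: "cis (2 * pi * s) = cis (2 * pi * t) \<longleftrightarrow> s - t \<in> \<int>"
proof -
  have "cis (2 * pi * s) = cis (2 * pi * t) \<longleftrightarrow> (\<exists>n::int. 2 * pi * s = 2 * pi * t + 2 * pi * n)"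
    unfolding sin_cos_eq_iff[symmetric] by (auto simp: complex_eq_iff)
  also have "\<dots> \<longleftrightarrow> (\<exists>n::int. s - t = n)"
  proof (rule ex_cong1)
    fix n :: int
    have "2 * pi * s = 2 * pi * t + 2 * pi * n \<longleftrightarrow> (2 * pi) * (s - t - n) = 0"
      by (simp add: algebra_simps)
    then show "2 * pi * s = 2 * pi * t + 2 * pi * n \<longleftrightarrow> s - t = n" by simp
  qed
  also have "\<dots> \<longleftrightarrow> s - t \<in> \<int>"
    by (auto elim: Ints_cases)
  finally show ?thesis .
qed

lemma ex_small_angle:
  assumes "cmod z = 1"
  obtains t where "\<bar>t\<bar> \<le> 1/2" "z = cis (2 * pi * t)"
proof
  show "\<bar>Arg z / (2 * pi)\<bar> \<le> 1/2"
    using Arg_le_pi[of z] mpi_less_Arg[of z] by (auto simp: abs_le_iff field_simps)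
  have "z \<noteq> 0" using assms by auto
  then show "z = cis (2 * pi * (Arg z / (2 * pi)))"
    using assms cis_Arg[of z] by (simp add: sgn_eq)
qed

lemma circle_length_cis:
  assumes "\<bar>t\<bar> \<le> 1/2"
  shows "circle_length (cis (2 * pi * t)) = \<bar>t\<bar>"
  unfolding circle_length_def
proof (rule Least_equality)
  have exp_cis: "exp (2 * of_real pi * of_real s * \<i>) = cis (2 * pi * s)" for s :: real
    by (simp add: cis_conv_exp mult_ac)
  show "\<exists>s::real. \<bar>t\<bar> = \<bar>s\<bar> \<and> exp (2 * of_real pi * of_real s * \<i>) = cis (2 * pi * t)"
    using exp_cis by blast
  fix r assume "\<exists>s::real. r = \<bar>s\<bar> \<and> exp (2 * of_real pi * of_real s * \<i>) = cis (2 * pi * t)"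
  then obtain s :: real where r: "r = \<bar>s\<bar>" and "s - t \<in> \<int>"
    unfolding exp_cis cis_2pi_eq_iff by blast
  then obtain k :: int where k: "s - t = of_int k" by (auto elim: Ints_cases)
  show "\<bar>t\<bar> \<le> r"
  proof (cases "k = 0")
    case False
    then have "1 \<le> \<bar>real_of_int k\<bar>" by linarith
    then show ?thesis using k assms r by linarith
  qed (use k r in simp)
qed

lemma circle_length_angle:
  assumes "cmod z = 1"
  obtains t where "\<bar>t\<bar> \<le> 1/2" "z = cis (2 * pi * t)" "circle_length z = \<bar>t\<bar>"
  using ex_small_angle[OF assms] circle_length_cis by metis

lemma circle_length_bounds:
  assumes "cmod z = 1"
  shows "0 \<le> circle_length z" "circle_length z \<le> 1/2"
  using circle_length_angle[OF assms] by (metis abs_ge_zero)+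

lemma circle_length_1 [simp]: "circle_length 1 = 0"
  using circle_length_cis[of 0] by simp

lemma circle_length_le:
  "circle_length (cis (2 * pi * s)) \<le> \<bar>s\<bar>"
proof -
  obtain t where t: "\<bar>t\<bar> \<le> 1/2" "cis (2 * pi * s) = cis (2 * pi * t)"
      "circle_length (cis (2 * pi * s)) = \<bar>t\<bar>"
    using circle_length_angle[of "cis (2 * pi * s)"] by auto
  then obtain k :: int where k: "s - t = of_int k"
    unfolding cis_2pi_eq_iff by (auto elim: Ints_cases)
  show ?thesis
  proof (cases "k = 0")
    case False
    then have "1 \<le> \<bar>real_of_int k\<bar>" by linarith
    then show ?thesis using k t by linarith
  qed (use k t in simp)
qed

lemma circle_length_mult:
  assumes "cmod z = 1" "cmod w = 1"
  shows "circle_length (z * w) \<le> circle_length z + circle_length w"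
proof -
  obtain s t where "z = cis (2 * pi * s)" "circle_length z = \<bar>s\<bar>"
    "w = cis (2 * pi * t)" "circle_length w = \<bar>t\<bar>"
    using assms circle_length_angle by metis
  then show ?thesis
    using circle_length_le[of "s + t"] by (simp add: cis_mult distrib_left)
qed

lemma circle_length_inverse:
  assumes "cmod z = 1"
  shows "circle_length (inverse z) = circle_length z"
proof -
  obtain t where t: "\<bar>t\<bar> \<le> 1/2" "z = cis (2 * pi * t)"
    using assms ex_small_angle by metis
  then show ?thesis
    using circle_length_cis[of t] circle_length_cis[of "- t"] by simp
qed

lemma cmod_diff_1_le_circle_length:
  assumes "cmod z = 1"
  shows "cmod (z - 1) \<le> 2 * pi * circle_length z"
proof -
  obtain t where t: "z = cis (2 * pi * t)" "circle_length z = \<bar>t\<bar>"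
    using assms circle_length_angle by metis
  have "cmod (cis (2 * pi * t) - 1) \<le> \<bar>2 * pi * t\<bar>"
    using dist_exp_i_1[of "2 * pi * t"] abs_sin_x_le_abs_x[of "pi * t"]
    by (simp add: cis_conv_exp)
  then show ?thesis using t by (simp add: abs_mult)
qed

text \<open>At distance less than \<open>1\<close> from \<open>1\<close> the real part is positive, so the angle is acute.\<close>

lemma circle_length_le_quarter:
  assumes "cmod z = 1" "cmod (z - 1) < 1"
  shows "circle_length z \<le> 1/4"
proof -
  obtain t where t: "\<bar>t\<bar> \<le> 1/2" "z = cis (2 * pi * t)" "circle_length z = \<bar>t\<bar>"
    using assms circle_length_angle by metis
  have "\<bar>Re (z - 1)\<bar> < 1" using assms(2) abs_Re_le_cmod order.strict_trans1 by blast
  then have "0 < cos (2 * pi * \<bar>t\<bar>)"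
    using t(2) by (cases "0 \<le> t") (simp_all add: abs_if split: if_splits)
  moreover have "cos (2 * pi * \<bar>t\<bar>) \<le> 0" if "1/4 < \<bar>t\<bar>"
  proof -
    have "0 \<le> cos (pi - 2 * pi * \<bar>t\<bar>)"
      using that t(1) by (intro cos_ge_zero) (simp_all add: field_simps)
    then show ?thesis by simp
  qed
  ultimately show ?thesis using t(3) by force
qed

text \<open>The length is at most \<open>1/4\<close>, by the first power. If it exceeded \<open>1/(4n)\<close>, the first of its
  multiples to exceed \<open>1/4\<close> would still be at most \<open>1/2\<close>, so it would be the length of the
  corresponding power, among the first \<open>n\<close>, which would then not be close to \<open>1\<close>.\<close>

lemma circle_length_le_of_powers:
  assumes z: "cmod z = 1" and n: "0 < n"
    and near: "\<And>k. k \<le> n \<Longrightarrow> cmod (z ^ k - 1) < 1"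
  shows "circle_length z \<le> 1 / (4 * real n)"
proof (rule ccontr)
  obtain t where t: "\<bar>t\<bar> \<le> 1/2" "z = cis (2 * pi * t)" "circle_length z = \<bar>t\<bar>"
    using assms circle_length_angle by metis
  assume "\<not> ?thesis"
  then have large: "1 / (4 * real n) < \<bar>t\<bar>" using t by simp
  then have t0: "0 < \<bar>t\<bar>" using n by (smt (verit) divide_pos_pos of_nat_0_less_iff)
  have small: "\<bar>t\<bar> \<le> 1/4"
    using circle_length_le_quarter[OF z] near[of 1] n t(3) by simp
  define k where "k = nat \<lfloor>1 / (4 * \<bar>t\<bar>)\<rfloor> + 1"
  have k: "1 / (4 * \<bar>t\<bar>) < real k" "real k \<le> 1 / (4 * \<bar>t\<bar>) + 1"
    unfolding k_def using t0 by (auto simp: of_nat_nat) linarith+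
  have "1 / (4 * \<bar>t\<bar>) < real n" using large t0 n by (simp add: field_simps)
  then have "k \<le> n" unfolding k_def using t0 by (simp add: nat_less_iff floor_less_iff Suc_le_eq)
  have kt: "1/4 < real k * \<bar>t\<bar>" "real k * \<bar>t\<bar> \<le> 1/2"
    using k t0 small by (simp_all add: field_simps)
  have "z ^ k = cis (real k * (2 * pi * t))"
    unfolding t(2) by (rule Complex.DeMoivre)
  then have "z ^ k = cis (2 * pi * (real k * t))"
    by (simp add: mult.left_commute mult.assoc)
  moreover have "\<bar>real k * t\<bar> \<le> 1/2" using kt by (simp add: abs_mult)
  ultimately have "circle_length (z ^ k) = real k * \<bar>t\<bar>"
    using circle_length_cis by (simp add: abs_mult)
  moreover have "circle_length (z ^ k) \<le> 1/4"
    using circle_length_le_quarter[of "z ^ k"] near[OF \<open>k \<le> n\<close>] z by (simp add: norm_power)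
  ultimately show False using kt by simp
qed

text \<open>An arc is the image of a compact interval of angles; this avoids any discussion of the
  continuity of the length.\<close>

lemma compact_circle_length_le:
  assumes "0 \<le> c"
  shows "compact {z. cmod z = 1 \<and> circle_length z \<le> c}"
proof -
  have "{z. cmod z = 1 \<and> circle_length z \<le> c} = (\<lambda>t. cis (2 * pi * t)) ` {- min c (1/2) .. min c (1/2)}"
  proof (intro equalityI subsetI)
    fix z assume "z \<in> {z. cmod z = 1 \<and> circle_length z \<le> c}"
    then have z: "cmod z = 1" "circle_length z \<le> c" by auto
    then obtain t where "\<bar>t\<bar> \<le> 1/2" "z = cis (2 * pi * t)" "circle_length z = \<bar>t\<bar>"
      using circle_length_angle by metis
    then show "z \<in> (\<lambda>t. cis (2 * pi * t)) ` {- min c (1/2) .. min c (1/2)}"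
      using z by (intro image_eqI[where x = t]) auto
  next
    fix z assume "z \<in> (\<lambda>t. cis (2 * pi * t)) ` {- min c (1/2) .. min c (1/2)}"
    then obtain t where "t \<in> {- min c (1/2) .. min c (1/2)}" and z: "z = cis (2 * pi * t)" by blast
    then have "\<bar>t\<bar> \<le> c" by auto
    then show "z \<in> {z. cmod z = 1 \<and> circle_length z \<le> c}"
      using circle_length_le[of t] z by auto
  qed
  moreover have "compact ((\<lambda>t. cis (2 * pi * t)) ` {- min c (1/2) .. min c (1/2)})"
    by (intro compact_continuous_image continuous_intros compact_Icc)
  ultimately show ?thesis by simp
qed

lemma openin_circle_topology_ball:
  "openin circle_topology (ball w e \<inter> {z. cmod z = 1})"
  unfolding circle_topology_def by (metis Int_commute openin_open open_ball)

lemma openin_circle_topologyE: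
  assumes "openin circle_topology U" "w \<in> U"
  obtains e where "0 < e" "\<And>z. cmod z = 1 \<Longrightarrow> dist z w < e \<Longrightarrow> z \<in> U"
proof -
  obtain T where T: "open T" "U = {z. cmod z = 1} \<inter> T"
    using assms(1) unfolding circle_topology_def openin_open by blast
  then obtain e where "0 < e" "ball w e \<subseteq> T" using assms(2) open_contains_ball by blast
  then show ?thesis using T(2) that[of e] by (auto simp: ball_def dist_commute)
qed

lemma topspace_circle_topology [simp]: "topspace circle_topology = {z. cmod z = 1}"
  by (simp add: circle_topology_def)

section \<open>Characters\<close>

lemma circle_group_simps [simp]:
  "carrier circle_group = {z. cmod z = 1}" "mult circle_group = (*)" "one circle_group = 1"
  by (simp_all add: circle_group_def)

lemma continuous_map_circle_iff:
  "continuous_map X circle_topology f \<longleftrightarrow>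
    continuous_map X euclidean f \<and> (\<forall>x\<in>topspace X. cmod (f x) = 1)"
  unfolding circle_topology_def continuous_map_in_subtopology by auto

lemma continuous_map_times:
  fixes f g :: "'a \<Rightarrow> 'b::real_normed_algebra"
  assumes "continuous_map X euclidean f" "continuous_map X euclidean g"
  shows "continuous_map X euclidean (\<lambda>x. f x * g x)"
proof -
  have "continuous_map X (prod_topology euclidean euclidean) (\<lambda>x. (f x, g x))"
    unfolding continuous_map_pairwise using assms by (simp add: o_def)
  moreover have "continuous_map (prod_topology euclidean euclidean) euclidean (\<lambda>(x::'b, y). x * y)"
    unfolding euclidean_product_topology continuous_map_iff_continuous2
    by (simp add: case_prod_beta continuous_intros)
  ultimately show ?thesis
    using continuous_map_compose[of X _ "\<lambda>x. (f x, g x)" _ "\<lambda>(x, y). x * y"] by (simp add: o_def)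
qed

lemma continuous_map_inverse_circle:
  fixes f :: "'a \<Rightarrow> complex"
  assumes "continuous_map X circle_topology f"
  shows "continuous_map X circle_topology (\<lambda>x. inverse (f x))"
proof -
  have "continuous_map X euclidean (cnj \<circ> f)"
    using assms by (intro continuous_map_compose[where X' = euclidean])
      (auto simp: continuous_map_circle_iff continuous_intros)
  moreover have "(cnj \<circ> f) x = inverse (f x)" if "x \<in> topspace X" for x
  proof -
    have "f x * cnj (f x) = 1"
      using that assms complex_norm_square[of "f x"] by (simp add: continuous_map_circle_iff)
    then show ?thesis by (simp add: inverse_unique)
  qed
  ultimately have "continuous_map X euclidean (\<lambda>x. inverse (f x))"
    by (rule continuous_map_eq)
  then show ?thesis using assms by (auto simp: continuous_map_circle_iff norm_inverse)
qed

lemma char_group_simps [simp]: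
  "mult (char_group G X) = (\<lambda>\<phi> \<psi>. \<lambda>x\<in>carrier G. \<phi> x * \<psi> x)"
  "one (char_group G X) = (\<lambda>x\<in>carrier G. 1)"
  by (simp_all add: char_group_def)

lemma mem_char_group_iff:
  "\<phi> \<in> carrier (char_group G X) \<longleftrightarrow> \<phi> \<in> extensional (carrier G) \<and>
    (\<forall>x\<in>carrier G. cmod (\<phi> x) = 1) \<and>
    (\<forall>x\<in>carrier G. \<forall>y\<in>carrier G. \<phi> (x \<otimes>\<^bsub>G\<^esub> y) = \<phi> x * \<phi> y) \<and>
    continuous_map X circle_topology \<phi>"
  by (auto simp: char_group_def hom_def Pi_iff)

lemma char_norm:
  "\<phi> \<in> carrier (char_group G X) \<Longrightarrow> x \<in> carrier G \<Longrightarrow> cmod (\<phi> x) = 1"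
  by (simp add: mem_char_group_iff)

lemma char_mult:
  "\<phi> \<in> carrier (char_group G X) \<Longrightarrow> x \<in> carrier G \<Longrightarrow> y \<in> carrier G \<Longrightarrow>
    \<phi> (x \<otimes>\<^bsub>G\<^esub> y) = \<phi> x * \<phi> y"
  by (simp add: mem_char_group_iff)

lemma char_continuous:
  "\<phi> \<in> carrier (char_group G X) \<Longrightarrow> continuous_map X circle_topology \<phi>"
  by (simp add: mem_char_group_iff)

lemma char_nonzero:
  "\<phi> \<in> carrier (char_group G X) \<Longrightarrow> x \<in> carrier G \<Longrightarrow> \<phi> x \<noteq> 0"
  using char_norm[of \<phi> G X x] by force

lemma char_eqI:
  "\<phi> \<in> carrier (char_group G X) \<Longrightarrow> \<psi> \<in> carrier (char_group G X) \<Longrightarrow>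
    (\<And>x. x \<in> carrier G \<Longrightarrow> \<phi> x = \<psi> x) \<Longrightarrow> \<phi> = \<psi>"
  by (auto simp: mem_char_group_iff intro: extensionalityI)

context group
begin

lemma char_one:
  assumes "\<phi> \<in> carrier (char_group G X)"
  shows "\<phi> \<one> = 1"
proof -
  have "\<phi> \<one> * \<phi> \<one> = \<phi> \<one>" using char_mult[OF assms, of \<one> \<one>] by simp
  then show ?thesis using char_nonzero[OF assms one_closed] by simp
qed

lemma char_inv:
  assumes "\<phi> \<in> carrier (char_group G X)" "x \<in> carrier G"
  shows "\<phi> (inv x) = inverse (\<phi> x)"
proof -
  have "\<phi> x * \<phi> (inv x) = 1"
    using char_mult[OF assms(1), of x "inv x"] char_one[OF assms(1)] assms(2) by simp
  then show ?thesis by (simp add: inverse_unique)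
qed

lemma char_pow:
  assumes "\<phi> \<in> carrier (char_group G X)" "x \<in> carrier G"
  shows "\<phi> (x [^] (n::nat)) = \<phi> x ^ n"
  using assms(2) by (induction n) (simp_all add: char_one[OF assms(1)] char_mult[OF assms(1)])

lemma char_inv_mult_dist:
  assumes \<phi>: "\<phi> \<in> carrier (char_group G X)" and x: "x \<in> carrier G" and y: "y \<in> carrier G"
  shows "cmod (\<phi> (inv x \<otimes> y) - 1) = cmod (\<phi> y - \<phi> x)"
proof -
  have "\<phi> (inv x \<otimes> y) - 1 = inverse (\<phi> x) * (\<phi> y - \<phi> x)"
    using char_mult[OF \<phi>, of "inv x" y] char_inv[OF \<phi> x] char_nonzero[OF \<phi> x] x y
    by (simp add: algebra_simps)
  then show ?thesis using char_norm[OF \<phi> x] by (simp add: norm_mult norm_inverse)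
qed

lemma char_group_inverse_closed:
  assumes X: "topspace X = carrier G" and \<phi>: "\<phi> \<in> carrier (char_group G X)"
  shows "(\<lambda>x\<in>carrier G. inverse (\<phi> x)) \<in> carrier (char_group G X)"
proof -
  have "continuous_map X circle_topology (\<lambda>x. inverse (\<phi> x))"
    by (rule continuous_map_inverse_circle[OF char_continuous[OF \<phi>]])
  then have "continuous_map X circle_topology (\<lambda>x\<in>carrier G. inverse (\<phi> x))"
    by (rule continuous_map_eq) (simp add: X)
  then show ?thesis
    unfolding mem_char_group_iff using char_norm[OF \<phi>] char_mult[OF \<phi>]
    by (simp add: norm_inverse)
qed

end

context comm_group
begin

lemma comm_group_char_group:
  assumes X: "topspace X = carrier G"
  shows "comm_group (char_group G X)"
proof (rule comm_groupI)
  fix \<phi> \<psi> assume \<phi>: "\<phi> \<in> carrier (char_group G X)" and \<psi>: "\<psi> \<in> carrier (char_group G X)"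
  have "continuous_map X euclidean \<phi>" "continuous_map X euclidean \<psi>"
    using char_continuous[OF \<phi>] char_continuous[OF \<psi>] unfolding continuous_map_circle_iff
    by simp_all
  then have "continuous_map X euclidean (\<lambda>x. \<phi> x * \<psi> x)"
    by (rule continuous_map_times)
  then have "continuous_map X circle_topology (\<lambda>x. \<phi> x * \<psi> x)"
    unfolding continuous_map_circle_iff using char_norm[OF \<phi>] char_norm[OF \<psi>] X
    by (simp add: norm_mult)
  then have "continuous_map X circle_topology (\<lambda>x\<in>carrier G. \<phi> x * \<psi> x)"
    by (rule continuous_map_eq) (simp add: X)
  then show "\<phi> \<otimes>\<^bsub>char_group G X\<^esub> \<psi> \<in> carrier (char_group G X)"
    unfolding mem_char_group_iff
    using char_norm[OF \<phi>] char_norm[OF \<psi>] char_mult[OF \<phi>] char_mult[OF \<psi>]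
    by (simp add: norm_mult mult_ac)
next
  have "continuous_map X circle_topology (\<lambda>x. 1)"
    unfolding continuous_map_circle_iff by simp
  then have "continuous_map X circle_topology (\<lambda>x\<in>carrier G. 1)"
    by (rule continuous_map_eq) (simp add: X)
  then show "\<one>\<^bsub>char_group G X\<^esub> \<in> carrier (char_group G X)"
    by (simp add: mem_char_group_iff)
next
  fix \<phi> assume \<phi>: "\<phi> \<in> carrier (char_group G X)"
  show "\<exists>\<psi>\<in>carrier (char_group G X). \<psi> \<otimes>\<^bsub>char_group G X\<^esub> \<phi> = \<one>\<^bsub>char_group G X\<^esub>"
    using char_nonzero[OF \<phi>]
    by (intro bexI[OF _ char_group_inverse_closed[OF X \<phi>]]) (auto simp: restrict_def fun_eq_iff)
  show "\<one>\<^bsub>char_group G X\<^esub> \<otimes>\<^bsub>char_group G X\<^esub> \<phi> = \<phi>"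
    using \<phi> by (simp add: mem_char_group_iff extensional_def fun_eq_iff)
qed (simp_all add: fun_eq_iff mult_ac)

lemma char_group_inv:
  assumes X: "topspace X = carrier G" and \<phi>: "\<phi> \<in> carrier (char_group G X)"
  shows "inv\<^bsub>char_group G X\<^esub> \<phi> = (\<lambda>x\<in>carrier G. inverse (\<phi> x))"
proof -
  interpret dual: comm_group "char_group G X" by (rule comm_group_char_group[OF X])
  show ?thesis
    using char_group_inverse_closed[OF X \<phi>] \<phi> char_nonzero[OF \<phi>]
    by (intro dual.inv_equality) (auto simp: restrict_def fun_eq_iff)
qed

end

section \<open>The metric dual of a metric Abelian group\<close>

locale metric_ab_group =
  fixes G :: "('a, 'b) monoid_scheme" (structure) and p :: "'a \<Rightarrow> real"
  assumes metric_abelian: "metric_abelian_group G p"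

sublocale metric_ab_group \<subseteq> comm_group G
  using metric_abelian by (simp add: metric_abelian_group_def)

sublocale metric_ab_group \<subseteq> met: Metric_space "carrier G" "value_dist G p"
  using metric_abelian by (simp add: metric_abelian_group_def is_value_def)

context metric_ab_group
begin

lemma value_topology_eq: "value_topology G p = met.mtopology"
  by (simp add: value_topology_def)

lemma topspace_value_topology [simp]: "topspace (value_topology G p) = carrier G"
  by (simp add: value_topology_eq)

lemma value_dist_eq: "x \<in> carrier G \<Longrightarrow> y \<in> carrier G \<Longrightarrow> value_dist G p x y = p (inv x \<otimes> y)"
  by (simp add: value_dist_def)

lemma value_dist_one: "x \<in> carrier G \<Longrightarrow> value_dist G p \<one> x = p x"
  by (simp add: value_dist_eq)

lemma value_nonneg: "x \<in> carrier G \<Longrightarrow> 0 \<le> p x"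
  using value_dist_one met.nonneg by metis

lemma value_eq_0_iff: "x \<in> carrier G \<Longrightarrow> p x = 0 \<longleftrightarrow> x = \<one>"
  using value_dist_one met.zero[of \<one> x] by auto

lemma value_one [simp]: "p \<one> = 0"
  by (simp add: value_eq_0_iff)

lemma value_inv: "x \<in> carrier G \<Longrightarrow> p (inv x) = p x"
  using met.commute[of x \<one>] by (simp add: value_dist_eq)

lemma value_mult_le:
  assumes "x \<in> carrier G" "y \<in> carrier G"
  shows "p (x \<otimes> y) \<le> p x + p y"
  using met.triangle[of "inv x" \<one> y] assms by (simp add: value_dist_eq)

lemma value_pow_le:
  assumes "x \<in> carrier G"
  shows "p (x [^] (n::nat)) \<le> real n * p x"
proof (induction n)
  case (Suc n)
  have "p (x [^] Suc n) \<le> p (x [^] n) + p x"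
    using value_mult_le[of "x [^] n" x] assms by simp
  then show ?case using Suc by (simp add: algebra_simps)
qed simp

lemma continuous_map_value_topologyI:
  fixes f :: "'a \<Rightarrow> complex"
  assumes "\<And>x e. x \<in> carrier G \<Longrightarrow> 0 < e \<Longrightarrow>
    \<exists>d>0. \<forall>y\<in>carrier G. value_dist G p x y < d \<longrightarrow> cmod (f y - f x) < e"
  shows "continuous_map (value_topology G p) euclidean f"
proof -
  have "openin met.mtopology {x \<in> carrier G. f x \<in> U}" if U: "open U" for U
    unfolding met.openin_mtopology
  proof (intro conjI allI impI)
    fix x assume x: "x \<in> {x \<in> carrier G. f x \<in> U}"
    then obtain e where e: "0 < e" "ball (f x) e \<subseteq> U"
      using U open_contains_ball by blast
    then obtain d where "0 < d" "\<forall>y\<in>carrier G. value_dist G p x y < d \<longrightarrow> cmod (f y - f x) < e"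
      using assms x by blast
    then show "\<exists>d>0. met.mball x d \<subseteq> {x \<in> carrier G. f x \<in> U}"
      using e(2) by (intro exI[of _ d]) (auto simp: dist_norm norm_minus_commute subset_iff)
  qed auto
  then show ?thesis
    unfolding value_topology_eq continuous_map_def by auto
qed

text \<open>The power \<open>x\<^sup>k\<close> stays in the ball of radius \<open>r\<close> for \<open>k \<le> r / p x\<close>, so the first
  \<open>\<lfloor>r / p x\<rfloor>\<close> powers of \<open>\<phi> x\<close> are close to \<open>1\<close>. For \<open>p x > r\<close> the bound
  exceeds \<open>1\<close>, and lengths are at most \<open>1/2\<close>.\<close>

lemma char_lipschitz_of_near_one_on_ball:
  assumes \<phi>: "\<phi> \<in> carrier (char_group G X)" and r: "0 < r"
    and near: "\<And>x. x \<in> carrier G \<Longrightarrow> p x \<le> r \<Longrightarrow> cmod (\<phi> x - 1) < 1"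
    and x: "x \<in> carrier G"
  shows "circle_length (\<phi> x) \<le> 1 / r * p x"
proof -
  consider "x = \<one>" | "r < p x" | "0 < p x" "p x \<le> r"
    using value_nonneg[OF x] value_eq_0_iff[OF x] by force
  then show ?thesis
  proof cases
    case 1
    then show ?thesis by (simp add: char_one[OF \<phi>])
  next
    case 2
    then have "1 \<le> 1 / r * p x" using r by (simp add: field_simps)
    then show ?thesis using circle_length_bounds(2)[OF char_norm[OF \<phi> x]] by linarith
  next
    case 3
    define n where "n = nat \<lfloor>r / p x\<rfloor>"
    have "1 \<le> r / p x" using 3 by (simp add: field_simps)
    then have n: "0 < n" "real n \<le> r / p x" "r / p x < real n + 1"
      unfolding n_def by (auto simp: of_nat_nat le_nat_iff)
    have "cmod (\<phi> x ^ k - 1) < 1" if "k \<le> n" for k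
    proof -
      have "p (x [^] k) \<le> real k * p x" by (rule value_pow_le[OF x])
      also have "\<dots> \<le> real n * p x" using that 3 by simp
      also have "\<dots> \<le> r" using n(2) 3 by (simp add: field_simps)
      finally show ?thesis using near[of "x [^] k"] x by (simp add: char_pow[OF \<phi>])
    qed
    then have "circle_length (\<phi> x) \<le> 1 / (4 * real n)"
      using circle_length_le_of_powers n(1) char_norm[OF \<phi> x] by simp
    also have "\<dots> \<le> 1 / r * p x"
    proof -
      have "r \<le> (real n + 1) * p x" using n(3) 3 by (simp add: field_simps)
      also have "\<dots> \<le> 4 * real n * p x" using n(1) 3 by (intro mult_right_mono) auto
      finally show ?thesis using r n(1) by (simp add: field_simps)
    qed
    finally show ?thesis .
  qed
qed

lemma dual_char_norm: "\<phi> \<in> carrier (dual_group G p) \<Longrightarrow> x \<in> carrier G \<Longrightarrow> cmod (\<phi> x) = 1"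
  unfolding dual_group_def by (rule char_norm)

lemma dual_char_mult:
  "\<phi> \<in> carrier (dual_group G p) \<Longrightarrow> x \<in> carrier G \<Longrightarrow> y \<in> carrier G \<Longrightarrow>
    \<phi> (x \<otimes> y) = \<phi> x * \<phi> y"
  unfolding dual_group_def by (rule char_mult)

lemma dual_char_eqI:
  "\<phi> \<in> carrier (dual_group G p) \<Longrightarrow> \<psi> \<in> carrier (dual_group G p) \<Longrightarrow>
    (\<And>x. x \<in> carrier G \<Longrightarrow> \<phi> x = \<psi> x) \<Longrightarrow> \<phi> = \<psi>"
  unfolding dual_group_def by (rule char_eqI)

text \<open>By continuity at the identity and the previous lemma, every character has a finite value.\<close>

lemma char_lipschitz:
  assumes \<phi>: "\<phi> \<in> carrier (dual_group G p)"
  obtains M where "0 < M" "\<And>x. x \<in> carrier G \<Longrightarrow> circle_length (\<phi> x) \<le> M * p x"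
proof -
  have \<phi>': "\<phi> \<in> carrier (char_group G met.mtopology)"
    using \<phi> by (simp add: dual_group_def value_topology_eq)
  then have "continuous_map met.mtopology euclidean \<phi>"
    using char_continuous[OF \<phi>'] by (simp add: continuous_map_circle_iff)
  then have "openin met.mtopology {x \<in> carrier G. \<phi> x \<in> ball 1 1}"
    using openin_continuous_map_preimage[of met.mtopology euclidean \<phi> "ball 1 1"] by simp
  then obtain r where r: "0 < r" "met.mball \<one> r \<subseteq> {x \<in> carrier G. \<phi> x \<in> ball 1 1}"
    unfolding met.openin_mtopology using char_one[OF \<phi>'] by force
  have "cmod (\<phi> x - 1) < 1" if "x \<in> carrier G" "p x \<le> r / 2" for x
  proof -
    have "x \<in> met.mball \<one> r" using that r(1) by (simp add: value_dist_one)
    then show ?thesis using r(2) by (auto simp: dist_norm norm_minus_commute)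
  qed
  then have "circle_length (\<phi> x) \<le> 1 / (r / 2) * p x" if "x \<in> carrier G" for x
    using char_lipschitz_of_near_one_on_ball[OF \<phi>', of "r / 2" x] r(1) that by simp
  then show ?thesis using r(1) that[of "1 / (r / 2)"] by simp
qed

text \<open>The infimum ranges over positive constants only, so \<open>M = 0\<close> has to be approached from
  above.\<close>

lemma dual_value_le:
  assumes "0 \<le> M" "\<And>x. x \<in> carrier G \<Longrightarrow> circle_length (\<phi> x) \<le> M * p x"
  shows "dual_value G p \<phi> \<le> M"
proof (rule field_le_epsilon)
  fix e :: real assume "0 < e"
  then have "circle_length (\<phi> x) \<le> (M + e) * p x" if "x \<in> carrier G" for x
    using assms(2)[OF that] value_nonneg[OF that] by (smt (verit) mult_right_mono)
  moreover have "bdd_below {M. 0 < M \<and> (\<forall>x\<in>carrier G. circle_length (\<phi> x) \<le> M * p x)}"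
    by (intro bdd_belowI[of _ 0]) auto
  ultimately show "dual_value G p \<phi> \<le> M + e"
    unfolding dual_value_def using assms(1) \<open>0 < e\<close> by (intro cInf_lower) auto
qed

lemma dual_value_nonneg:
  assumes "\<phi> \<in> carrier (dual_group G p)"
  shows "0 \<le> dual_value G p \<phi>"
proof -
  obtain M where "0 < M" "\<And>x. x \<in> carrier G \<Longrightarrow> circle_length (\<phi> x) \<le> M * p x"
    using char_lipschitz[OF assms] by metis
  then show ?thesis unfolding dual_value_def by (intro cInf_greatest) auto
qed

lemma circle_length_char_le:
  assumes \<phi>: "\<phi> \<in> carrier (dual_group G p)" and x: "x \<in> carrier G"
  shows "circle_length (\<phi> x) \<le> dual_value G p \<phi> * p x"
proof (cases "x = \<one>")
  case True
  then show ?thesis using char_one[of \<phi> "value_topology G p"] \<phi> by (simp add: dual_group_def)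
next
  case False
  then have px: "0 < p x" using value_nonneg[OF x] value_eq_0_iff[OF x] by simp
  obtain M where "0 < M" "\<And>x. x \<in> carrier G \<Longrightarrow> circle_length (\<phi> x) \<le> M * p x"
    using char_lipschitz[OF \<phi>] by metis
  then have "circle_length (\<phi> x) / p x \<le> dual_value G p \<phi>"
    unfolding dual_value_def using x px by (intro cInf_greatest) (auto simp: field_simps)
  then show ?thesis using px by (simp add: field_simps)
qed

lemma cmod_char_diff_1_le:
  assumes \<phi>: "\<phi> \<in> carrier (dual_group G p)" and x: "x \<in> carrier G"
  shows "cmod (\<phi> x - 1) \<le> 2 * pi * (dual_value G p \<phi> * p x)"
proof -
  have "cmod (\<phi> x - 1) \<le> 2 * pi * circle_length (\<phi> x)"
    by (rule cmod_diff_1_le_circle_length[OF dual_char_norm[OF \<phi> x]])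
  also have "\<dots> \<le> 2 * pi * (dual_value G p \<phi> * p x)"
    using circle_length_char_le[OF assms] by simp
  finally show ?thesis .
qed

text \<open>A Lipschitz bound is enough for continuity. This is how characters obtained as limits, and
  evaluations at points, are recognized as members of the dual.\<close>

lemma mem_dual_groupI:
  assumes "\<phi> \<in> extensional (carrier G)" "\<And>x. x \<in> carrier G \<Longrightarrow> cmod (\<phi> x) = 1"
    and mult: "\<And>x y. x \<in> carrier G \<Longrightarrow> y \<in> carrier G \<Longrightarrow> \<phi> (x \<otimes> y) = \<phi> x * \<phi> y"
    and lip: "\<And>x. x \<in> carrier G \<Longrightarrow> circle_length (\<phi> x) \<le> M * p x"
  shows "\<phi> \<in> carrier (dual_group G p)"
proof -
  have "continuous_map (value_topology G p) euclidean \<phi>"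
  proof (rule continuous_map_value_topologyI)
    fix x and e :: real assume x: "x \<in> carrier G" and e: "0 < e"
    have "cmod (\<phi> y - \<phi> x) < e"
      if y: "y \<in> carrier G" and d: "value_dist G p x y < e / (2 * pi * (\<bar>M\<bar> + 1))" for y
    proof -
      have "\<phi> x * \<phi> (inv x \<otimes> y) = \<phi> y"
        using mult[of x "inv x \<otimes> y"] x y by (simp add: m_assoc[symmetric])
      then have "\<phi> y - \<phi> x = \<phi> x * (\<phi> (inv x \<otimes> y) - 1)"
        by (simp add: algebra_simps)
      then have "cmod (\<phi> y - \<phi> x) = cmod (\<phi> (inv x \<otimes> y) - 1)"
        using assms(2)[OF x] by (simp add: norm_mult)
      also have "\<dots> \<le> 2 * pi * circle_length (\<phi> (inv x \<otimes> y))"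
        using cmod_diff_1_le_circle_length assms(2) x y by simp
      also have "\<dots> \<le> 2 * pi * ((\<bar>M\<bar> + 1) * p (inv x \<otimes> y))"
      proof -
        have "M * p (inv x \<otimes> y) \<le> (\<bar>M\<bar> + 1) * p (inv x \<otimes> y)"
          using x y value_nonneg by (intro mult_right_mono) auto
        then have "circle_length (\<phi> (inv x \<otimes> y)) \<le> (\<bar>M\<bar> + 1) * p (inv x \<otimes> y)"
          using lip[of "inv x \<otimes> y"] x y by simp
        then show ?thesis by simp
      qed
      also have "\<dots> < e"
      proof -
        have "0 < 2 * pi * (\<bar>M\<bar> + 1)" by (intro mult_pos_pos) auto
        then have "p (inv x \<otimes> y) * (2 * pi * (\<bar>M\<bar> + 1)) < e"
          using d value_dist_eq[OF x y] pos_less_divide_eq by metis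
        then show ?thesis by (simp only: mult_ac)
      qed
      finally show ?thesis .
    qed
    then show "\<exists>d>0. \<forall>y\<in>carrier G. value_dist G p x y < d \<longrightarrow> cmod (\<phi> y - \<phi> x) < e"
      using e by (intro exI[of _ "e / (2 * pi * (\<bar>M\<bar> + 1))"]) (auto intro!: divide_pos_pos mult_pos_pos)
  qed
  then show ?thesis
    using assms by (simp add: dual_group_def mem_char_group_iff continuous_map_circle_iff)
qed

lemma comm_group_dual_group: "comm_group (dual_group G p)"
  unfolding dual_group_def by (rule comm_group_char_group) simp

lemma dual_group_div_apply:
  assumes "\<phi> \<in> carrier (dual_group G p)" "x \<in> carrier G"
  shows "(inv\<^bsub>dual_group G p\<^esub> \<phi> \<otimes>\<^bsub>dual_group G p\<^esub> \<psi>) x = inverse (\<phi> x) * \<psi> x"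
  using assms char_group_inv[of "value_topology G p" \<phi>] by (simp add: dual_group_def)

lemma cmod_dual_div_diff_1:
  assumes \<phi>: "\<phi> \<in> carrier (dual_group G p)" and x: "x \<in> carrier G"
  shows "cmod ((inv\<^bsub>dual_group G p\<^esub> \<phi> \<otimes>\<^bsub>dual_group G p\<^esub> \<psi>) x - 1) = cmod (\<psi> x - \<phi> x)"
proof -
  have nz: "cmod (\<phi> x) = 1" "\<phi> x \<noteq> 0" using dual_char_norm[OF assms] by auto
  then have "(inv\<^bsub>dual_group G p\<^esub> \<phi> \<otimes>\<^bsub>dual_group G p\<^esub> \<psi>) x - 1 = inverse (\<phi> x) * (\<psi> x - \<phi> x)"
    by (simp add: dual_group_div_apply[OF assms] right_diff_distrib)
  then show ?thesis using nz by (simp add: norm_mult norm_inverse)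
qed

lemma dual_value_mult_le:
  assumes \<phi>: "\<phi> \<in> carrier (dual_group G p)" and \<psi>: "\<psi> \<in> carrier (dual_group G p)"
  shows "dual_value G p (\<phi> \<otimes>\<^bsub>dual_group G p\<^esub> \<psi>) \<le> dual_value G p \<phi> + dual_value G p \<psi>"
proof (rule dual_value_le)
  show "0 \<le> dual_value G p \<phi> + dual_value G p \<psi>" using assms by (simp add: dual_value_nonneg)
  fix x assume x: "x \<in> carrier G"
  have "circle_length (\<phi> x * \<psi> x) \<le> circle_length (\<phi> x) + circle_length (\<psi> x)"
    using \<phi> \<psi> x by (intro circle_length_mult dual_char_norm)
  also have "\<dots> \<le> (dual_value G p \<phi> + dual_value G p \<psi>) * p x"
    using circle_length_char_le[OF \<phi> x] circle_length_char_le[OF \<psi> x] by (simp add: distrib_right)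
  finally show "circle_length ((\<phi> \<otimes>\<^bsub>dual_group G p\<^esub> \<psi>) x) \<le> (dual_value G p \<phi> + dual_value G p \<psi>) * p x"
    using x by (simp add: dual_group_def)
qed

lemma dual_value_inv:
  assumes \<phi>: "\<phi> \<in> carrier (dual_group G p)"
  shows "dual_value G p (inv\<^bsub>dual_group G p\<^esub> \<phi>) = dual_value G p \<phi>"
proof -
  have "circle_length ((inv\<^bsub>dual_group G p\<^esub> \<phi>) x) = circle_length (\<phi> x)" if "x \<in> carrier G" for x
    using \<phi> that char_group_inv[of "value_topology G p" \<phi>] dual_char_norm[OF \<phi> that]
    by (simp add: dual_group_def circle_length_inverse)
  then show ?thesis unfolding dual_value_def by simp
qed

lemma dual_value_eq_0_iff:
  assumes \<phi>: "\<phi> \<in> carrier (dual_group G p)"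
  shows "dual_value G p \<phi> = 0 \<longleftrightarrow> \<phi> = \<one>\<^bsub>dual_group G p\<^esub>"
proof
  interpret dual: comm_group "dual_group G p" by (rule comm_group_dual_group)
  assume 0: "dual_value G p \<phi> = 0"
  have "\<phi> x = 1" if "x \<in> carrier G" for x
    using cmod_char_diff_1_le[OF \<phi> that] 0 by simp
  then show "\<phi> = \<one>\<^bsub>dual_group G p\<^esub>"
    using \<phi> dual.one_closed by (intro dual_char_eqI) (auto simp: dual_group_def)
next
  assume "\<phi> = \<one>\<^bsub>dual_group G p\<^esub>"
  then have "dual_value G p \<phi> \<le> 0" by (intro dual_value_le) (auto simp: dual_group_def)
  then show "dual_value G p \<phi> = 0" using dual_value_nonneg[OF \<phi>] by simp
qed

lemma metric_ab_group_dual: "metric_ab_group (dual_group G p) (dual_value G p)"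
proof
  interpret dual: comm_group "dual_group G p" by (rule comm_group_dual_group)
  let ?G = "dual_group G p" and ?p = "dual_value G p"
  have "Metric_space (carrier ?G) (value_dist ?G ?p)"
  proof
    fix \<phi> \<psi>
    show "0 \<le> value_dist ?G ?p \<phi> \<psi>" by (simp add: value_dist_def dual_value_nonneg)
    show "value_dist ?G ?p \<phi> \<psi> = value_dist ?G ?p \<psi> \<phi>"
    proof (cases "\<phi> \<in> carrier ?G \<and> \<psi> \<in> carrier ?G")
      case True
      then have "inv\<^bsub>?G\<^esub> (inv\<^bsub>?G\<^esub> \<phi> \<otimes>\<^bsub>?G\<^esub> \<psi>) = inv\<^bsub>?G\<^esub> \<psi> \<otimes>\<^bsub>?G\<^esub> \<phi>"
        by (simp add: dual.inv_mult_group)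
      then show ?thesis
        using True dual_value_inv[of "inv\<^bsub>?G\<^esub> \<phi> \<otimes>\<^bsub>?G\<^esub> \<psi>"] by (simp add: value_dist_def)
    qed (auto simp: value_dist_def)
  next
    fix \<phi> \<psi> assume "\<phi> \<in> carrier ?G" "\<psi> \<in> carrier ?G"
    then show "value_dist ?G ?p \<phi> \<psi> = 0 \<longleftrightarrow> \<phi> = \<psi>"
      by (simp add: value_dist_def dual_value_eq_0_iff)
        (metis dual.inv_closed dual.inv_equality dual.inv_inv dual.l_inv)
  next
    fix \<phi> \<psi> \<xi> assume *: "\<phi> \<in> carrier ?G" "\<psi> \<in> carrier ?G" "\<xi> \<in> carrier ?G"
    then have "inv\<^bsub>?G\<^esub> \<phi> \<otimes>\<^bsub>?G\<^esub> \<xi> = (inv\<^bsub>?G\<^esub> \<phi> \<otimes>\<^bsub>?G\<^esub> \<psi>) \<otimes>\<^bsub>?G\<^esub> (inv\<^bsub>?G\<^esub> \<psi> \<otimes>\<^bsub>?G\<^esub> \<xi>)"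
      by (simp add: dual.m_assoc) (simp add: dual.m_assoc[symmetric])
    then show "value_dist ?G ?p \<phi> \<xi> \<le> value_dist ?G ?p \<phi> \<psi> + value_dist ?G ?p \<psi> \<xi>"
      using * dual_value_mult_le by (simp add: value_dist_def)
  qed
  then show "metric_abelian_group ?G ?p"
    by (simp add: metric_abelian_group_def is_value_def comm_group_dual_group dual_value_nonneg)
qed

lemma dual_value_le_of_near_one_on_ball:
  assumes "\<phi> \<in> carrier (dual_group G p)" "0 < r"
    and "\<And>x. x \<in> carrier G \<Longrightarrow> p x \<le> r \<Longrightarrow> cmod (\<phi> x - 1) < 1"
  shows "dual_value G p \<phi> \<le> 1 / r"
  using char_lipschitz_of_near_one_on_ball[of \<phi> "value_topology G p" r] assms
  by (intro dual_value_le) (auto simp: dual_group_def)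

lemma dual_dist_le_of_near_on_ball:
  assumes \<phi>: "\<phi> \<in> carrier (dual_group G p)" and \<psi>: "\<psi> \<in> carrier (dual_group G p)" and r: "0 < r"
    and near: "\<And>x. x \<in> carrier G \<Longrightarrow> p x \<le> r \<Longrightarrow> cmod (\<psi> x - \<phi> x) < 1"
  shows "value_dist (dual_group G p) (dual_value G p) \<phi> \<psi> \<le> 1 / r"
proof -
  interpret dual: metric_ab_group "dual_group G p" "dual_value G p" by (rule metric_ab_group_dual)
  let ?\<chi> = "inv\<^bsub>dual_group G p\<^esub> \<phi> \<otimes>\<^bsub>dual_group G p\<^esub> \<psi>"
  have "dual_value G p ?\<chi> \<le> 1 / r"
  proof (rule dual_value_le_of_near_one_on_ball[OF _ r])
    show "?\<chi> \<in> carrier (dual_group G p)" using \<phi> \<psi> by simp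
    fix x assume x: "x \<in> carrier G" "p x \<le> r"
    show "cmod (?\<chi> x - 1) < 1" using near[OF x] cmod_dual_div_diff_1[OF \<phi> x(1)] by simp
  qed
  then show ?thesis using \<phi> \<psi> by (simp add: dual.value_dist_eq)
qed

lemma cmod_char_diff_le:
  assumes \<phi>: "\<phi> \<in> carrier (dual_group G p)" and \<psi>: "\<psi> \<in> carrier (dual_group G p)"
    and x: "x \<in> carrier G"
  shows "cmod (\<psi> x - \<phi> x) \<le> 2 * pi * (value_dist (dual_group G p) (dual_value G p) \<phi> \<psi> * p x)"
proof -
  interpret dual: metric_ab_group "dual_group G p" "dual_value G p" by (rule metric_ab_group_dual)
  let ?\<chi> = "inv\<^bsub>dual_group G p\<^esub> \<phi> \<otimes>\<^bsub>dual_group G p\<^esub> \<psi>"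
  have "cmod (\<psi> x - \<phi> x) = cmod (?\<chi> x - 1)" by (simp add: cmod_dual_div_diff_1[OF \<phi> x])
  also have "\<dots> \<le> 2 * pi * (dual_value G p ?\<chi> * p x)"
    using \<phi> \<psi> x by (intro cmod_char_diff_1_le) auto
  finally show ?thesis using \<phi> \<psi> by (simp add: dual.value_dist_eq)
qed

end

section \<open>Finite subcovers and cluster points\<close>

lemma compactin_neighbourhoods:
  assumes K: "compactin X K" and V: "\<And>z. z \<in> K \<Longrightarrow> openin X (V z)" "\<And>z. z \<in> K \<Longrightarrow> z \<in> V z"
  obtains A where "finite A" "A \<subseteq> K" "K \<subseteq> \<Union>(V ` A)"
proof -
  have "\<exists>F. finite F \<and> F \<subseteq> V ` K \<and> K \<subseteq> \<Union>F"
    using V by (intro compactinD[OF K]) auto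
  then show thesis using that by (metis finite_subset_image)
qed

lemma compactin_cluster_point:
  assumes K: "compactin X K" and s: "\<And>n::nat. s n \<in> K"
  obtains z where "z \<in> K" "\<And>V N. openin X V \<Longrightarrow> z \<in> V \<Longrightarrow> \<exists>n\<ge>N. s n \<in> V"
proof -
  have "\<exists>z\<in>K. \<forall>V N. openin X V \<longrightarrow> z \<in> V \<longrightarrow> (\<exists>n\<ge>N. s n \<in> V)"
  proof (rule ccontr)
    assume "\<not> ?thesis"
    then obtain V N where V: "\<And>z. z \<in> K \<Longrightarrow> openin X (V z) \<and> z \<in> V z \<and> (\<forall>n\<ge>N z. s n \<notin> V z)"
      by metis
    then have "\<And>z. z \<in> K \<Longrightarrow> openin X (V z)" "\<And>z. z \<in> K \<Longrightarrow> z \<in> V z" by simp_all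
    from compactin_neighbourhoods[OF K this]
    obtain A where A: "finite A" "A \<subseteq> K" "K \<subseteq> \<Union>(V ` A)" .
    define n where "n = (\<Sum>z\<in>A. N z)"
    obtain z where z: "z \<in> A" "s n \<in> V z" using s[of n] A(3) by auto
    have "N z \<le> n" unfolding n_def using A(1) z(1) by (simp add: member_le_sum)
    then show False using V z A(2) by blast
  qed
  then show thesis using that by blast
qed

lemma mult_less_of_less_divide:
  fixes a :: real
  assumes "0 < k" "a < e / k"
  shows "k * a < e"
  using assms by (simp add: pos_less_divide_eq mult.commute)

lemma cmod_triangle_4:
  "cmod (a - e) \<le> cmod (a - b) + cmod (b - c) + cmod (c - d) + cmod (d - e)"
  using norm_triangle_ineq[of "a - b" "b - c"] norm_triangle_ineq[of "a - c" "c - d"]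
    norm_triangle_ineq[of "a - d" "d - e"] by simp

context metric_ab_group
begin

section \<open>Completeness of the dual\<close>

text \<open>A Cauchy sequence of characters converges pointwise, and the sets of points of the circle of
  bounded length are closed, so the Lipschitz bounds pass to the limit.\<close>

theorem mcomplete_dual:
  "Metric_space.mcomplete (carrier (dual_group G p)) (value_dist (dual_group G p) (dual_value G p))"
proof -
  let ?D = "value_dist (dual_group G p) (dual_value G p)"
  interpret dual: metric_ab_group "dual_group G p" "dual_value G p" by (rule metric_ab_group_dual)
  have "\<exists>\<phi>. limitin dual.met.mtopology \<sigma> \<phi> sequentially" if C: "dual.met.MCauchy \<sigma>" for \<sigma>
  proof -
    have \<sigma>: "\<sigma> n \<in> carrier (dual_group G p)" for n
      using C by (auto simp: dual.met.MCauchy_def)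
    have cauchy: "\<exists>N. \<forall>m n. N \<le> m \<longrightarrow> N \<le> n \<longrightarrow> ?D (\<sigma> m) (\<sigma> n) < e" if "0 < e" for e
      using C that by (auto simp: dual.met.MCauchy_def)
    have "convergent (\<lambda>n. \<sigma> n x)" if x: "x \<in> carrier G" for x
    proof (rule Cauchy_convergent, rule CauchyI)
      fix e :: real assume e: "0 < e"
      then have "0 < e / (2 * pi * (p x + 1))" using value_nonneg[OF x] by simp
      then obtain N where N: "\<And>m n. N \<le> m \<Longrightarrow> N \<le> n \<Longrightarrow> ?D (\<sigma> m) (\<sigma> n) < e / (2 * pi * (p x + 1))"
        using cauchy by meson
      have "cmod (\<sigma> m x - \<sigma> n x) < e" if "N \<le> m" "N \<le> n" for m n
      proof -
        have "cmod (\<sigma> m x - \<sigma> n x) \<le> 2 * pi * (?D (\<sigma> n) (\<sigma> m) * p x)"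
          by (rule cmod_char_diff_le[OF \<sigma> \<sigma> x])
        also have "\<dots> \<le> 2 * pi * (?D (\<sigma> n) (\<sigma> m) * (p x + 1))"
          by (intro mult_left_mono) auto
        also have "\<dots> < e"
        proof -
          have "0 < 2 * pi * (p x + 1)" using value_nonneg[OF x] by (intro mult_pos_pos) auto
          from mult_less_of_less_divide[OF this N[OF that(2,1)]] show ?thesis
            by (simp only: mult_ac)
        qed
        finally show ?thesis .
      qed
      then show "\<exists>N. \<forall>m\<ge>N. \<forall>n\<ge>N. cmod (\<sigma> m x - \<sigma> n x) < e" by blast
    qed
    then have "\<exists>l. (\<lambda>n. \<sigma> n x) \<longlonglongrightarrow> l" if "x \<in> carrier G" for x
      using that by (simp add: convergent_def)
    then obtain f where f: "\<And>x. x \<in> carrier G \<Longrightarrow> (\<lambda>n. \<sigma> n x) \<longlonglongrightarrow> f x" by metis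
    define \<phi> where "\<phi> = restrict f (carrier G)"
    have lim: "(\<lambda>n. \<sigma> n x) \<longlonglongrightarrow> \<phi> x" if "x \<in> carrier G" for x
      using f[OF that] that by (simp add: \<phi>_def)
    have norm: "cmod (\<phi> x) = 1" if x: "x \<in> carrier G" for x
    proof -
      have "(\<lambda>n. cmod (\<sigma> n x)) \<longlonglongrightarrow> cmod (\<phi> x)" by (rule tendsto_norm[OF lim[OF x]])
      then show ?thesis using dual_char_norm[OF \<sigma> x] by (simp add: LIMSEQ_const_iff)
    qed
    have mult: "\<phi> (x \<otimes> y) = \<phi> x * \<phi> y" if x: "x \<in> carrier G" and y: "y \<in> carrier G" for x y
    proof (rule LIMSEQ_unique[OF lim])
      show "(\<lambda>n. \<sigma> n (x \<otimes> y)) \<longlonglongrightarrow> \<phi> x * \<phi> y"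
        unfolding dual_char_mult[OF \<sigma> x y] by (intro tendsto_mult lim x y)
    qed (use x y in simp)
    have tail: "\<exists>N. \<forall>n\<ge>N. \<forall>x\<in>carrier G. circle_length (inverse (\<phi> x) * \<sigma> n x) \<le> e * p x"
      if e: "0 < e" for e
    proof -
      obtain N where N: "\<And>m n. N \<le> m \<Longrightarrow> N \<le> n \<Longrightarrow> ?D (\<sigma> m) (\<sigma> n) < e"
        using cauchy[OF e] by meson
      have "circle_length (inverse (\<phi> x) * \<sigma> n x) \<le> e * p x"
        if n: "N \<le> n" and x: "x \<in> carrier G" for n x
      proof -
        let ?C = "{z. cmod z = 1 \<and> circle_length z \<le> e * p x}"
        have cl: "closed ?C"
          using e value_nonneg[OF x] by (intro compact_imp_closed compact_circle_length_le) simp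
        have mem: "inverse (\<sigma> (m + N) x) * \<sigma> n x \<in> ?C" for m
        proof -
          let ?\<xi> = "inv\<^bsub>dual_group G p\<^esub> \<sigma> (m + N) \<otimes>\<^bsub>dual_group G p\<^esub> \<sigma> n"
          have "circle_length (?\<xi> x) \<le> dual_value G p ?\<xi> * p x"
            using \<sigma> x by (intro circle_length_char_le) auto
          also have "\<dots> \<le> e * p x"
            using N[of "m + N" n] n \<sigma> value_nonneg[OF x]
            by (intro mult_right_mono) (simp_all add: dual.value_dist_eq)
          finally show ?thesis
            using dual_char_norm[OF \<sigma> x] by (simp add: dual_group_div_apply \<sigma> x norm_mult norm_inverse)
        qed
        have "(\<lambda>m. inverse (\<sigma> (m + N) x) * \<sigma> n x) \<longlonglongrightarrow> inverse (\<phi> x) * \<sigma> n x"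
          using norm[OF x] by (intro tendsto_intros LIMSEQ_ignore_initial_segment[OF lim[OF x]]) auto
        with cl mem have "inverse (\<phi> x) * \<sigma> n x \<in> ?C" by (rule closed_sequentially)
        then show ?thesis by simp
      qed
      then show ?thesis by blast
    qed
    have "\<phi> \<in> carrier (dual_group G p)"
    proof -
      obtain N where N: "\<And>x. x \<in> carrier G \<Longrightarrow> circle_length (inverse (\<phi> x) * \<sigma> N x) \<le> 1 * p x"
        using tail[of 1] by auto
      show ?thesis
      proof (rule mem_dual_groupI[OF _ norm mult])
        fix x assume x: "x \<in> carrier G"
        let ?w = "inverse (\<phi> x) * \<sigma> N x"
        have w: "cmod ?w = 1" using norm[OF x] dual_char_norm[OF \<sigma> x] by (simp add: norm_mult norm_inverse)
        have "\<sigma> N x \<noteq> 0" using dual_char_norm[OF \<sigma> x, of N] by auto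
        then have eq: "\<phi> x = \<sigma> N x * inverse ?w" by simp
        have "cmod (inverse ?w) = 1" unfolding norm_inverse w by simp
        then have "circle_length (\<sigma> N x * inverse ?w) \<le> circle_length (\<sigma> N x) + circle_length (inverse ?w)"
          by (intro circle_length_mult dual_char_norm[OF \<sigma> x])
        then have "circle_length (\<phi> x) \<le> circle_length (\<sigma> N x) + circle_length ?w"
          unfolding circle_length_inverse[OF w] eq[symmetric] .
        also have "\<dots> \<le> (dual_value G p (\<sigma> N) + 1) * p x"
          using N[OF x] circle_length_char_le[OF \<sigma> x, of N] by (simp add: distrib_right)
        finally show "circle_length (\<phi> x) \<le> (dual_value G p (\<sigma> N) + 1) * p x" .
      qed (simp add: \<phi>_def restrict_extensional del: restrict_apply)
    qed
    moreover have "\<forall>\<^sub>F n in sequentially. \<sigma> n \<in> carrier (dual_group G p) \<and> ?D (\<sigma> n) \<phi> < e"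
      if e: "0 < e" for e
    proof -
      obtain N where N: "\<And>n x. N \<le> n \<Longrightarrow> x \<in> carrier G \<Longrightarrow>
          circle_length (inverse (\<phi> x) * \<sigma> n x) \<le> e / 2 * p x"
        using tail[of "e / 2"] e by auto
      have "?D (\<sigma> n) \<phi> < e" if n: "N \<le> n" for n
      proof -
        have "?D \<phi> (\<sigma> n) \<le> e / 2"
          unfolding dual.value_dist_eq[OF \<open>\<phi> \<in> _\<close> \<sigma>]
          using N[OF n] e by (intro dual_value_le) (simp_all add: dual_group_div_apply \<open>\<phi> \<in> _\<close>)
        then show ?thesis using e by (simp add: dual.met.commute)
      qed
      then show ?thesis using \<sigma> by (auto simp: eventually_sequentially)
    qed
    ultimately show ?thesis by (auto simp: dual.met.limitin_metric)
  qed
  then show ?thesis by (simp add: dual.met.mcomplete_def)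
qed

section \<open>Compactness of balls of the dual\<close>

text \<open>The analogue of the Banach-Alaoglu theorem: the ball is the intersection of a product of
  compact subsets of the circle with the closed set of homomorphisms.\<close>

theorem compactin_dual_ball_pointwise:
  assumes r: "0 \<le> r"
  shows "compactin (product_topology (\<lambda>_. euclidean) (carrier G))
    {\<phi> \<in> carrier (dual_group G p). dual_value G p \<phi> \<le> r}"
proof -
  let ?P = "product_topology (\<lambda>_. euclidean :: complex topology) (carrier G)"
  let ?C = "\<lambda>x. {z. cmod z = 1 \<and> circle_length z \<le> r * p x}"
  let ?E = "\<lambda>(x, y). {f \<in> topspace ?P. f (x \<otimes> y) = f x * f y}"
  have prod: "compactin ?P (PiE (carrier G) ?C)"
    unfolding compactin_PiE using r value_nonneg by (simp add: compact_circle_length_le)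
  have hom: "closedin ?P (\<Inter>z\<in>carrier G \<times> carrier G. ?E z)"
  proof (rule closedin_INT)
    fix z assume "z \<in> carrier G \<times> carrier G"
    then obtain x y where z: "z = (x, y)" "x \<in> carrier G" "y \<in> carrier G" by auto
    have proj: "continuous_map ?P euclidean (\<lambda>f. f u)" if "u \<in> carrier G" for u
      using continuous_map_product_projection[OF that, of "\<lambda>_. euclidean"] by simp
    have "closedin ?P {f \<in> topspace ?P. f (x \<otimes> y) = f x * f y}"
      using z by (intro closedin_continuous_maps_eq[where Y = euclidean] proj continuous_map_times) auto
    then show "closedin ?P (?E z)" using z by simp
  qed auto
  have "{\<phi> \<in> carrier (dual_group G p). dual_value G p \<phi> \<le> r} =
      (\<Inter>z\<in>carrier G \<times> carrier G. ?E z) \<inter> PiE (carrier G) ?C"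
  proof (intro equalityI subsetI)
    fix \<phi> assume "\<phi> \<in> {\<phi> \<in> carrier (dual_group G p). dual_value G p \<phi> \<le> r}"
    then have \<phi>: "\<phi> \<in> carrier (dual_group G p)" and "dual_value G p \<phi> \<le> r" by auto
    then have "circle_length (\<phi> x) \<le> r * p x" if "x \<in> carrier G" for x
      using circle_length_char_le[OF \<phi> that] value_nonneg[OF that] mult_right_mono order_trans by meson
    moreover have "\<phi> \<in> extensional (carrier G)"
      using \<phi> by (simp add: dual_group_def mem_char_group_iff)
    ultimately show "\<phi> \<in> (\<Inter>z\<in>carrier G \<times> carrier G. ?E z) \<inter> PiE (carrier G) ?C"
      using dual_char_norm[OF \<phi>] dual_char_mult[OF \<phi>] by (auto simp: PiE_def)
  next
    fix \<phi> assume \<phi>: "\<phi> \<in> (\<Inter>z\<in>carrier G \<times> carrier G. ?E z) \<inter> PiE (carrier G) ?C"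
    then have lip: "circle_length (\<phi> x) \<le> r * p x" if "x \<in> carrier G" for x
      using that by auto
    have "\<phi> \<in> extensional (carrier G)" using \<phi> by (auto simp: PiE_def)
    then have "\<phi> \<in> carrier (dual_group G p)"
      using \<phi> by (intro mem_dual_groupI[OF _ _ _ lip]) auto
    then show "\<phi> \<in> {\<phi> \<in> carrier (dual_group G p). dual_value G p \<phi> \<le> r}"
      using dual_value_le[OF r lip] by simp
  qed
  then show ?thesis using closed_Int_compactin[OF hom prod] by (simp only:)
qed

section \<open>Weakly compact sets are equicontinuous on the dual\<close>

lemma topspace_weak_topology [simp]: "topspace (weak_topology G p) = carrier G"
proof -
  interpret dual: metric_ab_group "dual_group G p" "dual_value G p" by (rule metric_ab_group_dual)
  have "{x \<in> carrier G. \<one>\<^bsub>dual_group G p\<^esub> x \<in> topspace circle_topology} = carrier G"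
    using dual_char_norm[OF dual.one_closed] by auto
  then show ?thesis
    unfolding weak_topology_def topology_generated_by_topspace
    using dual.one_closed openin_topspace[of circle_topology] by blast
qed

lemma openin_weak_topology_near:
  assumes \<xi>: "\<xi> \<in> carrier (dual_group G p)"
  shows "openin (weak_topology G p) {y \<in> carrier G. cmod (\<xi> y - w) < e}"
proof -
  have "{y \<in> carrier G. cmod (\<xi> y - w) < e} =
      {y \<in> carrier G. \<xi> y \<in> ball w e \<inter> {z. cmod z = 1}}"
    using dual_char_norm[OF \<xi>] by (auto simp: dist_norm norm_minus_commute)
  then show ?thesis
    unfolding weak_topology_def using \<xi> openin_circle_topology_ball
    by (intro topology_generated_by_Basis) blast
qed

lemma openin_weak_topology_far:
  assumes \<xi>: "\<xi> \<in> carrier (dual_group G p)"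
  shows "openin (weak_topology G p) {y \<in> carrier G. e < cmod (\<xi> y - w)}"
proof -
  have "{y \<in> carrier G. e < cmod (\<xi> y - w)} =
      {y \<in> carrier G. \<xi> y \<in> {z. cmod z = 1} \<inter> - cball w e}"
    using dual_char_norm[OF \<xi>] by (auto simp: dist_norm norm_minus_commute)
  moreover have "openin circle_topology ({z. cmod z = 1} \<inter> - cball w e)"
    unfolding circle_topology_def by (intro openin_open_Int open_Compl closed_cball)
  ultimately show ?thesis
    unfolding weak_topology_def using \<xi> by (intro topology_generated_by_Basis) blast
qed

text \<open>A gliding hump. If the claim failed at \<open>x\<close>, characters \<open>\<xi>\<^sub>k\<close> of rapidly decreasing value and
  points \<open>y\<^sub>k\<close> of \<open>K\<close> could be chosen such that \<open>\<xi>\<^sub>k(y\<^sub>k)\<close> is far from \<open>1\<close>, while \<open>y\<^sub>k\<close> nearly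
  agrees with \<open>x\<close> on the earlier characters and the later characters are close to \<open>1\<close> at \<open>x\<close> and \<open>y\<^sub>k\<close>.
  By completeness the product \<open>\<phi>\<close> of all \<open>\<xi>\<^sub>k\<close> exists, and \<open>\<phi>(y\<^sub>k)\<close> stays away from \<open>\<phi>(x)\<close>.
  But a weak cluster point \<open>z \<in> K\<close> of the \<open>y\<^sub>k\<close> nearly agrees with \<open>x\<close> on all partial products,
  hence on \<open>\<phi>\<close>. The induction below carries the partial product \<open>\<Psi>\<close>, the weak neighbourhood \<open>U\<close> of \<open>x\<close>
  from which the next point is taken, and the bound \<open>c\<close> for the value of the next character.\<close>

lemma weakly_compact_equicontinuous_at:
  assumes K: "compactin (weak_topology G p) K" and x: "x \<in> K" and \<delta>: "0 < \<delta>"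
  shows "\<exists>U c. openin (weak_topology G p) U \<and> x \<in> U \<and> 0 < c \<and>
    (\<forall>\<xi>\<in>carrier (dual_group G p). dual_value G p \<xi> < c \<longrightarrow> (\<forall>y\<in>K \<inter> U. cmod (\<xi> y - 1) \<le> \<delta>))"
proof (rule ccontr)
  let ?W = "weak_topology G p" and ?G = "dual_group G p" and ?p = "dual_value G p"
  let ?D = "value_dist ?G ?p"
  interpret dual: metric_ab_group ?G ?p by (rule metric_ab_group_dual)
  assume contra: "\<not> ?thesis"
  have hump: "\<exists>\<xi>\<in>carrier ?G. \<exists>y\<in>K \<inter> U. ?p \<xi> < c \<and> \<delta> < cmod (\<xi> y - 1)"
    if "openin ?W U" "x \<in> U" "0 < c" for U c
  proof (rule ccontr)
    assume "\<not> ?thesis"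
    then have "cmod (\<xi> y - 1) \<le> \<delta>" if "\<xi> \<in> carrier ?G" "?p \<xi> < c" "y \<in> K \<inter> U" for \<xi> y
      using that not_less by blast
    with that contra show False by blast
  qed
  have KG: "K \<subseteq> carrier G" using compactin_subset_topspace[OF K] by simp
  then have xG: "x \<in> carrier G" using x by auto
  \<comment> \<open>The partial products differ from their limit by at most \<open>2c\<close> in value, hence by at most
    \<open>4\<pi> c p(u)\<close> at a point \<open>u\<close>; keeping \<open>c p(u) \<le> \<kappa>\<close> makes this at most \<open>\<delta>/8\<close>.\<close>
  define \<kappa> where "\<kappa> = \<delta> / (32 * pi)"
  have \<kappa>: "0 < \<kappa>" "4 * pi * \<kappa> = \<delta> / 8" using \<delta> by (auto simp: \<kappa>_def)
  define P where "P = (\<lambda>(\<Psi>, U, c). \<Psi> \<in> carrier ?G \<and> openin ?W U \<and> x \<in> U \<and>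
      (\<forall>y\<in>U. cmod (\<Psi> y - \<Psi> x) < \<delta> / 8) \<and> 0 < c \<and> c * p x \<le> \<kappa>)"
  define Q where "Q = (\<lambda>(\<Psi>, U, c) (\<Psi>', U', c'). U' \<subseteq> U \<and> 2 * c' \<le> c \<and>
      (\<exists>\<xi>\<in>carrier ?G. ?p \<xi> < c \<and> \<Psi>' = \<Psi> \<otimes>\<^bsub>?G\<^esub> \<xi> \<and>
        (\<exists>y\<in>K \<inter> U. \<delta> < cmod (\<xi> y - 1) \<and> c' * p y \<le> \<kappa>)))"
  have small: "0 < \<kappa> / (p y + 1)" "\<kappa> / (p y + 1) * p y \<le> \<kappa>" if "y \<in> carrier G" for y
    using value_nonneg[OF that] \<kappa>(1) by (simp_all add: field_simps)
  have "\<exists>s. P s"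
  proof
    have "cmod (\<one>\<^bsub>?G\<^esub> y - \<one>\<^bsub>?G\<^esub> x) < \<delta> / 8" if "y \<in> carrier G" for y
      using \<delta> that xG by (simp add: dual_group_def)
    then show "P (\<one>\<^bsub>?G\<^esub>, carrier G, \<kappa> / (p x + 1))"
      using small[OF xG] xG openin_topspace[of ?W] by (simp add: P_def)
  qed
  moreover have "\<exists>s'. P s' \<and> Q s s'" if "P s" for s
  proof -
    obtain \<Psi> U c where s: "s = (\<Psi>, U, c)" by (cases s)
    have \<Psi>: "\<Psi> \<in> carrier ?G" and U: "openin ?W U" "x \<in> U" and c: "0 < c" "c * p x \<le> \<kappa>"
      using \<open>P s\<close> by (auto simp: P_def s)
    obtain \<xi> y where \<xi>: "\<xi> \<in> carrier ?G" "?p \<xi> < c" and y: "y \<in> K \<inter> U" "\<delta> < cmod (\<xi> y - 1)"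
      using hump[OF U c(1)] by blast
    let ?\<Psi> = "\<Psi> \<otimes>\<^bsub>?G\<^esub> \<xi>" and ?c = "min (c / 2) (\<kappa> / (p y + 1))"
    let ?U = "U \<inter> {y \<in> carrier G. cmod (?\<Psi> y - ?\<Psi> x) < \<delta> / 8}"
    have yG: "y \<in> carrier G" using y KG by auto
    have \<Psi>': "?\<Psi> \<in> carrier ?G" using \<Psi> \<xi> by simp
    have "?c * p y \<le> \<kappa> / (p y + 1) * p y"
      by (rule mult_right_mono[OF min.cobounded2 value_nonneg[OF yG]])
    moreover have "?c * p x \<le> c * p x"
      using c(1) by (intro mult_right_mono value_nonneg[OF xG]) simp
    ultimately have "?c * p y \<le> \<kappa>" "?c * p x \<le> \<kappa>"
      using small(2)[OF yG] c by linarith+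
    moreover have "0 < ?c" using c small(1)[OF yG] by simp
    moreover have "openin ?W ?U"
      using U \<Psi>' by (intro openin_Int openin_weak_topology_near)
    ultimately have "P (?\<Psi>, ?U, ?c) \<and> Q s (?\<Psi>, ?U, ?c)"
      using \<Psi>' U xG \<delta> \<xi> y by (auto simp: P_def Q_def s)
    then show ?thesis by blast
  qed
  ultimately obtain s where s: "\<And>n. P (s n)" "\<And>n. Q (s n) (s (Suc n))"
    using dependent_nat_choice[of "\<lambda>_. P" "\<lambda>_. Q"] by metis
  define \<Psi> U c where "\<Psi> = (\<lambda>n. fst (s n))" and "U = (\<lambda>n. fst (snd (s n)))"
    and "c = (\<lambda>n. snd (snd (s n)))"
  have s_eq: "s n = (\<Psi> n, U n, c n)" for n by (simp add: \<Psi>_def U_def c_def)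
  have \<Psi>: "\<Psi> n \<in> carrier ?G" and U: "openin ?W (U n)" "x \<in> U n"
    and close: "\<And>y. y \<in> U n \<Longrightarrow> cmod (\<Psi> n y - \<Psi> n x) < \<delta> / 8"
    and c: "0 < c n" "c n * p x \<le> \<kappa>" for n
    using s(1)[of n] by (auto simp: P_def s_eq)
  have step: "U (Suc n) \<subseteq> U n" "2 * c (Suc n) \<le> c n"
    "\<exists>\<xi>\<in>carrier ?G. ?p \<xi> < c n \<and> \<Psi> (Suc n) = \<Psi> n \<otimes>\<^bsub>?G\<^esub> \<xi> \<and>
      (\<exists>y\<in>K \<inter> U n. \<delta> < cmod (\<xi> y - 1) \<and> c (Suc n) * p y \<le> \<kappa>)" for n
    using s(2)[of n] by (auto simp: Q_def s_eq)
  obtain \<xi> where \<xi>: "\<And>n. \<xi> n \<in> carrier ?G" "\<And>n. ?p (\<xi> n) < c n"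
      "\<And>n. \<Psi> (Suc n) = \<Psi> n \<otimes>\<^bsub>?G\<^esub> \<xi> n"
    and "\<And>n. \<exists>y\<in>K \<inter> U n. \<delta> < cmod (\<xi> n y - 1) \<and> c (Suc n) * p y \<le> \<kappa>"
    using step(3) by metis
  then obtain y where y: "\<And>n. y n \<in> K" "\<And>n. y n \<in> U n" "\<And>n. \<delta> < cmod (\<xi> n (y n) - 1)"
      "\<And>n. c (Suc n) * p (y n) \<le> \<kappa>"
    by (metis IntE)
  have U_mono: "U k \<subseteq> U j" if "j \<le> k" for j k
    using lift_Suc_antimono_le[of U, OF step(1) that] .
  have D_Suc: "?D (\<Psi> k) (\<Psi> (Suc k)) < c k" for k
  proof -
    have "inv\<^bsub>?G\<^esub> \<Psi> k \<otimes>\<^bsub>?G\<^esub> \<Psi> (Suc k) = \<xi> k"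
      using \<Psi> \<xi> by (simp add: dual.m_assoc[symmetric])
    then show ?thesis using \<Psi> \<xi>(2) by (simp add: dual.value_dist_eq)
  qed
  have D_le: "?D (\<Psi> j) (\<Psi> k) \<le> 2 * c j - 2 * c k" if "j \<le> k" for j k
    using that
  proof (induction k rule: dec_induct)
    case (step k)
    have "?D (\<Psi> j) (\<Psi> (Suc k)) \<le> ?D (\<Psi> j) (\<Psi> k) + ?D (\<Psi> k) (\<Psi> (Suc k))"
      using \<Psi> by (intro dual.met.triangle)
    then show ?case using step.IH D_Suc[of k] \<open>\<And>n. 2 * c (Suc n) \<le> c n\<close>[of k] by linarith
  qed (simp add: \<Psi>)
  have c_le: "c n \<le> c 0 * (1 / 2) ^ n" for n
  proof (induction n)
    case (Suc n)
    then show ?case using step(2)[of n] by simp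
  qed simp
  have geometric: "(\<lambda>n. c 0 * (1 / 2) ^ n) \<longlonglongrightarrow> 0"
    by (intro tendsto_mult_right_zero LIMSEQ_realpow_zero) auto
  have "\<forall>n. 0 \<le> c n" "\<forall>n. c n \<le> c 0 * (1 / 2) ^ n"
    using less_imp_le[OF c(1)] c_le by blast+
  then have c_lim: "c \<longlonglongrightarrow> 0"
    by (rule tendsto_sandwich[OF always_eventually always_eventually tendsto_const geometric])
  have c_small: "\<exists>n. c n < e" if "0 < e" for e
    using eventually_happens[OF order_tendstoD(2)[OF c_lim that]] by simp
  have "dual.met.MCauchy \<Psi>"
    unfolding dual.met.MCauchy_def
  proof (intro conjI strip)
    show "range \<Psi> \<subseteq> carrier ?G" using \<Psi> by blast
    fix e :: real assume "0 < e"
    then have "0 < e / 4" by simp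
    from c_small[OF this] obtain N where N: "c N < e / 4" ..
    have "?D (\<Psi> m) (\<Psi> n) < e" if "N \<le> m" "N \<le> n" for m n
    proof -
      have "?D (\<Psi> m) (\<Psi> n) \<le> ?D (\<Psi> N) (\<Psi> m) + ?D (\<Psi> N) (\<Psi> n)"
        by (rule dual.met.triangle''[OF \<Psi> \<Psi> \<Psi>])
      with D_le[OF that(1)] D_le[OF that(2)] c(1)[of m] c(1)[of n] N show ?thesis by linarith
    qed
    then show "\<exists>N. \<forall>n n'. N \<le> n \<longrightarrow> N \<le> n' \<longrightarrow> ?D (\<Psi> n) (\<Psi> n') < e" by blast
  qed
  then obtain \<phi> where "limitin dual.met.mtopology \<Psi> \<phi> sequentially"
    using mcomplete_dual by (auto simp: dual.met.mcomplete_def)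
  then have \<phi>: "\<phi> \<in> carrier ?G"
    and lim: "\<And>e. 0 < e \<Longrightarrow> \<exists>N. \<forall>n\<ge>N. ?D (\<Psi> n) \<phi> < e"
    by (auto simp: dual.met.limitin_metric eventually_sequentially) meson
  have D_lim: "?D (\<Psi> j) \<phi> \<le> 2 * c j" for j
  proof (rule field_le_epsilon)
    fix e :: real assume "0 < e"
    then obtain N where "\<forall>n\<ge>N. ?D (\<Psi> n) \<phi> < e" using lim by blast
    then have "?D (\<Psi> (max j N)) \<phi> < e" by simp
    then show "?D (\<Psi> j) \<phi> \<le> 2 * c j + e"
      using dual.met.triangle[OF \<Psi> \<Psi> \<phi>, of j "max j N"] D_le[of j "max j N"] c(1)[of "max j N"] by simp
  qed
  have \<phi>_near: "cmod (\<phi> u - \<Psi> j u) \<le> 4 * pi * (c j * p u)" if u: "u \<in> carrier G" for u j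
  proof -
    have "cmod (\<phi> u - \<Psi> j u) \<le> 2 * pi * (?D (\<Psi> j) \<phi> * p u)"
      by (rule cmod_char_diff_le[OF \<Psi> \<phi> u])
    also have "\<dots> \<le> 2 * pi * (2 * c j * p u)"
      using D_lim[of j] value_nonneg[OF u] by (intro mult_left_mono mult_right_mono) auto
    finally show ?thesis by simp
  qed
  have yG: "y k \<in> carrier G" for k using y(1) KG by auto
  \<comment> \<open>The jump \<open>\<delta>\<close> of the \<open>k\<close>-th factor survives three errors of at most \<open>\<delta>/8\<close>.\<close>
  have far: "5 * \<delta> / 8 < cmod (\<phi> (y k) - \<phi> x)" for k
  proof -
    have "\<Psi> (Suc k) (y k) - \<Psi> k (y k) = \<Psi> k (y k) * (\<xi> k (y k) - 1)"
      using yG[of k] by (simp add: \<xi>(3) dual_group_def algebra_simps)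
    then have "\<delta> < cmod (\<Psi> (Suc k) (y k) - \<Psi> k (y k))"
      using y(3)[of k] dual_char_norm[OF \<Psi> yG, of k k] by (simp add: norm_mult)
    moreover have "cmod (\<phi> (y k) - \<Psi> (Suc k) (y k)) \<le> \<delta> / 8"
      using \<phi>_near[OF yG, of k "Suc k"] y(4)[of k] \<kappa>(2) mult_left_mono[of _ \<kappa> "4 * pi"]
      by (smt (verit) pi_gt_zero)
    moreover have "cmod (\<phi> x - \<Psi> k x) \<le> \<delta> / 8"
      using \<phi>_near[OF xG, of k] c(2)[of k] \<kappa>(2) mult_left_mono[of _ \<kappa> "4 * pi"]
      by (smt (verit) pi_gt_zero)
    moreover have "cmod (\<Psi> k (y k) - \<Psi> k x) < \<delta> / 8" by (rule close[OF y(2)])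
    ultimately show ?thesis
      using cmod_triangle_4[of "\<Psi> (Suc k) (y k)" "\<Psi> k (y k)" "\<phi> (y k)" "\<phi> x" "\<Psi> k x"]
      by (simp add: norm_minus_commute)
  qed
  \<comment> \<open>The cluster point \<open>z\<close> and \<open>x\<close> are nearly equal on a late partial product, hence on the
    limit, and this contradicts the previous step for some \<open>y\<^sub>k\<close> close to \<open>z\<close>.\<close>
  obtain z where z: "z \<in> K" and cluster: "\<And>V N. openin ?W V \<Longrightarrow> z \<in> V \<Longrightarrow> \<exists>n\<ge>N. y n \<in> V"
    using compactin_cluster_point[OF K, of y] y(1) by blast
  have zG: "z \<in> carrier G" using z KG by auto
  have pos: "0 < 16 * (4 * pi) * (p z + p x + 1)"
    using value_nonneg[OF zG] value_nonneg[OF xG] by (intro mult_pos_pos) auto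
  then have "0 < \<delta> / (16 * (4 * pi) * (p z + p x + 1))"
    using \<delta> by (rule divide_pos_pos[rotated])
  then obtain j where j: "c j < \<delta> / (16 * (4 * pi) * (p z + p x + 1))" using c_small by blast
  have "4 * pi * (c j * (p z + p x + 1)) < \<delta> / 16"
    using mult_less_of_less_divide[OF pos j] by (simp add: field_simps)
  moreover have "c j * p z \<le> c j * (p z + p x + 1)" "c j * p x \<le> c j * (p z + p x + 1)"
    using c(1)[of j] value_nonneg[OF zG] value_nonneg[OF xG] by (auto intro!: mult_left_mono)
  ultimately have near_j: "cmod (\<phi> z - \<Psi> j z) < \<delta> / 16" "cmod (\<phi> x - \<Psi> j x) < \<delta> / 16"
    using \<phi>_near[OF zG, of j] \<phi>_near[OF xG, of j]
    by (smt (verit) mult_left_mono pi_gt_zero)+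
  have "openin ?W ({u \<in> carrier G. cmod (\<phi> u - \<phi> z) < \<delta> / 16} \<inter> {u \<in> carrier G. cmod (\<Psi> j u - \<Psi> j z) < \<delta> / 16})"
    by (intro openin_Int openin_weak_topology_near \<phi> \<Psi>)
  from cluster[OF this, of j] obtain k where k: "j \<le> k" "cmod (\<phi> (y k) - \<phi> z) < \<delta> / 16"
      "cmod (\<Psi> j (y k) - \<Psi> j z) < \<delta> / 16"
    using zG \<delta> by auto
  have "cmod (\<Psi> j (y k) - \<Psi> j x) < \<delta> / 8"
    using y(2)[of k] U_mono[OF k(1)] by (intro close) auto
  then have "cmod (\<phi> (y k) - \<phi> x) < 5 * \<delta> / 8"
    using cmod_triangle_4[of "\<phi> (y k)" "\<Psi> j x" "\<phi> z" "\<Psi> j z" "\<Psi> j (y k)"] k near_j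
      norm_triangle_ineq[of "\<phi> (y k) - \<Psi> j x" "\<Psi> j x - \<phi> x"] \<delta>
    by (simp add: norm_minus_commute)
  then show False using far[of k] by simp
qed

theorem weakly_compact_equicontinuous:
  assumes K: "compactin (weak_topology G p) K" and \<delta>: "0 < \<delta>"
  obtains c where "0 < c"
    "\<And>\<xi> y. \<xi> \<in> carrier (dual_group G p) \<Longrightarrow> dual_value G p \<xi> < c \<Longrightarrow> y \<in> K \<Longrightarrow> cmod (\<xi> y - 1) \<le> \<delta>"
proof -
  obtain U c where U: "\<And>x. x \<in> K \<Longrightarrow> openin (weak_topology G p) (U x) \<and> x \<in> U x \<and> 0 < c x \<and>
      (\<forall>\<xi>\<in>carrier (dual_group G p). dual_value G p \<xi> < c x \<longrightarrow>
        (\<forall>y\<in>K \<inter> U x. cmod (\<xi> y - 1) \<le> \<delta>))"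
    using weakly_compact_equicontinuous_at[OF K _ \<delta>] by metis
  then have "\<And>x. x \<in> K \<Longrightarrow> openin (weak_topology G p) (U x)" "\<And>x. x \<in> K \<Longrightarrow> x \<in> U x"
    by simp_all
  from compactin_neighbourhoods[OF K this]
  obtain A where A: "finite A" "A \<subseteq> K" "K \<subseteq> \<Union>(U ` A)" .
  define c' where "c' = Min (insert 1 (c ` A))"
  have "0 < c'" unfolding c'_def using A U by (subst Min_gr_iff) auto
  moreover have "cmod (\<xi> y - 1) \<le> \<delta>"
    if "\<xi> \<in> carrier (dual_group G p)" "dual_value G p \<xi> < c'" "y \<in> K" for \<xi> y
  proof -
    obtain x where x: "x \<in> A" "y \<in> U x" using A(3) \<open>y \<in> K\<close> by auto
    have "c' \<le> c x" unfolding c'_def using A(1) x(1) by (intro Min_le) auto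
    then have "dual_value G p \<xi> < c x" using that(2) by simp
    then show ?thesis using U[of x] that x A(2) by blast
  qed
  ultimately show thesis using that by blast
qed

end

section \<open>The canonical homomorphism\<close>

lemma openin_pointwise_preimage:
  assumes "i \<in> I" "openin circle_topology U" "B \<subseteq> extensional I" "\<And>\<xi>. \<xi> \<in> B \<Longrightarrow> cmod (\<xi> i) = 1"
  shows "openin (subtopology (product_topology (\<lambda>_. euclidean) I) B) {\<xi> \<in> B. \<xi> i \<in> U}"
proof -
  let ?P = "product_topology (\<lambda>_. euclidean :: complex topology) I"
  obtain T where T: "open T" "U = {z. cmod z = 1} \<inter> T"
    using assms(2) unfolding circle_topology_def openin_open by blast
  have "openin ?P {\<xi> \<in> topspace ?P. \<xi> i \<in> T}"
    using continuous_map_product_projection[OF assms(1), of "\<lambda>_. euclidean"] T(1)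
    by (intro openin_continuous_map_preimage[where Y = euclidean]) simp_all
  moreover have "{\<xi> \<in> B. \<xi> i \<in> U} = {\<xi> \<in> topspace ?P. \<xi> i \<in> T} \<inter> B"
    using T assms(3,4) by (auto simp: PiE_def)
  ultimately show ?thesis unfolding openin_subtopology by blast
qed

context metric_ab_group
begin

lemma bidual_group_eq: "bidual_group G p = dual_group (dual_group G p) (dual_value G p)"
  and bidual_value_eq: "bidual_value G p = dual_value (dual_group G p) (dual_value G p)"
  by (simp_all add: bidual_group_def bidual_value_def)

lemma canonical_hom_eq: "canonical_hom G p x = (\<lambda>\<phi>\<in>carrier (dual_group G p). \<phi> x)"
  by (simp add: canonical_hom_def eval_map_def dual_group_def)

lemma canonical_hom_apply: "\<phi> \<in> carrier (dual_group G p) \<Longrightarrow> canonical_hom G p x \<phi> = \<phi> x"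
  by (simp add: canonical_hom_eq)

lemma canonical_hom_closed:
  assumes x: "x \<in> carrier G"
  shows "canonical_hom G p x \<in> carrier (bidual_group G p)"
proof -
  interpret dual: metric_ab_group "dual_group G p" "dual_value G p" by (rule metric_ab_group_dual)
  show ?thesis
    unfolding bidual_group_eq
  proof (rule dual.mem_dual_groupI)
    show "canonical_hom G p x \<in> extensional (carrier (dual_group G p))"
      by (simp add: canonical_hom_eq restrict_extensional del: restrict_apply)
    fix \<phi> \<psi> assume \<phi>: "\<phi> \<in> carrier (dual_group G p)" and \<psi>: "\<psi> \<in> carrier (dual_group G p)"
    show "cmod (canonical_hom G p x \<phi>) = 1"
      using dual_char_norm[OF \<phi> x] \<phi> by (simp add: canonical_hom_apply)
    show "circle_length (canonical_hom G p x \<phi>) \<le> p x * dual_value G p \<phi>"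
      using circle_length_char_le[OF \<phi> x] \<phi> by (simp add: canonical_hom_apply mult.commute)
    have "(\<phi> \<otimes>\<^bsub>dual_group G p\<^esub> \<psi>) x = \<phi> x * \<psi> x"
      using x by (simp add: dual_group_def)
    then show "canonical_hom G p x (\<phi> \<otimes>\<^bsub>dual_group G p\<^esub> \<psi>) = canonical_hom G p x \<phi> * canonical_hom G p x \<psi>"
      using canonical_hom_apply[OF \<phi>] canonical_hom_apply[OF \<psi>]
        canonical_hom_apply[OF dual.m_closed[OF \<phi> \<psi>]] by simp
  qed
qed

lemma canonical_hom_div:
  assumes x: "x \<in> carrier G" and y: "y \<in> carrier G"
  shows "inv\<^bsub>bidual_group G p\<^esub> canonical_hom G p x \<otimes>\<^bsub>bidual_group G p\<^esub> canonical_hom G p y =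
    canonical_hom G p (inv x \<otimes> y)"
proof -
  interpret dual: metric_ab_group "dual_group G p" "dual_value G p" by (rule metric_ab_group_dual)
  interpret bidual: metric_ab_group "bidual_group G p" "bidual_value G p"
    unfolding bidual_group_eq bidual_value_eq by (rule dual.metric_ab_group_dual)
  note closed = canonical_hom_closed[OF x] canonical_hom_closed[OF y]
  show ?thesis
  proof (rule dual.dual_char_eqI)
    show "inv\<^bsub>bidual_group G p\<^esub> canonical_hom G p x \<otimes>\<^bsub>bidual_group G p\<^esub> canonical_hom G p y
        \<in> carrier (dual_group (dual_group G p) (dual_value G p))"
      using closed unfolding bidual_group_eq[symmetric] by simp
    show "canonical_hom G p (inv x \<otimes> y) \<in> carrier (dual_group (dual_group G p) (dual_value G p))"
      using canonical_hom_closed[of "inv x \<otimes> y"] x y unfolding bidual_group_eq by simp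
    fix \<phi> assume \<phi>: "\<phi> \<in> carrier (dual_group G p)"
    have "\<phi> (inv x \<otimes> y) = inverse (\<phi> x) * \<phi> y"
      using \<phi> x y char_inv[of \<phi> "value_topology G p" x] dual_char_mult[OF \<phi>, of "inv x" y]
      by (simp add: dual_group_def)
    then show "(inv\<^bsub>bidual_group G p\<^esub> canonical_hom G p x \<otimes>\<^bsub>bidual_group G p\<^esub> canonical_hom G p y) \<phi> =
        canonical_hom G p (inv x \<otimes> y) \<phi>"
      using dual.dual_group_div_apply[OF closed(1)[unfolded bidual_group_eq] \<phi>]
      by (simp add: bidual_group_eq canonical_hom_apply[OF \<phi>])
  qed
qed

lemma canonical_hom_dist:
  assumes x: "x \<in> carrier G" and y: "y \<in> carrier G"
  shows "value_dist (bidual_group G p) (bidual_value G p) (canonical_hom G p x) (canonical_hom G p y) =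
    bidual_value G p (canonical_hom G p (inv x \<otimes> y))"
  using canonical_hom_closed[OF x] canonical_hom_closed[OF y]
  by (simp add: value_dist_def canonical_hom_div[OF x y])

end

section \<open>Reflexive groups: weakly compact balls and the topology of the dual\<close>

locale reflexive_group = metric_ab_group +
  assumes reflexive: "metrically_reflexive G p"
begin

lemma canonical_hom_surj: "canonical_hom G p ` carrier G = carrier (bidual_group G p)"
  using reflexive by (simp add: metrically_reflexive_def)

lemma canonical_hom_isometry:
  "x \<in> carrier G \<Longrightarrow> y \<in> carrier G \<Longrightarrow>
    value_dist (bidual_group G p) (bidual_value G p) (canonical_hom G p x) (canonical_hom G p y) =
    value_dist G p x y"
  using reflexive by (simp add: metrically_reflexive_def)

lemma bidual_value_canonical_hom:
  assumes x: "x \<in> carrier G"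
  shows "bidual_value G p (canonical_hom G p x) = p x"
  using canonical_hom_isometry[OF one_closed x] canonical_hom_dist[OF one_closed x] x
  by (simp add: value_dist_eq)

lemma canonical_hom_inj: "inj_on (canonical_hom G p) (carrier G)"
proof (rule inj_onI)
  fix x y assume xy: "x \<in> carrier G" "y \<in> carrier G" "canonical_hom G p x = canonical_hom G p y"
  interpret dual: metric_ab_group "dual_group G p" "dual_value G p" by (rule metric_ab_group_dual)
  interpret bidual: metric_ab_group "bidual_group G p" "bidual_value G p"
    unfolding bidual_group_eq bidual_value_eq by (rule dual.metric_ab_group_dual)
  have "value_dist G p x y = 0"
    using canonical_hom_isometry[OF xy(1,2)] xy canonical_hom_closed by simp
  then show "x = y" using xy by simp
qed

text \<open>Balls of \<open>G\<close> are balls of the dual of \<open>G'\<close>, and the weak topology of \<open>G\<close> is then the topology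
  of pointwise convergence on \<open>G'\<close>.\<close>

theorem weakly_compact_ball:
  assumes r: "0 \<le> r"
  shows "compactin (weak_topology G p) {x \<in> carrier G. p x \<le> r}"
proof -
  interpret dual: metric_ab_group "dual_group G p" "dual_value G p" by (rule metric_ab_group_dual)
  let ?P = "product_topology (\<lambda>_. euclidean :: complex topology) (carrier (dual_group G p))"
  define B where "B = {\<xi> \<in> carrier (bidual_group G p). bidual_value G p \<xi> \<le> r}"
  define g where "g = inv_into (carrier G) (canonical_hom G p)"
  have cpt: "compactin ?P B"
    using dual.compactin_dual_ball_pointwise[OF r] by (simp add: B_def bidual_group_eq bidual_value_eq)
  have g: "g \<xi> \<in> carrier G" "canonical_hom G p (g \<xi>) = \<xi>" if "\<xi> \<in> B" for \<xi>
    using that unfolding B_def canonical_hom_surj[symmetric] g_def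
    by (auto intro: inv_into_into f_inv_into_f)
  have g_apply: "\<phi> (g \<xi>) = \<xi> \<phi>" if "\<xi> \<in> B" "\<phi> \<in> carrier (dual_group G p)" for \<xi> \<phi>
    using canonical_hom_apply[OF that(2), of "g \<xi>"] g(2)[OF that(1)] by simp
  have top: "topspace (subtopology ?P B) = B"
    using compactin_subset_topspace[OF cpt] by (simp add: Int_absorb1)
  have "continuous_map (subtopology ?P B) (weak_topology G p) g"
    unfolding weak_topology_def
  proof (rule continuous_on_generated_topo)
    show "g ` topspace (subtopology ?P B) \<subseteq> \<Union>{{x \<in> carrier G. \<phi> x \<in> U} | \<phi> U.
        \<phi> \<in> carrier (dual_group G p) \<and> openin circle_topology U}"
      using g(1) topspace_weak_topology unfolding weak_topology_def top by auto
    fix V assume "V \<in> {{x \<in> carrier G. \<phi> x \<in> U} | \<phi> U.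
        \<phi> \<in> carrier (dual_group G p) \<and> openin circle_topology U}"
    then obtain \<phi> U where V: "V = {x \<in> carrier G. \<phi> x \<in> U}" and \<phi>: "\<phi> \<in> carrier (dual_group G p)"
      and U: "openin circle_topology U" by blast
    have "g -` V \<inter> topspace (subtopology ?P B) = {\<xi> \<in> B. \<xi> \<phi> \<in> U}"
      unfolding top V using g(1) g_apply[OF _ \<phi>] by auto
    moreover have "openin (subtopology ?P B) {\<xi> \<in> B. \<xi> \<phi> \<in> U}"
    proof (rule openin_pointwise_preimage[OF \<phi> U])
      show "B \<subseteq> extensional (carrier (dual_group G p))"
        using compactin_subset_topspace[OF cpt] by (auto simp: PiE_def)
      show "cmod (\<xi> \<phi>) = 1" if "\<xi> \<in> B" for \<xi>
        using that \<phi> by (auto simp: B_def bidual_group_eq intro: dual.dual_char_norm)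
    qed
    ultimately show "openin (subtopology ?P B) (g -` V \<inter> topspace (subtopology ?P B))" by simp
  qed
  moreover have "compactin (subtopology ?P B) B"
    using cpt by (simp add: compactin_subtopology)
  ultimately have "compactin (weak_topology G p) (g ` B)" by (rule image_compactin[rotated])
  moreover have "g ` B = {x \<in> carrier G. p x \<le> r}"
  proof (intro equalityI subsetI)
    fix x assume "x \<in> g ` B"
    then obtain \<xi> where "\<xi> \<in> B" "x = g \<xi>" by blast
    then show "x \<in> {x \<in> carrier G. p x \<le> r}"
      using g[of \<xi>] bidual_value_canonical_hom[of x] by (simp add: B_def)
  next
    fix x assume x: "x \<in> {x \<in> carrier G. p x \<le> r}"
    then have "canonical_hom G p x \<in> B"
      using canonical_hom_closed bidual_value_canonical_hom by (simp add: B_def)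
    moreover have "g (canonical_hom G p x) = x"
      unfolding g_def using canonical_hom_inj x by (simp add: inv_into_f_f)
    ultimately show "x \<in> g ` B" by force
  qed
  ultimately show ?thesis by simp
qed

text \<open>Each topology is finer than the other: a character close to \<open>1\<close> on the weakly compact ball of
  radius \<open>r\<close> has value at most \<open>1/r\<close>, and weakly compact sets are equicontinuous on the dual.\<close>

theorem dual_topology_eq_uniform_convergence:
  "value_topology (dual_group G p) (dual_value G p) =
    uniform_convergence_topology (carrier (dual_group G p)) {K. compactin (weak_topology G p) K}"
proof -
  let ?D = "value_dist (dual_group G p) (dual_value G p)"
  interpret dual: metric_ab_group "dual_group G p" "dual_value G p" by (rule metric_ab_group_dual)
  have fine: "\<exists>\<K> e. finite \<K> \<and> \<K> \<subseteq> {K. compactin (weak_topology G p) K} \<and> 0 < e \<and>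
      {\<psi> \<in> carrier (dual_group G p). \<forall>x\<in>\<Union>\<K>. dist (\<psi> x) (\<phi> x) < e} \<subseteq> U"
    if \<phi>: "\<phi> \<in> carrier (dual_group G p)" and r: "0 < r" "dual.met.mball \<phi> r \<subseteq> U" for \<phi> r U
  proof (intro exI[of _ "{{x \<in> carrier G. p x \<le> 2 / r}}"] exI[of _ 1] conjI subsetI)
    fix K assume "K \<in> {{x \<in> carrier G. p x \<le> 2 / r}}"
    then show "K \<in> {K. compactin (weak_topology G p) K}"
      using weakly_compact_ball[of "2 / r"] r by simp
  next
    fix \<psi> assume *: "\<psi> \<in> {\<psi> \<in> carrier (dual_group G p).
        \<forall>x\<in>\<Union>{{x \<in> carrier G. p x \<le> 2 / r}}. dist (\<psi> x) (\<phi> x) < 1}"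
    then have "?D \<phi> \<psi> \<le> 1 / (2 / r)"
      using r(1) by (intro dual_dist_le_of_near_on_ball[OF \<phi>]) (auto simp: dist_norm)
    then have "\<psi> \<in> dual.met.mball \<phi> r" using \<phi> * r(1) by simp
    then show "\<psi> \<in> U" using r(2) by blast
  qed auto
  have coarse: "\<exists>r>0. dual.met.mball \<phi> r \<subseteq> U"
    if \<phi>: "\<phi> \<in> carrier (dual_group G p)" and \<K>: "finite \<K>" "\<K> \<subseteq> {K. compactin (weak_topology G p) K}"
      and e: "0 < e" and sub: "{\<psi> \<in> carrier (dual_group G p). \<forall>x\<in>\<Union>\<K>. dist (\<psi> x) (\<phi> x) < e} \<subseteq> U"
    for \<phi> \<K> e U
  proof -
    have cpt: "compactin (weak_topology G p) (\<Union>\<K>)" using \<K> by (intro compactin_Union) auto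
    then have sub_G: "\<Union>\<K> \<subseteq> carrier G" using compactin_subset_topspace by fastforce
    have "0 < e / 2" using e by simp
    from weakly_compact_equicontinuous[OF cpt this]
    obtain c where c: "0 < c" "\<And>\<xi> y. \<xi> \<in> carrier (dual_group G p) \<Longrightarrow> dual_value G p \<xi> < c \<Longrightarrow>
        y \<in> \<Union>\<K> \<Longrightarrow> cmod (\<xi> y - 1) \<le> e / 2" by metis
    have "dual.met.mball \<phi> c \<subseteq> U"
    proof
      fix \<psi> assume "\<psi> \<in> dual.met.mball \<phi> c"
      then have \<psi>: "\<psi> \<in> carrier (dual_group G p)" and d: "?D \<phi> \<psi> < c" by auto
      have "cmod (\<psi> x - \<phi> x) \<le> e / 2" if x: "x \<in> \<Union>\<K>" for x
      proof -
        have "x \<in> carrier G" using x sub_G by blast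
        from cmod_dual_div_diff_1[OF \<phi> this, of \<psi>] show ?thesis
          using c(2)[of "inv\<^bsub>dual_group G p\<^esub> \<phi> \<otimes>\<^bsub>dual_group G p\<^esub> \<psi>" x] x d \<phi> \<psi>
          by (simp add: dual.value_dist_eq)
      qed
      then have "\<forall>x\<in>\<Union>\<K>. dist (\<psi> x) (\<phi> x) < e" using e by (fastforce simp: dist_norm)
      then show "\<psi> \<in> U" using sub \<psi> by blast
    qed
    then show ?thesis using c(1) by blast
  qed
  show ?thesis
    unfolding topology_eq
  proof (intro allI)
    fix U
    show "openin (value_topology (dual_group G p) (dual_value G p)) U \<longleftrightarrow>
      openin (uniform_convergence_topology (carrier (dual_group G p))
        {K. compactin (weak_topology G p) K}) U"
      unfolding openin_uniform_convergence_topology dual.value_topology_eq dual.met.openin_mtopology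
    proof (rule iffI)
      assume U: "U \<subseteq> carrier (dual_group G p) \<and> (\<forall>\<phi>. \<phi> \<in> U \<longrightarrow> (\<exists>r>0. dual.met.mball \<phi> r \<subseteq> U))"
      have "\<exists>\<K>' e. finite \<K>' \<and> \<K>' \<subseteq> {K. compactin (weak_topology G p) K} \<and> 0 < e \<and>
          {\<psi> \<in> carrier (dual_group G p). \<forall>x\<in>\<Union>\<K>'. dist (\<psi> x) (\<phi> x) < e} \<subseteq> U"
        if \<phi>: "\<phi> \<in> U" for \<phi>
      proof -
        obtain r where r: "0 < r" "dual.met.mball \<phi> r \<subseteq> U" using U \<phi> by blast
        have "\<phi> \<in> carrier (dual_group G p)" using U \<phi> by blast
        then show ?thesis by (rule fine[OF _ r])
      qed
      with U show "U \<subseteq> carrier (dual_group G p) \<and>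
          (\<forall>\<phi>\<in>U. \<exists>\<K>' e. finite \<K>' \<and> \<K>' \<subseteq> {K. compactin (weak_topology G p) K} \<and> 0 < e \<and>
            {\<psi> \<in> carrier (dual_group G p). \<forall>x\<in>\<Union>\<K>'. dist (\<psi> x) (\<phi> x) < e} \<subseteq> U)"
        by blast
    next
      assume U: "U \<subseteq> carrier (dual_group G p) \<and>
          (\<forall>\<phi>\<in>U. \<exists>\<K>' e. finite \<K>' \<and> \<K>' \<subseteq> {K. compactin (weak_topology G p) K} \<and> 0 < e \<and>
            {\<psi> \<in> carrier (dual_group G p). \<forall>x\<in>\<Union>\<K>'. dist (\<psi> x) (\<phi> x) < e} \<subseteq> U)"
      have "\<exists>r>0. dual.met.mball \<phi> r \<subseteq> U" if \<phi>: "\<phi> \<in> U" for \<phi>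
      proof -
        from bspec[OF conjunct2[OF U] \<phi>] obtain \<K> e where \<K>: "finite \<K>" "\<K> \<subseteq> {K. compactin (weak_topology G p) K}" "0 < e"
          "{\<psi> \<in> carrier (dual_group G p). \<forall>x\<in>\<Union>\<K>. dist (\<psi> x) (\<phi> x) < e} \<subseteq> U"
          by (elim exE conjE) (rule that)
        have "\<phi> \<in> carrier (dual_group G p)" using U \<phi> by blast
        then show ?thesis by (rule coarse[OF _ \<K>])
      qed
      with U show "U \<subseteq> carrier (dual_group G p) \<and> (\<forall>\<phi>. \<phi> \<in> U \<longrightarrow> (\<exists>r>0. dual.met.mball \<phi> r \<subseteq> U))"
        by blast
    qed
  qed
qed

section \<open>Reflexivity of the dual\<close>

text \<open>Under the identification of \<open>G\<close> with its second dual, a character of the second dual is a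
  character of \<open>G\<close>, with the same value.\<close>

theorem reflexive_group_dual: "reflexive_group (dual_group G p) (dual_value G p)"
proof -
  let ?G1 = "dual_group G p" and ?p1 = "dual_value G p"
  let ?G2 = "bidual_group G p" and ?p2 = "bidual_value G p"
  interpret dual: metric_ab_group ?G1 ?p1 by (rule metric_ab_group_dual)
  interpret bidual: metric_ab_group ?G2 ?p2
    unfolding bidual_group_eq bidual_value_eq by (rule dual.metric_ab_group_dual)
  have third_eq: "bidual_group ?G1 ?p1 = dual_group ?G2 ?p2" "bidual_value ?G1 ?p1 = dual_value ?G2 ?p2"
    by (simp_all add: bidual_group_def bidual_value_def)
  have \<kappa>_apply: "canonical_hom ?G1 ?p1 \<phi> (canonical_hom G p x) = \<phi> x"
    if "\<phi> \<in> carrier ?G1" "x \<in> carrier G" for \<phi> x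
    using dual.canonical_hom_apply[of "canonical_hom G p x" \<phi>] canonical_hom_closed[OF that(2)]
      canonical_hom_apply[OF that(1), of x] by (simp add: bidual_group_eq)
  have \<kappa>_value: "bidual_value ?G1 ?p1 (canonical_hom ?G1 ?p1 \<phi>) = ?p1 \<phi>" if \<phi>: "\<phi> \<in> carrier ?G1" for \<phi>
  proof -
    have "(\<forall>\<xi>\<in>carrier ?G2. circle_length (canonical_hom ?G1 ?p1 \<phi> \<xi>) \<le> M * ?p2 \<xi>) \<longleftrightarrow>
        (\<forall>x\<in>carrier G. circle_length (\<phi> x) \<le> M * p x)" for M
      unfolding canonical_hom_surj[symmetric]
      by (simp add: \<kappa>_apply[OF \<phi>] bidual_value_canonical_hom)
    then show ?thesis unfolding third_eq dual_value_def[of G p] dual_value_def[of ?G2 ?p2] by simp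
  qed
  have "canonical_hom ?G1 ?p1 ` carrier ?G1 = carrier (bidual_group ?G1 ?p1)"
  proof (intro equalityI subsetI)
    fix \<Xi> assume "\<Xi> \<in> carrier (bidual_group ?G1 ?p1)"
    then have \<Xi>: "\<Xi> \<in> carrier (dual_group ?G2 ?p2)" by (simp add: third_eq)
    define \<phi> where "\<phi> = (\<lambda>x\<in>carrier G. \<Xi> (canonical_hom G p x))"
    have \<phi>_apply: "\<phi> x = \<Xi> (canonical_hom G p x)" if "x \<in> carrier G" for x
      using that by (simp add: \<phi>_def)
    have \<phi>: "\<phi> \<in> carrier ?G1"
    proof (rule mem_dual_groupI)
      show "\<phi> \<in> extensional (carrier G)" by (simp add: \<phi>_def restrict_extensional del: restrict_apply)
      fix x y assume x: "x \<in> carrier G" and y: "y \<in> carrier G"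
      note closed = canonical_hom_closed[OF x] canonical_hom_closed[OF y]
      show "cmod (\<phi> x) = 1"
        using bidual.dual_char_norm[OF \<Xi> closed(1)] x by (simp add: \<phi>_apply)
      show "circle_length (\<phi> x) \<le> dual_value ?G2 ?p2 \<Xi> * p x"
        using bidual.circle_length_char_le[OF \<Xi> closed(1)] x
        by (simp add: \<phi>_apply bidual_value_canonical_hom)
      have "canonical_hom G p (x \<otimes> y) = canonical_hom G p x \<otimes>\<^bsub>?G2\<^esub> canonical_hom G p y"
      proof (rule dual.dual_char_eqI)
        fix \<phi> assume "\<phi> \<in> carrier ?G1"
        then show "canonical_hom G p (x \<otimes> y) \<phi> = (canonical_hom G p x \<otimes>\<^bsub>?G2\<^esub> canonical_hom G p y) \<phi>"
          using canonical_hom_apply[of \<phi>] dual_char_mult[of \<phi> x y] x y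
          by (simp add: bidual_group_eq dual_group_def[of ?G1])
      qed (use x y closed canonical_hom_closed[of "x \<otimes> y"] in \<open>simp_all add: bidual_group_eq[symmetric]\<close>)
      then show "\<phi> (x \<otimes> y) = \<phi> x * \<phi> y"
        using bidual.dual_char_mult[OF \<Xi> closed] x y by (simp add: \<phi>_apply)
    qed
    have "\<Xi> = canonical_hom ?G1 ?p1 \<phi>"
    proof (rule bidual.dual_char_eqI[OF \<Xi>])
      show "canonical_hom ?G1 ?p1 \<phi> \<in> carrier (dual_group ?G2 ?p2)"
        using dual.canonical_hom_closed[OF \<phi>] by (simp add: third_eq)
      fix \<xi> assume "\<xi> \<in> carrier ?G2"
      then obtain x where "x \<in> carrier G" "\<xi> = canonical_hom G p x"
        unfolding canonical_hom_surj[symmetric] by blast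
      then show "\<Xi> \<xi> = canonical_hom ?G1 ?p1 \<phi> \<xi>" using \<kappa>_apply[OF \<phi>] \<phi>_apply by simp
    qed
    then show "\<Xi> \<in> canonical_hom ?G1 ?p1 ` carrier ?G1" using \<phi> by blast
  qed (use dual.canonical_hom_closed in auto)
  moreover have "value_dist (bidual_group ?G1 ?p1) (bidual_value ?G1 ?p1)
      (canonical_hom ?G1 ?p1 \<phi>) (canonical_hom ?G1 ?p1 \<psi>) = value_dist ?G1 ?p1 \<phi> \<psi>"
    if "\<phi> \<in> carrier ?G1" "\<psi> \<in> carrier ?G1" for \<phi> \<psi>
    using dual.canonical_hom_dist[OF that] \<kappa>_value[of "inv\<^bsub>?G1\<^esub> \<phi> \<otimes>\<^bsub>?G1\<^esub> \<psi>"] that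
    by (simp add: dual.value_dist_eq)
  ultimately have "metrically_reflexive ?G1 ?p1"
    by (simp add: metrically_reflexive_def)
  then show ?thesis by unfold_locales
qed

end

section \<open>Separating and dense sets of characters\<close>

lemma finite_net_unit_disc:
  assumes "0 < e"
  obtains Z :: "complex set" where "finite Z" "\<And>z. cmod z \<le> 1 \<Longrightarrow> \<exists>w\<in>Z. cmod (z - w) < e"
proof -
  have cover: "cball 0 1 \<subseteq> (\<Union>w\<in>UNIV. ball w e)"
    using assms by (metis UN_I UNIV_I centre_in_ball subsetI)
  from compactE_image[OF compact_cball open_ball cover]
  obtain Z :: "complex set" where Z: "finite Z" "cball 0 1 \<subseteq> (\<Union>w\<in>Z. ball w e)" by metis
  have "\<exists>w\<in>Z. cmod (z - w) < e" if "cmod z \<le> 1" for z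
  proof -
    have "z \<in> cball 0 1" using that by simp
    then obtain w where "w \<in> Z" "z \<in> ball w e" using Z(2) by blast
    then show ?thesis unfolding mem_ball dist_norm norm_minus_commute[of w] by blast
  qed
  then show thesis using that Z(1) by blast
qed

text \<open>Finitely many bounded functions on \<open>A\<close> take, up to the tolerances \<open>e\<close>, finitely many joint
  values, and one point of \<open>A\<close> is chosen for each of them.\<close>

lemma finite_simultaneous_net:
  fixes f :: "'i \<Rightarrow> 'a \<Rightarrow> complex"
  assumes I: "finite I" and e: "\<And>i. i \<in> I \<Longrightarrow> 0 < e i"
    and f: "\<And>i a. i \<in> I \<Longrightarrow> a \<in> A \<Longrightarrow> cmod (f i a) \<le> 1"
  obtains A0 where "finite A0" "A0 \<subseteq> A" "\<And>a. a \<in> A \<Longrightarrow> \<exists>b\<in>A0. \<forall>i\<in>I. cmod (f i a - f i b) < e i"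
proof -
  have "\<exists>Z. finite Z \<and> (\<forall>z. cmod z \<le> 1 \<longrightarrow> (\<exists>w\<in>Z. cmod (z - w) < e i / 2))" if "i \<in> I" for i
  proof -
    have "0 < e i / 2" using e[OF that] by simp
    from finite_net_unit_disc[OF this] show ?thesis by metis
  qed
  then obtain Z where Z: "\<And>i. i \<in> I \<Longrightarrow> finite (Z i)"
      "\<And>i z. i \<in> I \<Longrightarrow> cmod z \<le> 1 \<Longrightarrow> \<exists>w\<in>Z i. cmod (z - w) < e i / 2"
    by metis
  have "\<exists>w. w \<in> Z i \<and> cmod (f i a - w) < e i / 2" if "i \<in> I" "a \<in> A" for i a
    using Z(2)[OF that(1) f[OF that]] by blast
  then obtain c where c: "\<And>i a. i \<in> I \<Longrightarrow> a \<in> A \<Longrightarrow> c i a \<in> Z i"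
      "\<And>i a. i \<in> I \<Longrightarrow> a \<in> A \<Longrightarrow> cmod (f i a - c i a) < e i / 2"
    by metis
  \<comment> \<open>The joint approximate value at \<open>a\<close>, restricted to \<open>I\<close> to lie in a finite product.\<close>
  define g where "g = (\<lambda>a. \<lambda>i\<in>I. c i a)"
  have "g ` A \<subseteq> PiE I Z" using c(1) by (auto simp: g_def)
  then have "finite (g ` A)" by (rule finite_subset) (rule finite_PiE[OF I Z(1)])
  from finite_subset_image[OF this subset_refl]
  obtain A0 where A0: "A0 \<subseteq> A" "finite A0" "g ` A = g ` A0" by (elim exE conjE) (rule that)
  have "\<exists>b\<in>A0. \<forall>i\<in>I. cmod (f i a - f i b) < e i" if a: "a \<in> A" for a
  proof -
    have "g a \<in> g ` A0" unfolding A0(3)[symmetric] using a by (rule imageI)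
    then obtain b where b: "b \<in> A0" "g a = g b" by (elim imageE) (rule that)
    have "cmod (f i a - f i b) < e i" if i: "i \<in> I" for i
    proof -
      have "c i a = c i b" using b(2) i unfolding g_def by (metis restrict_apply')
      moreover have "b \<in> A" using b(1) A0(1) by blast
      ultimately show ?thesis
        using c(2)[OF i a] c(2)[OF i, of b] norm_triangle_ineq4[of "f i a - c i a" "f i b - c i a"]
        by simp
    qed
    then show ?thesis using b(1) by blast
  qed
  then show thesis using that A0(1,2) by blast
qed

lemma card_of_finite_subsets:
  assumes E: "infinite E" and A: "|A| \<le>o |E|"
  shows "|Fpow A| \<le>o |E|"
proof (cases "finite A")
  case True
  then have "finite (Fpow A)"
    by (rule finite_subset[OF _ finite_Pow_iff[THEN iffD2], rotated]) (auto simp: Fpow_def)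
  then show ?thesis using ordLess_imp_ordLeq finite_ordLess_infinite2[OF _ E] by blast
next
  case False
  then show ?thesis using card_of_Fpow_infinite A ordIso_ordLeq_trans by blast
qed

context reflexive_group
begin

text \<open>Reflexivity provides, for each element \<open>d\<close> of a dense set, a character that almost attains
  the value of \<open>d\<close> in the second dual. Its length at \<open>d\<close> is large enough that it is still different
  from \<open>1\<close> at every \<open>x\<close> whose distance to \<open>d\<close> is less than \<open>p(x)/8\<close>.\<close>

lemma ex_separating_characters:
  assumes D: "D \<subseteq> carrier G"
    and dense: "\<And>x e. x \<in> carrier G \<Longrightarrow> 0 < e \<Longrightarrow> \<exists>d\<in>D. value_dist G p x d < e"
  obtains S where "S \<subseteq> carrier (dual_group G p)" "|S| \<le>o |D|"
    "\<And>x. x \<in> carrier G \<Longrightarrow> (\<And>s. s \<in> S \<Longrightarrow> s x = 1) \<Longrightarrow> x = \<one>"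
proof -
  interpret dual: metric_ab_group "dual_group G p" "dual_value G p" by (rule metric_ab_group_dual)
  have "\<exists>\<xi>\<in>carrier (dual_group G p). p d / 2 * dual_value G p \<xi> < circle_length (\<xi> d)"
    if d: "d \<in> carrier G" "d \<noteq> \<one>" for d
  proof (rule ccontr)
    assume "\<not> ?thesis"
    then have "circle_length (\<xi> d) \<le> p d / 2 * dual_value G p \<xi>" if "\<xi> \<in> carrier (dual_group G p)" for \<xi>
      using that not_less by blast
    then have "dual_value (dual_group G p) (dual_value G p) (canonical_hom G p d) \<le> p d / 2"
      using value_nonneg[OF d(1)] by (intro dual.dual_value_le) (simp_all add: canonical_hom_apply)
    then have "p d \<le> p d / 2" using bidual_value_canonical_hom[OF d(1)] by (simp add: bidual_value_eq)
    then show False using value_nonneg[OF d(1)] value_eq_0_iff[OF d(1)] d(2) by simp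
  qed
  then obtain f where f: "\<And>d. d \<in> carrier G \<Longrightarrow> d \<noteq> \<one> \<Longrightarrow> f d \<in> carrier (dual_group G p)"
      "\<And>d. d \<in> carrier G \<Longrightarrow> d \<noteq> \<one> \<Longrightarrow> p d / 2 * dual_value G p (f d) < circle_length (f d d)"
    by metis
  show thesis
  proof
    show "f ` (D - {\<one>}) \<subseteq> carrier (dual_group G p)" using f(1) D by blast
    have "|D - {\<one>}| \<le>o |D|" by (rule card_of_mono1) blast
    then show "|f ` (D - {\<one>})| \<le>o |D|" by (rule ordLeq_transitive[OF card_of_image])
    fix x assume x: "x \<in> carrier G" and triv: "\<And>s. s \<in> f ` (D - {\<one>}) \<Longrightarrow> s x = 1"
    show "x = \<one>"
    proof (rule ccontr)
      assume "x \<noteq> \<one>"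
      then have px: "0 < p x" using value_nonneg[OF x] value_eq_0_iff[OF x] by simp
      then obtain d where "d \<in> D" and dist: "value_dist G p x d < p x / 8"
        using dense[OF x, of "p x / 8"] by auto
      then have d: "d \<in> carrier G" using D by blast
      have "value_dist G p \<one> x \<le> value_dist G p \<one> d + value_dist G p x d"
        by (rule met.triangle'[OF one_closed d x])
      then have pd: "7 / 8 * p x < p d" using dist x d by (simp add: value_dist_one)
      then have "d \<noteq> \<one>" using px by auto
      note fd = f[OF d \<open>d \<noteq> \<one>\<close>]
      have "f d x = 1" using triv \<open>d \<in> D\<close> \<open>d \<noteq> \<one>\<close> by blast
      then have "f d (inv x \<otimes> d) = f d d"
        using dual_char_mult[OF fd(1), of "inv x" d] char_inv[of "f d" "value_topology G p" x] fd(1) x d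
        by (simp add: dual_group_def)
      then have "circle_length (f d d) \<le> dual_value G p (f d) * value_dist G p x d"
        using circle_length_char_le[OF fd(1), of "inv x \<otimes> d"] x d by (simp add: value_dist_eq)
      also have "\<dots> \<le> dual_value G p (f d) * (p d / 2)"
        using dist pd px by (intro mult_left_mono dual_value_nonneg[OF fd(1)]) simp
      finally show False using fd(2) by (simp add: mult.commute)
    qed
  qed
qed

text \<open>Only the identity is mapped to \<open>1\<close> by all of \<open>S\<close>. In a weakly compact ball, the sets on which
  finitely many members of \<open>S\<close> are close to \<open>1\<close> therefore shrink into the neighbourhood of the
  identity on which \<open>\<phi>\<close> is close to \<open>1\<close>.\<close>

lemma controlled_by_separating:
  assumes S: "S \<subseteq> carrier (dual_group G p)"
    and sep: "\<And>x. x \<in> carrier G \<Longrightarrow> (\<And>s. s \<in> S \<Longrightarrow> s x = 1) \<Longrightarrow> x = \<one>"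
    and \<phi>: "\<phi> \<in> carrier (dual_group G p)" and R: "0 \<le> R" and e: "0 < e"
  obtains Q where "Q \<in> Fpow (S \<times> (UNIV :: nat set))"
    "\<And>x. x \<in> carrier G \<Longrightarrow> p x \<le> R \<Longrightarrow> (\<And>s n. (s, n) \<in> Q \<Longrightarrow> cmod (s x - 1) \<le> 1 / real (Suc n)) \<Longrightarrow>
      cmod (\<phi> x - 1) < e"
proof -
  let ?K = "{x \<in> carrier G. p x \<le> R}"
  let ?T = "{y \<in> carrier G. cmod (\<phi> y - 1) < e}"
  let ?V = "\<lambda>(s, n). {y \<in> carrier G. 1 / real (Suc n) < cmod (s y - 1)}"
  have "\<exists>\<F>. finite \<F> \<and> \<F> \<subseteq> insert ?T (?V ` (S \<times> UNIV)) \<and> ?K \<subseteq> \<Union>\<F>"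
  proof (rule compactinD[OF weakly_compact_ball[OF R]])
    fix U assume "U \<in> insert ?T (?V ` (S \<times> UNIV))"
    then show "openin (weak_topology G p) U"
      using S \<phi> by (auto intro!: openin_weak_topology_near openin_weak_topology_far)
  next
    show "?K \<subseteq> \<Union>(insert ?T (?V ` (S \<times> UNIV)))"
    proof
      fix x assume x: "x \<in> ?K"
      show "x \<in> \<Union>(insert ?T (?V ` (S \<times> UNIV)))"
      proof (cases "\<forall>s\<in>S. s x = 1")
        case True
        then have "x = \<one>" using sep x by blast
        moreover have "\<phi> \<one> = 1" using char_one \<phi> unfolding dual_group_def by blast
        ultimately have "x \<in> ?T" using e by simp
        then show ?thesis by blast
      next
        case False
        then obtain s where s: "s \<in> S" "s x \<noteq> 1" by blast
        then have "0 < cmod (s x - 1)" by simp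
        then obtain n where "1 / real (Suc n) < cmod (s x - 1)" by (rule nat_approx_posE)
        then have "x \<in> ?V (s, n)" using x by simp
        then show ?thesis using s(1) by blast
      qed
    qed
  qed
  then obtain \<F> where \<F>: "finite \<F>" "\<F> \<subseteq> insert ?T (?V ` (S \<times> UNIV))" "?K \<subseteq> \<Union>\<F>" by blast
  have "finite (\<F> - {?T})" "\<F> - {?T} \<subseteq> ?V ` (S \<times> UNIV)" using \<F>(1,2) by auto
  from finite_subset_image[OF this]
  obtain Q where Q: "Q \<subseteq> S \<times> UNIV" "finite Q" "\<F> - {?T} = ?V ` Q" by (elim exE conjE) (rule that)
  show thesis
  proof
    show "Q \<in> Fpow (S \<times> UNIV)" using Q(1,2) by (simp add: Fpow_def)
    fix x assume x: "x \<in> carrier G" "p x \<le> R"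
      and near: "\<And>s n. (s, n) \<in> Q \<Longrightarrow> cmod (s x - 1) \<le> 1 / real (Suc n)"
    have "x \<notin> ?V q" if "q \<in> Q" for q
      using near[of "fst q" "snd q"] that by (auto simp: case_prod_beta not_less)
    then have "x \<notin> \<Union>(\<F> - {?T})" unfolding Q(3) by blast
    moreover have "x \<in> \<Union>\<F>" using \<F>(3) x by blast
    ultimately have "x \<in> ?T" by blast
    then show "cmod (\<phi> x - 1) < e" by simp
  qed
qed

text \<open>The characters that are controlled on the ball of radius \<open>2R\<close> by the same finite set \<open>Q\<close> form
  a totally bounded set up to \<open>1/R\<close>: \<open>Q\<close> takes, up to the prescribed error, finitely many values on
  the ball of radius \<open>R\<close>, and a controlled character is determined there, up to a small error, by
  its values at finitely many points. The radius \<open>2R\<close> is needed for differences of points.\<close>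

lemma controlled_characters_finite_net:
  assumes Q: "finite Q" "\<And>s n. (s, n) \<in> Q \<Longrightarrow> s \<in> carrier (dual_group G p)" and R: "0 < R"
    and C: "C \<subseteq> carrier (dual_group G p)"
    and ctrl: "\<And>\<phi> x. \<phi> \<in> C \<Longrightarrow> x \<in> carrier G \<Longrightarrow> p x \<le> 2 * R \<Longrightarrow>
      (\<And>s n. (s, n) \<in> Q \<Longrightarrow> cmod (s x - 1) \<le> 1 / real (Suc n)) \<Longrightarrow> cmod (\<phi> x - 1) < 1 / 4"
  obtains N where "finite N" "N \<subseteq> C"
    "\<And>\<phi>. \<phi> \<in> C \<Longrightarrow> \<exists>\<psi>\<in>N. value_dist (dual_group G p) (dual_value G p) \<phi> \<psi> \<le> 1 / R"
proof -
  let ?K = "{x \<in> carrier G. p x \<le> R}"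
  have unit: "\<And>q x. q \<in> Q \<Longrightarrow> x \<in> ?K \<Longrightarrow> cmod (fst q x) \<le> 1"
  proof -
    fix q x assume "q \<in> Q" "x \<in> ?K"
    then have "fst q \<in> carrier (dual_group G p)" "x \<in> carrier G" using Q(2)[of "fst q" "snd q"] by simp_all
    from dual_char_norm[OF this] show "cmod (fst q x) \<le> 1" by simp
  qed
  obtain X where X: "finite X" "X \<subseteq> ?K"
    "\<And>x. x \<in> ?K \<Longrightarrow> \<exists>y\<in>X. \<forall>q\<in>Q. cmod (fst q x - fst q y) < 1 / real (Suc (snd q))"
  proof (rule finite_simultaneous_net[where f = fst and A = ?K and I = Q and e = "\<lambda>q. 1 / real (Suc (snd q))"])
    fix X assume "finite X" "X \<subseteq> ?K"
      "\<And>x. x \<in> ?K \<Longrightarrow> \<exists>y\<in>X. \<forall>q\<in>Q. cmod (fst q x - fst q y) < 1 / real (Suc (snd q))"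
    then show thesis by (rule that)
  qed (rule Q(1), simp, rule unit)
  have unit: "\<And>x \<phi>. x \<in> X \<Longrightarrow> \<phi> \<in> C \<Longrightarrow> cmod (\<phi> x) \<le> 1"
  proof -
    fix x \<phi> assume "x \<in> X" "\<phi> \<in> C"
    then have "\<phi> \<in> carrier (dual_group G p)" "x \<in> carrier G" using C X(2) by blast+
    from dual_char_norm[OF this] show "cmod (\<phi> x) \<le> 1" by simp
  qed
  obtain N where N: "finite N" "N \<subseteq> C"
    "\<And>\<phi>. \<phi> \<in> C \<Longrightarrow> \<exists>\<psi>\<in>N. \<forall>x\<in>X. cmod (\<phi> x - \<psi> x) < 1 / 4"
  proof (rule finite_simultaneous_net[where f = "\<lambda>x \<phi>. \<phi> x" and A = C and e = "\<lambda>_. 1 / 4" and I = X])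
    fix N assume "finite N" "N \<subseteq> C"
      "\<And>\<phi>. \<phi> \<in> C \<Longrightarrow> \<exists>\<psi>\<in>N. \<forall>x\<in>X. cmod (\<phi> x - \<psi> x) < 1 / 4"
    then show thesis by (rule that)
  qed (rule X(1), simp, rule unit)
  have move: "cmod (\<phi> x - \<phi> y) < 1 / 4"
    if \<phi>: "\<phi> \<in> C" and x: "x \<in> ?K" and y: "y \<in> X"
      and near: "\<forall>q\<in>Q. cmod (fst q x - fst q y) < 1 / real (Suc (snd q))" for \<phi> x y
  proof -
    have xG: "x \<in> carrier G" and yG: "y \<in> carrier G" and "p x \<le> R" "p y \<le> R" using x y X(2) by auto
    have diff: "cmod (\<xi> (inv y \<otimes> x) - 1) = cmod (\<xi> x - \<xi> y)" if "\<xi> \<in> carrier (dual_group G p)" for \<xi>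
      using char_inv_mult_dist[OF _ yG xG] that unfolding dual_group_def by blast
    have "p (inv y \<otimes> x) \<le> 2 * R"
      using value_mult_le[of "inv y" x] xG yG \<open>p x \<le> R\<close> \<open>p y \<le> R\<close> by (simp add: value_inv)
    moreover have "cmod (s (inv y \<otimes> x) - 1) \<le> 1 / real (Suc n)" if "(s, n) \<in> Q" for s n
      unfolding diff[OF Q(2)[OF that]] using bspec[OF near that] by simp
    ultimately have "cmod (\<phi> (inv y \<otimes> x) - 1) < 1 / 4"
      using \<phi> xG yG by (intro ctrl) auto
    moreover have "\<phi> \<in> carrier (dual_group G p)" using \<phi> C by blast
    ultimately show ?thesis unfolding diff[OF \<open>\<phi> \<in> carrier _\<close>] by simp
  qed
  show thesis
  proof (rule that[OF N(1,2)])
    fix \<phi> assume \<phi>: "\<phi> \<in> C"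
    then obtain \<psi> where \<psi>: "\<psi> \<in> N" "\<forall>x\<in>X. cmod (\<phi> x - \<psi> x) < 1 / 4" using N(3) by blast
    then have \<psi>C: "\<psi> \<in> C" using N(2) by blast
    have "cmod (\<psi> x - \<phi> x) < 1" if x: "x \<in> carrier G" "p x \<le> R" for x
    proof -
      have xK: "x \<in> ?K" using x by simp
      then obtain y where y: "y \<in> X" "\<forall>q\<in>Q. cmod (fst q x - fst q y) < 1 / real (Suc (snd q))"
        using X(3) by blast
      have "cmod (\<psi> x - \<phi> x) \<le> cmod (\<psi> x - \<psi> y) + cmod (\<psi> y - \<phi> y) + cmod (\<phi> y - \<phi> x)"
        using cmod_triangle_4[of "\<psi> x" "\<phi> x" "\<psi> y" "\<phi> y" "\<phi> x"] by simp
      moreover have "cmod (\<phi> y - \<psi> y) < 1 / 4" using \<psi>(2) y(1) by blast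
      ultimately show ?thesis
        using move[OF \<psi>C xK y] move[OF \<phi> xK y]
          norm_minus_commute[of "\<phi> x" "\<phi> y"] norm_minus_commute[of "\<phi> y" "\<psi> y"] by linarith
    qed
    then have "value_dist (dual_group G p) (dual_value G p) \<phi> \<psi> \<le> 1 / R"
      using \<phi> \<psi>C C R by (intro dual_dist_le_of_near_on_ball) auto
    then show "\<exists>\<psi>\<in>N. value_dist (dual_group G p) (dual_value G p) \<phi> \<psi> \<le> 1 / R" using \<psi>(1) by blast
  qed
qed

text \<open>Every character is controlled, on the ball of radius \<open>2(m + 1)\<close>, by one of the finite sets \<open>Q\<close>
  of pairs of a separating character and a tolerance. Collecting the finite nets for all pairs
  \<open>(m, Q)\<close> gives a dense set. The infinite set \<open>E\<close> only measures cardinality: it will be \<open>D\<close>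
  itself, or the natural numbers when \<open>D\<close> is countable.\<close>

theorem ex_dense_in_dual:
  fixes E :: "'e set"
  assumes E: "infinite E" and D: "D \<subseteq> carrier G" "|D| \<le>o |E|"
    and dense: "\<And>x e. x \<in> carrier G \<Longrightarrow> 0 < e \<Longrightarrow> \<exists>d\<in>D. value_dist G p x d < e"
  obtains D' where "D' \<subseteq> carrier (dual_group G p)" "|D'| \<le>o |E|"
    "\<And>\<phi> e. \<phi> \<in> carrier (dual_group G p) \<Longrightarrow> 0 < e \<Longrightarrow>
      \<exists>\<psi>\<in>D'. value_dist (dual_group G p) (dual_value G p) \<phi> \<psi> < e"
proof -
  from ex_separating_characters[OF D(1) dense] obtain S where S: "S \<subseteq> carrier (dual_group G p)"
    "|S| \<le>o |D|" and sep: "\<And>x. x \<in> carrier G \<Longrightarrow> (\<And>s. s \<in> S \<Longrightarrow> s x = 1) \<Longrightarrow> x = \<one>" by metis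
  let ?\<Q> = "Fpow (S \<times> (UNIV :: nat set))"
  have nat_le: "|UNIV :: nat set| \<le>o |E|" using E infinite_iff_card_of_nat by blast
  have "|S| \<le>o |E|" using S(2) D(2) ordLeq_transitive by blast
  then have "|?\<Q>| \<le>o |E|"
    by (intro card_of_finite_subsets[OF E] card_of_Times_ordLeq_infinite[OF E] nat_le)
  then have index: "|(UNIV :: nat set) \<times> ?\<Q>| \<le>o |E|"
    by (rule card_of_Times_ordLeq_infinite[OF E nat_le])
  define C where "C = (\<lambda>m Q. {\<phi> \<in> carrier (dual_group G p). \<forall>x\<in>carrier G. p x \<le> 2 * real (Suc m) \<longrightarrow>
      (\<forall>s n. (s, n) \<in> Q \<longrightarrow> cmod (s x - 1) \<le> 1 / real (Suc n)) \<longrightarrow> cmod (\<phi> x - 1) < 1 / 4})"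
  have ex: "\<exists>N. finite N \<and> N \<subseteq> C m Q \<and>
      (\<forall>\<phi>\<in>C m Q. \<exists>\<psi>\<in>N. value_dist (dual_group G p) (dual_value G p) \<phi> \<psi> \<le> 1 / real (Suc m))"
    if Q: "Q \<in> ?\<Q>" for m Q
  proof (rule controlled_characters_finite_net[of Q "real (Suc m)" "C m Q"])
    show "finite Q" "\<And>s n. (s, n) \<in> Q \<Longrightarrow> s \<in> carrier (dual_group G p)"
      using Q S(1) by (auto simp: Fpow_def)
    show "C m Q \<subseteq> carrier (dual_group G p)" by (auto simp: C_def)
    show "cmod (\<phi> x - 1) < 1 / 4"
      if "\<phi> \<in> C m Q" "x \<in> carrier G" "p x \<le> 2 * real (Suc m)"
        "\<And>s n. (s, n) \<in> Q \<Longrightarrow> cmod (s x - 1) \<le> 1 / real (Suc n)" for \<phi> x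
      using that by (simp add: C_def)
  qed (simp, blast)
  define N where "N = (\<lambda>m Q. SOME N. finite N \<and> N \<subseteq> C m Q \<and>
      (\<forall>\<phi>\<in>C m Q. \<exists>\<psi>\<in>N. value_dist (dual_group G p) (dual_value G p) \<phi> \<psi> \<le> 1 / real (Suc m)))"
  have N: "finite (N m Q) \<and> N m Q \<subseteq> C m Q \<and>
      (\<forall>\<phi>\<in>C m Q. \<exists>\<psi>\<in>N m Q. value_dist (dual_group G p) (dual_value G p) \<phi> \<psi> \<le> 1 / real (Suc m))"
    if "Q \<in> ?\<Q>" for m Q
    unfolding N_def by (rule someI_ex[OF ex[OF that]])
  show thesis
  proof
    show "(\<Union>i\<in>UNIV \<times> ?\<Q>. N (fst i) (snd i)) \<subseteq> carrier (dual_group G p)"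
    proof
      fix \<psi> assume "\<psi> \<in> (\<Union>i\<in>UNIV \<times> ?\<Q>. N (fst i) (snd i))"
      then obtain i where "snd i \<in> ?\<Q>" "\<psi> \<in> N (fst i) (snd i)" by auto
      then have "\<psi> \<in> C (fst i) (snd i)" using N[of "snd i" "fst i"] by blast
      then show "\<psi> \<in> carrier (dual_group G p)" by (simp add: C_def)
    qed
    have "\<forall>i\<in>UNIV \<times> ?\<Q>. |N (fst i) (snd i)| \<le>o |E|"
    proof
      fix i assume "i \<in> (UNIV :: nat set) \<times> ?\<Q>"
      then have "finite (N (fst i) (snd i))" using N[of "snd i" "fst i"] by auto
      then show "|N (fst i) (snd i)| \<le>o |E|"
        by (intro ordLess_imp_ordLeq finite_ordLess_infinite2[OF _ E])
    qed
    then show "|\<Union>i\<in>UNIV \<times> ?\<Q>. N (fst i) (snd i)| \<le>o |E|"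
      by (rule card_of_UNION_ordLeq_infinite[OF E index])
    fix \<phi> and e :: real assume \<phi>: "\<phi> \<in> carrier (dual_group G p)" and "0 < e"
    from nat_approx_posE[OF \<open>0 < e\<close>] obtain m where m: "1 / real (Suc m) < e" .
    have "0 \<le> 2 * real (Suc m)" "0 < (1 / 4 :: real)" by simp_all
    from controlled_by_separating[OF S(1) sep \<phi> this]
    obtain Q where Q: "Q \<in> ?\<Q>" "\<And>x. x \<in> carrier G \<Longrightarrow> p x \<le> 2 * real (Suc m) \<Longrightarrow>
      (\<And>s n. (s, n) \<in> Q \<Longrightarrow> cmod (s x - 1) \<le> 1 / real (Suc n)) \<Longrightarrow> cmod (\<phi> x - 1) < 1 / 4"
      by metis
    have "\<phi> \<in> C m Q" using \<phi> Q(2) by (simp add: C_def)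
    then obtain \<psi> where "\<psi> \<in> N m Q" "value_dist (dual_group G p) (dual_value G p) \<phi> \<psi> \<le> 1 / real (Suc m)"
      using N[OF Q(1), of m] by blast
    then show "\<exists>\<psi>\<in>\<Union>i\<in>UNIV \<times> ?\<Q>. N (fst i) (snd i). value_dist (dual_group G p) (dual_value G p) \<phi> \<psi> < e"
      using Q(1) m by (intro bexI[of _ \<psi>] UN_I[of "(m, Q)"]) simp_all
  qed
qed

end

section \<open>Characters of a finite group\<close>

context metric_ab_group
begin

lemma sum_char_cnj_eq_0:
  assumes \<phi>: "\<phi> \<in> carrier (dual_group G p)" and \<psi>: "\<psi> \<in> carrier (dual_group G p)" and "\<phi> \<noteq> \<psi>"
  shows "(\<Sum>x\<in>carrier G. \<phi> x * cnj (\<psi> x)) = 0"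
proof -
  obtain a where a: "a \<in> carrier G" "\<phi> a \<noteq> \<psi> a" using dual_char_eqI[OF \<phi> \<psi>] assms(3) by blast
  have unit: "\<psi> a * cnj (\<psi> a) = 1"
    using dual_char_norm[OF \<psi> a(1)] complex_norm_square[of "\<psi> a"] by simp
  have "\<phi> a * cnj (\<psi> a) \<noteq> 1"
  proof
    assume "\<phi> a * cnj (\<psi> a) = 1"
    then have "\<phi> a * cnj (\<psi> a) = \<psi> a * cnj (\<psi> a)" using unit by simp
    moreover have "cnj (\<psi> a) \<noteq> 0" using unit by auto
    ultimately show False using a(2) by simp
  qed
  have "(\<Sum>x\<in>carrier G. \<phi> x * cnj (\<psi> x)) = (\<Sum>x\<in>(\<lambda>x. a \<otimes> x) ` carrier G. \<phi> x * cnj (\<psi> x))"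
    by (simp only: surj_const_mult[OF a(1)])
  also have "\<dots> = (\<Sum>x\<in>carrier G. \<phi> (a \<otimes> x) * cnj (\<psi> (a \<otimes> x)))"
    by (simp add: sum.reindex[OF inj_on_cmult[OF a(1)]])
  also have "\<dots> = (\<Sum>x\<in>carrier G. (\<phi> a * cnj (\<psi> a)) * (\<phi> x * cnj (\<psi> x)))"
    by (rule sum.cong) (simp_all add: dual_char_mult[OF \<phi> a(1)] dual_char_mult[OF \<psi> a(1)] mult_ac)
  also have "\<dots> = (\<phi> a * cnj (\<psi> a)) * (\<Sum>x\<in>carrier G. \<phi> x * cnj (\<psi> x))"
    by (rule sum_distrib_left[symmetric])
  finally show ?thesis using \<open>\<phi> a * cnj (\<psi> a) \<noteq> 1\<close> by (simp add: mult_cancel_right1)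
qed

text \<open>By orthogonality the sum of \<open>n\<close> characters has square norm \<open>n |G|\<close> in \<open>\<ell>\<^sup>2(G)\<close>, to which the
  identity element alone contributes \<open>n\<^sup>2\<close>.\<close>

theorem card_dual_le:
  assumes G: "finite (carrier G)"
  shows "finite (carrier (dual_group G p)) \<and> card (carrier (dual_group G p)) \<le> card (carrier G)"
proof (rule finite_if_finite_subsets_card_bdd)
  fix C assume C: "C \<subseteq> carrier (dual_group G p)" "finite C"
  define s where "s = (\<lambda>x. \<Sum>\<phi>\<in>C. \<phi> x)"
  have self: "(\<Sum>x\<in>carrier G. \<phi> x * cnj (\<phi> x)) = of_nat (card (carrier G))" if "\<phi> \<in> C" for \<phi>
  proof -
    have "\<phi> x * cnj (\<phi> x) = 1" if "x \<in> carrier G" for x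
      using dual_char_norm[of \<phi> x] complex_norm_square[of "\<phi> x"] C(1) \<open>\<phi> \<in> C\<close> that by auto
    then have "(\<Sum>x\<in>carrier G. \<phi> x * cnj (\<phi> x)) = (\<Sum>x\<in>carrier G. 1)"
      by (intro sum.cong) auto
    then show ?thesis by simp
  qed
  have "of_real (\<Sum>x\<in>carrier G. (cmod (s x))\<^sup>2) = (\<Sum>x\<in>carrier G. s x * cnj (s x))"
    by (simp only: of_real_sum complex_norm_square)
  also have "\<dots> = (\<Sum>x\<in>carrier G. \<Sum>\<phi>\<in>C. \<Sum>\<psi>\<in>C. \<phi> x * cnj (\<psi> x))"
    by (simp add: s_def cnj_sum sum_product)
  also have "\<dots> = (\<Sum>\<phi>\<in>C. \<Sum>\<psi>\<in>C. \<Sum>x\<in>carrier G. \<phi> x * cnj (\<psi> x))"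
    by (subst sum.swap, rule sum.cong[OF refl], rule sum.swap)
  also have "\<dots> = (\<Sum>\<phi>\<in>C. \<Sum>\<psi>\<in>C. if \<phi> = \<psi> then of_nat (card (carrier G)) else 0)"
    using self sum_char_cnj_eq_0 C(1) by (intro sum.cong refl) (auto simp: subset_iff)
  also have "\<dots> = of_nat (card C * card (carrier G))"
    using C(2) by simp
  finally have "complex_of_real (\<Sum>x\<in>carrier G. (cmod (s x))\<^sup>2) = complex_of_real (real (card C * card (carrier G)))"
    by simp
  then have norm: "(\<Sum>x\<in>carrier G. (cmod (s x))\<^sup>2) = real (card C * card (carrier G))"
    by (simp only: of_real_eq_iff)
  have "\<phi> \<one> = 1" if "\<phi> \<in> C" for \<phi>
    using char_one[of \<phi>] C(1) that unfolding dual_group_def by blast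
  then have "s \<one> = (\<Sum>\<phi>\<in>C. 1)" unfolding s_def by (intro sum.cong) auto
  then have "s \<one> = of_nat (card C)" by simp
  then have "(real (card C))\<^sup>2 = (cmod (s \<one>))\<^sup>2" by simp
  also have "\<dots> \<le> (\<Sum>x\<in>carrier G. (cmod (s x))\<^sup>2)"
    by (rule member_le_sum) (simp_all add: G)
  finally have "real (card C) * real (card C) \<le> real (card C) * real (card (carrier G))"
    unfolding norm by (simp add: power2_eq_square)
  then show "card C \<le> card (carrier G)"
    by (cases "card C = 0") auto
qed

end

section \<open>Weights\<close>

lemma weight_le:
  assumes "topology_base X \<B>"
  shows "weight X \<le>o |\<B>|"
proof -
  have "topology_base X (SOME \<B>. topology_base X \<B> \<and> (\<forall>\<B>'. topology_base X \<B>' \<longrightarrow> |\<B>| \<le>o |\<B>'| )) \<and>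
      (\<forall>\<B>'. topology_base X \<B>' \<longrightarrow>
        |SOME \<B>. topology_base X \<B> \<and> (\<forall>\<B>'. topology_base X \<B>' \<longrightarrow> |\<B>| \<le>o |\<B>'| )| \<le>o |\<B>'| )"
    by (rule someI_ex[OF ex_least_topology_base])
  then show ?thesis unfolding weight_def using assms by blast
qed

lemma ex_base_weight:
  obtains \<B> where "topology_base X \<B>" "weight X = |\<B>|"
proof -
  have "topology_base X (SOME \<B>. topology_base X \<B> \<and> (\<forall>\<B>'. topology_base X \<B>' \<longrightarrow> |\<B>| \<le>o |\<B>'| ))"
    using someI_ex[OF ex_least_topology_base] by blast
  then show thesis using that unfolding weight_def by blast
qed

lemma weight_le_of_homeomorphic_map:
  assumes f: "homeomorphic_map X Y f"
  shows "weight X \<le>o weight Y"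
proof -
  obtain \<B> where \<B>: "topology_base Y \<B>" "weight Y = |\<B>|" by (rule ex_base_weight)
  let ?g = "\<lambda>V. {x \<in> topspace X. f x \<in> V}"
  have cont: "continuous_map X Y f" and "open_map X Y f" and inj: "inj_on f (topspace X)"
    using f by (auto simp: homeomorphic_eq_everything_map)
  have "topology_base X (?g ` \<B>)"
    unfolding topology_base_def
  proof (intro conjI ballI allI impI)
    fix W assume "W \<in> ?g ` \<B>"
    then obtain V where V: "V \<in> \<B>" "W = ?g V" by blast
    then have "openin Y V" using \<B>(1) by (simp add: topology_base_def)
    then show "openin X W" unfolding V(2) by (rule openin_continuous_map_preimage[OF cont])
  next
    fix U x assume U: "openin X U \<and> x \<in> U"
    then have "openin Y (f ` U)" using \<open>open_map X Y f\<close> by (simp add: open_map_def)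
    moreover have "f x \<in> f ` U" using U by blast
    ultimately obtain V where V: "V \<in> \<B>" "f x \<in> V" "V \<subseteq> f ` U"
      using \<B>(1) unfolding topology_base_def by meson
    have UX: "U \<subseteq> topspace X" using U openin_subset by blast
    have "?g V \<subseteq> U"
    proof
      fix y assume y: "y \<in> ?g V"
      then obtain u where u: "u \<in> U" "f y = f u" using V(3) by blast
      then have "y = u" using inj_onD[OF inj, of y u] y UX by blast
      then show "y \<in> U" using u by simp
    qed
    moreover have "x \<in> ?g V" using U UX V(2) by blast
    ultimately show "\<exists>V\<in>?g ` \<B>. x \<in> V \<and> V \<subseteq> U" using V(1) by blast
  qed
  then have "weight X \<le>o |?g ` \<B>|" by (rule weight_le)
  also have "|?g ` \<B>| \<le>o |\<B>|" by (rule card_of_image)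
  finally show ?thesis unfolding \<B>(2) .
qed

context Metric_space
begin

lemma topology_base_of_dense:
  assumes D: "D \<subseteq> M" and dense: "\<And>x e. x \<in> M \<Longrightarrow> 0 < e \<Longrightarrow> \<exists>y\<in>D. d x y < e"
  shows "topology_base mtopology ((\<lambda>(y, n). mball y (1 / real (Suc n))) ` (D \<times> UNIV))"
  unfolding topology_base_def
proof (intro conjI ballI allI impI)
  fix V assume "V \<in> (\<lambda>(y, n). mball y (1 / real (Suc n))) ` (D \<times> UNIV)"
  then show "openin mtopology V" by auto
next
  fix U x assume U: "openin mtopology U \<and> x \<in> U"
  then have x: "x \<in> M" using openin_subset by fastforce
  from U obtain r where r: "0 < r" "mball x r \<subseteq> U" unfolding openin_mtopology by blast
  then have "0 < r / 2" by simp
  from nat_approx_posE[OF this] obtain n where n: "1 / real (Suc n) < r / 2" .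
  obtain y where y: "y \<in> D" "d x y < 1 / real (Suc n)" using dense[OF x, of "1 / real (Suc n)"] by auto
  have "mball y (1 / real (Suc n)) \<subseteq> mball x r"
    using y D n x by (intro mball_subset) (simp_all add: commute)
  moreover have "x \<in> mball y (1 / real (Suc n))" using x y D by (auto simp: commute)
  ultimately show "\<exists>V\<in>(\<lambda>(y, n). mball y (1 / real (Suc n))) ` (D \<times> UNIV). x \<in> V \<and> V \<subseteq> U"
    using y(1) r(2) by (intro bexI[of _ "mball y (1 / real (Suc n))"]) auto
qed

lemma ex_dense_of_topology_base:
  assumes \<B>: "topology_base mtopology \<B>"
  obtains D where "D \<subseteq> M" "|D| \<le>o |\<B>|" "\<And>x e. x \<in> M \<Longrightarrow> 0 < e \<Longrightarrow> \<exists>y\<in>D. d x y < e"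
proof
  let ?c = "\<lambda>V. SOME x. x \<in> V"
  have c: "?c V \<in> V" if "V \<noteq> {}" for V :: "'a set"
    using that by (simp add: some_in_eq)
  show "?c ` (\<B> - {{}}) \<subseteq> M"
  proof
    fix x assume "x \<in> ?c ` (\<B> - {{}})"
    then obtain V where V: "V \<in> \<B>" "V \<noteq> {}" "x = ?c V" by blast
    then have "openin mtopology V" using \<B> by (simp add: topology_base_def)
    then have "V \<subseteq> M" using openin_subset by fastforce
    then show "x \<in> M" using V c by blast
  qed
  have "|\<B> - {{}}| \<le>o |\<B>|" by (rule card_of_mono1) blast
  then show "|?c ` (\<B> - {{}})| \<le>o |\<B>|" by (rule ordLeq_transitive[OF card_of_image])
  fix x and e :: real assume x: "x \<in> M" and e: "0 < e"
  have "openin mtopology (mball x e)" "x \<in> mball x e" using x e by auto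
  then obtain V where V: "V \<in> \<B>" "x \<in> V" "V \<subseteq> mball x e"
    using \<B> unfolding topology_base_def by meson
  then have "?c V \<in> mball x e" using c[of V] by blast
  then have "d x (?c V) < e" by simp
  moreover have "?c V \<in> ?c ` (\<B> - {{}})" using V(1,2) by blast
  ultimately show "\<exists>y\<in>?c ` (\<B> - {{}}). d x y < e" by blast
qed

lemma infinite_dense:
  assumes M: "infinite M" and D: "D \<subseteq> M"
    and dense: "\<And>x e. x \<in> M \<Longrightarrow> 0 < e \<Longrightarrow> \<exists>y\<in>D. d x y < e"
  shows "infinite D"
proof
  assume fin: "finite D"
  then have "M \<noteq> D" using M by blast
  then obtain x where x: "x \<in> M" "x \<notin> D" using D by blast
  have "D \<noteq> {}" using dense[OF x(1), of 1] by auto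
  have "0 < Min (d x ` D)"
  proof (subst Min_gr_iff)
    show "\<forall>a\<in>d x ` D. 0 < a" using x D mdist_pos_less by (metis imageE subsetD)
  qed (use fin \<open>D \<noteq> {}\<close> in auto)
  from dense[OF x(1) this] obtain y where "y \<in> D" "d x y < Min (d x ` D)" by blast
  moreover have "Min (d x ` D) \<le> d x y" using fin \<open>y \<in> D\<close> by (intro Min_le) auto
  ultimately show False by simp
qed

lemma openin_singleton_of_finite:
  assumes "finite M" "x \<in> M"
  shows "openin mtopology {x}"
proof -
  have "mtopology = discrete_topology M"
    using finite_t1_space_imp_discrete_topology[OF topspace_mtopology assms(1)]
      Hausdorff_imp_t1_space[OF Hausdorff_space_mtopology] by simp
  then show ?thesis using assms(2) by simp
qed

lemma weight_finite:
  assumes "finite M"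
  shows "weight mtopology =o |M|"
proof -
  have "topology_base mtopology ((\<lambda>x. {x}) ` M)"
    unfolding topology_base_def
  proof (intro conjI ballI allI impI)
    fix U x assume U: "openin mtopology U \<and> x \<in> U"
    then have "x \<in> M" using openin_subset by fastforce
    then show "\<exists>V\<in>(\<lambda>x. {x}) ` M. x \<in> V \<and> V \<subseteq> U" using U by blast
  qed (use openin_singleton_of_finite[OF assms] in blast)
  then have "weight mtopology \<le>o |(\<lambda>x. {x}) ` M|" by (rule weight_le)
  also have "|(\<lambda>x. {x}) ` M| \<le>o |M|" by (rule card_of_image)
  finally have le: "weight mtopology \<le>o |M|" .
  obtain \<B> where \<B>: "topology_base mtopology \<B>" "weight mtopology = |\<B>|" by (rule ex_base_weight)
  have "(\<lambda>x. {x}) ` M \<subseteq> \<B>"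
  proof
    fix W assume "W \<in> (\<lambda>x. {x}) ` M"
    then obtain x where x: "x \<in> M" "W = {x}" by blast
    then obtain V where "V \<in> \<B>" "x \<in> V" "V \<subseteq> {x}"
      using openin_singleton_of_finite[OF assms x(1)] \<B>(1) unfolding topology_base_def by blast
    then have "V = {x}" by blast
    then show "W \<in> \<B>" using \<open>V \<in> \<B>\<close> x(2) by simp
  qed
  then have "|M| \<le>o |\<B>|" by (intro card_of_ordLeqI[of "\<lambda>x. {x}"]) (auto simp: inj_on_def)
  then show ?thesis using le \<B>(2) by (simp add: ordIso_iff_ordLeq)
qed

end

context reflexive_group
begin

text \<open>For an infinite group the weight is the least cardinality of a dense set, so that the previous
  bound for dense sets of the dual applies. For a finite group the weight is the number of
  elements.\<close>

lemma weight_dual_le: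
  "weight (value_topology (dual_group G p) (dual_value G p)) \<le>o weight (value_topology G p)"
proof -
  interpret dual: metric_ab_group "dual_group G p" "dual_value G p" by (rule metric_ab_group_dual)
  show ?thesis
  proof (cases "finite (carrier G)")
    case True
    then have fin: "finite (carrier (dual_group G p))"
      and le: "card (carrier (dual_group G p)) \<le> card (carrier G)" using card_dual_le by auto
    have "weight (value_topology (dual_group G p) (dual_value G p)) =o |carrier (dual_group G p)|"
      unfolding dual.value_topology_eq by (rule dual.met.weight_finite[OF fin])
    also have "|carrier (dual_group G p)| \<le>o |carrier G|"
      using finite_card_of_iff_card2[OF fin True] le by simp
    also have "|carrier G| =o weight (value_topology G p)"
      unfolding value_topology_eq by (rule ordIso_symmetric[OF met.weight_finite[OF True]])
    finally show ?thesis .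
  next
    case False
    obtain \<B> where \<B>: "topology_base (value_topology G p) \<B>" "weight (value_topology G p) = |\<B>|"
      by (rule ex_base_weight)
    from met.ex_dense_of_topology_base[OF \<B>(1)[unfolded value_topology_eq]]
    obtain D where D: "D \<subseteq> carrier G" "|D| \<le>o |\<B>|"
      and dense: "\<And>x e. x \<in> carrier G \<Longrightarrow> 0 < e \<Longrightarrow> \<exists>y\<in>D. value_dist G p x y < e" by metis
    have inf: "infinite D" by (rule met.infinite_dense[OF False D(1) dense])
    have "|D| \<le>o |D|" by (rule ordLeq_reflexive) simp
    from ex_dense_in_dual[OF inf D(1) this dense]
    obtain D' where D': "D' \<subseteq> carrier (dual_group G p)" "|D'| \<le>o |D|"
      and dense': "\<And>\<phi> e. \<phi> \<in> carrier (dual_group G p) \<Longrightarrow> 0 < e \<Longrightarrow>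
        \<exists>\<psi>\<in>D'. value_dist (dual_group G p) (dual_value G p) \<phi> \<psi> < e" by metis
    have "|UNIV :: nat set| \<le>o |D|" using inf infinite_iff_card_of_nat by blast
    then have times: "|D' \<times> (UNIV :: nat set)| \<le>o |D|"
      by (rule card_of_Times_ordLeq_infinite[OF inf D'(2)])
    have "weight (value_topology (dual_group G p) (dual_value G p)) \<le>o
        |(\<lambda>(\<psi>, n). dual.met.mball \<psi> (1 / real (Suc n))) ` (D' \<times> UNIV)|"
      unfolding dual.value_topology_eq by (rule weight_le[OF dual.met.topology_base_of_dense[OF D'(1) dense']])
    also have "|(\<lambda>(\<psi>, n). dual.met.mball \<psi> (1 / real (Suc n))) ` (D' \<times> UNIV)| \<le>o |D' \<times> (UNIV :: nat set)|"
      by (rule card_of_image)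
    also note times
    also note D(2)
    finally show ?thesis unfolding \<B>(2) .
  qed
qed

lemma canonical_hom_homeomorphic:
  "homeomorphic_map (value_topology G p) (value_topology (bidual_group G p) (bidual_value G p)) (canonical_hom G p)"
proof -
  interpret dual: metric_ab_group "dual_group G p" "dual_value G p" by (rule metric_ab_group_dual)
  interpret bidual: metric_ab_group "bidual_group G p" "bidual_value G p"
    unfolding bidual_group_eq bidual_value_eq by (rule dual.metric_ab_group_dual)
  let ?\<kappa> = "canonical_hom G p"
  have "openin bidual.met.mtopology (?\<kappa> ` U)" if U: "openin met.mtopology U" for U
    unfolding bidual.met.openin_mtopology
  proof (intro conjI allI impI)
    have UG: "U \<subseteq> carrier G" using U met.openin_mtopology by blast
    then show "?\<kappa> ` U \<subseteq> carrier (bidual_group G p)" unfolding canonical_hom_surj[symmetric] by blast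
    fix \<xi> assume "\<xi> \<in> ?\<kappa> ` U"
    then obtain x where x: "x \<in> U" "\<xi> = ?\<kappa> x" by blast
    then obtain r where r: "0 < r" "met.mball x r \<subseteq> U" using U unfolding met.openin_mtopology by blast
    have "bidual.met.mball \<xi> r \<subseteq> ?\<kappa> ` U"
    proof
      fix \<eta> assume \<eta>: "\<eta> \<in> bidual.met.mball \<xi> r"
      then have "\<eta> \<in> ?\<kappa> ` carrier G" by (simp add: canonical_hom_surj)
      then obtain y where y: "y \<in> carrier G" "\<eta> = ?\<kappa> y" by blast
      have "x \<in> carrier G" using x(1) UG by blast
      then have "y \<in> met.mball x r" using \<eta> y x(2) by (simp add: canonical_hom_isometry)
      then show "\<eta> \<in> ?\<kappa> ` U" using r(2) y(2) by blast
    qed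
    then show "\<exists>r>0. bidual.met.mball \<xi> r \<subseteq> ?\<kappa> ` U" using r(1) by blast
  qed
  then have "open_map met.mtopology bidual.met.mtopology ?\<kappa>" by (simp add: open_map_def)
  moreover have "continuous_map met.mtopology bidual.met.mtopology ?\<kappa>"
    unfolding continuous_map_def
  proof (intro conjI allI impI)
    show "?\<kappa> \<in> topspace met.mtopology \<rightarrow> topspace bidual.met.mtopology"
      using canonical_hom_closed by simp
    fix V assume V: "openin bidual.met.mtopology V"
    show "openin met.mtopology {x \<in> topspace met.mtopology. ?\<kappa> x \<in> V}"
      unfolding met.openin_mtopology
    proof (intro conjI allI impI)
      fix x assume x: "x \<in> {x \<in> topspace met.mtopology. ?\<kappa> x \<in> V}"
      then have xG: "x \<in> carrier G" and "?\<kappa> x \<in> V" by auto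
      then obtain r where r: "0 < r" "bidual.met.mball (?\<kappa> x) r \<subseteq> V"
        using V unfolding bidual.met.openin_mtopology by blast
      have "met.mball x r \<subseteq> {x \<in> topspace met.mtopology. ?\<kappa> x \<in> V}"
      proof
        fix y assume y: "y \<in> met.mball x r"
        then have yG: "y \<in> carrier G" by simp
        then have "?\<kappa> y \<in> bidual.met.mball (?\<kappa> x) r"
          using y canonical_hom_closed[OF xG] canonical_hom_closed[OF yG]
          by (simp add: canonical_hom_isometry[OF xG])
        then show "y \<in> {x \<in> topspace met.mtopology. ?\<kappa> x \<in> V}" using r(2) yG by auto
      qed
      then show "\<exists>r>0. met.mball x r \<subseteq> {x \<in> topspace met.mtopology. ?\<kappa> x \<in> V}" using r(1) by blast
    qed simp
  qed
  ultimately show ?thesis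
    unfolding value_topology_eq bidual.value_topology_eq
    using canonical_hom_surj canonical_hom_inj by (intro bijective_open_imp_homeomorphic_map) simp_all
qed

text \<open>Applied to the reflexive group \<open>G'\<close>, the preceding inequality bounds the weight of the second
  dual, which is homeomorphic to \<open>G\<close>.\<close>

theorem weight_dual:
  "weight (value_topology G p) =o weight (value_topology (dual_group G p) (dual_value G p))"
proof -
  interpret dual: reflexive_group "dual_group G p" "dual_value G p" by (rule reflexive_group_dual)
  have "weight (value_topology G p) \<le>o weight (value_topology (bidual_group G p) (bidual_value G p))"
    by (rule weight_le_of_homeomorphic_map[OF canonical_hom_homeomorphic])
  also have "weight (value_topology (bidual_group G p) (bidual_value G p)) \<le>o
      weight (value_topology (dual_group G p) (dual_value G p))"
    unfolding bidual_group_eq bidual_value_eq by (rule dual.weight_dual_le)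
  finally show ?thesis using weight_dual_le by (simp add: ordIso_iff_ordLeq)
qed

theorem polish_dual:
  assumes "polish_topology (value_topology G p)"
  shows "polish_topology (value_topology (dual_group G p) (dual_value G p))"
proof -
  interpret dual: metric_ab_group "dual_group G p" "dual_value G p" by (rule metric_ab_group_dual)
  obtain D where D: "countable D" "D \<subseteq> carrier G" "met.mtopology closure_of D = carrier G"
    using assms by (auto simp: polish_topology_def separable_space_def value_topology_eq)
  have dense: "\<exists>y\<in>D. value_dist G p x y < e" if "x \<in> carrier G" "0 < e" for x e
    using that D(3) unfolding met.metric_closure_of by fastforce
  have "|D| \<le>o |UNIV :: nat set|" using D(1) unfolding countable_def card_of_ordLeq[symmetric] by simp
  from ex_dense_in_dual[OF infinite_UNIV_nat D(2) this dense]
  obtain D' where D': "D' \<subseteq> carrier (dual_group G p)" "|D'| \<le>o |UNIV :: nat set|"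
    and dense': "\<And>\<phi> e. \<phi> \<in> carrier (dual_group G p) \<Longrightarrow> 0 < e \<Longrightarrow>
      \<exists>\<psi>\<in>D'. value_dist (dual_group G p) (dual_value G p) \<phi> \<psi> < e" by metis
  have "countable D'" using D'(2) unfolding countable_def card_of_ordLeq[symmetric] by simp
  moreover have "dual.met.mtopology closure_of D' = carrier (dual_group G p)"
  proof
    show "carrier (dual_group G p) \<subseteq> dual.met.mtopology closure_of D'"
    proof
      fix \<phi> assume \<phi>: "\<phi> \<in> carrier (dual_group G p)"
      have "\<exists>\<psi>\<in>D'. \<psi> \<in> dual.met.mball \<phi> r" if "0 < r" for r
        using dense'[OF \<phi> that] D'(1) \<phi> by auto
      then show "\<phi> \<in> dual.met.mtopology closure_of D'"
        using \<phi> unfolding dual.met.metric_closure_of by blast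
    qed
  qed (use closure_of_subset_topspace[of dual.met.mtopology D'] in simp)
  ultimately have "separable_space dual.met.mtopology"
    using D'(1) unfolding separable_space_def by auto
  moreover have "completely_metrizable_space dual.met.mtopology"
    using mcomplete_dual dual.met.Metric_space_axioms unfolding completely_metrizable_space_def by blast
  ultimately show ?thesis by (simp add: polish_topology_def dual.value_topology_eq)
qed

end

section \<open>The compact-open topology\<close>

lemma topspace_compact_open_topology [simp]:
  "topspace (compact_open_topology G X) = carrier (char_group G X)"
proof -
  have "{\<phi> \<in> carrier (char_group G X). \<phi> ` {} \<subseteq> topspace circle_topology} = carrier (char_group G X)"
    by simp
  then show ?thesis
    unfolding compact_open_topology_def topology_generated_by_topspace
    using compactin_empty[of X] openin_topspace[of circle_topology] by blast
qed

lemma openin_compact_open_topology: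
  assumes "compactin X K" "openin circle_topology U"
  shows "openin (compact_open_topology G X) {\<phi> \<in> carrier (char_group G X). \<phi> ` K \<subseteq> U}"
  unfolding compact_open_topology_def using assms by (intro topology_generated_by_Basis) blast

lemma continuous_map_into_compact_open_topology:
  assumes top: "f ` topspace Y \<subseteq> carrier (char_group G X)"
    and "\<And>K U. compactin X K \<Longrightarrow> openin circle_topology U \<Longrightarrow> openin Y {y \<in> topspace Y. f y ` K \<subseteq> U}"
  shows "continuous_map Y (compact_open_topology G X) f"
  unfolding compact_open_topology_def
proof (rule continuous_on_generated_topo)
  show "f ` topspace Y \<subseteq> \<Union>{{\<phi> \<in> carrier (char_group G X). \<phi> ` K \<subseteq> U} | K U.
      compactin X K \<and> openin circle_topology U}"
    using top topspace_compact_open_topology[of G X]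
    unfolding compact_open_topology_def topology_generated_by_topspace by simp
  fix W assume "W \<in> {{\<phi> \<in> carrier (char_group G X). \<phi> ` K \<subseteq> U} | K U.
      compactin X K \<and> openin circle_topology U}"
  then obtain K U where W: "W = {\<phi> \<in> carrier (char_group G X). \<phi> ` K \<subseteq> U}"
    and KU: "compactin X K" "openin circle_topology U" by blast
  have "f -` W \<inter> topspace Y = {y \<in> topspace Y. f y ` K \<subseteq> U}" using top unfolding W by blast
  then show "openin Y (f -` W \<inter> topspace Y)" using assms(2)[OF KU] by simp
qed

text \<open>Joint continuity of evaluation keeps the condition \<open>\<psi> y \<in> U\<close> for all \<open>\<psi>\<close> near \<open>\<phi>\<close> and \<open>y\<close> near
  \<open>x \<in> K\<close>, and finitely many of these neighbourhoods of points \<open>x\<close> cover \<open>K\<close>. The lemma serves both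
  for the pointwise topology on a ball and for the topology of the dual value.\<close>

lemma compact_open_coarser:
  assumes X: "topspace X = carrier G" and Y: "topspace Y \<subseteq> carrier (char_group G X)"
    and joint: "\<And>\<phi> x e. \<phi> \<in> topspace Y \<Longrightarrow> x \<in> carrier G \<Longrightarrow> 0 < e \<Longrightarrow>
      \<exists>T V. openin Y T \<and> \<phi> \<in> T \<and> openin X V \<and> x \<in> V \<and> (\<forall>\<psi>\<in>T. \<forall>y\<in>V. cmod (\<psi> y - \<phi> x) < e)"
  shows "continuous_map Y (compact_open_topology G X) (\<lambda>\<phi>. \<phi>)"
proof (rule continuous_map_into_compact_open_topology)
  show "(\<lambda>\<phi>. \<phi>) ` topspace Y \<subseteq> carrier (char_group G X)" using Y by simp
  fix K U assume K: "compactin X K" and U: "openin circle_topology U"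
  have KG: "K \<subseteq> carrier G" using compactin_subset_topspace[OF K] X by simp
  show "openin Y {\<phi> \<in> topspace Y. \<phi> ` K \<subseteq> U}"
    unfolding openin_subopen[of Y "{\<phi> \<in> topspace Y. \<phi> ` K \<subseteq> U}"]
  proof
    fix \<phi> assume "\<phi> \<in> {\<phi> \<in> topspace Y. \<phi> ` K \<subseteq> U}"
    then have \<phi>: "\<phi> \<in> topspace Y" and \<phi>U: "\<And>x. x \<in> K \<Longrightarrow> \<phi> x \<in> U" by auto
    have "\<exists>T V. openin Y T \<and> \<phi> \<in> T \<and> openin X V \<and> x \<in> V \<and> (\<forall>\<psi>\<in>T. \<forall>y\<in>V. y \<in> K \<longrightarrow> \<psi> y \<in> U)"
      if x: "x \<in> K" for x
    proof -
      obtain e where e: "0 < e" "\<And>z. cmod z = 1 \<Longrightarrow> dist z (\<phi> x) < e \<Longrightarrow> z \<in> U"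
        using openin_circle_topologyE[OF U \<phi>U[OF x]] by metis
      have "x \<in> carrier G" using x KG by blast
      from joint[OF \<phi> this e(1)] obtain T V where TV: "openin Y T" "\<phi> \<in> T" "openin X V" "x \<in> V"
        and near: "\<forall>\<psi>\<in>T. \<forall>y\<in>V. cmod (\<psi> y - \<phi> x) < e" by (elim exE conjE) (rule that)
      have "\<psi> y \<in> U" if "\<psi> \<in> T" "y \<in> V" "y \<in> K" for \<psi> y
      proof (rule e(2))
        have "\<psi> \<in> carrier (char_group G X)" using openin_subset[OF TV(1)] Y that(1) by blast
        then show "cmod (\<psi> y) = 1" using KG that(3) by (intro char_norm) auto
        show "dist (\<psi> y) (\<phi> x) < e" using near that(1,2) by (simp add: dist_norm)
      qed
      then show ?thesis using TV by (intro exI[of _ T] exI[of _ V]) simp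
    qed
    then obtain T V where TV: "\<And>x. x \<in> K \<Longrightarrow> openin Y (T x) \<and> \<phi> \<in> T x \<and> openin X (V x) \<and> x \<in> V x \<and>
        (\<forall>\<psi>\<in>T x. \<forall>y\<in>V x. y \<in> K \<longrightarrow> \<psi> y \<in> U)"
      by metis
    then have "\<And>x. x \<in> K \<Longrightarrow> openin X (V x)" "\<And>x. x \<in> K \<Longrightarrow> x \<in> V x" by simp_all
    from compactin_neighbourhoods[OF K this]
    obtain A where A: "finite A" "A \<subseteq> K" "K \<subseteq> \<Union>(V ` A)" .
    let ?T = "(\<Inter>x\<in>A. T x) \<inter> topspace Y"
    have "openin Y ?T" using A(1,2) TV by (intro openin_INT) auto
    moreover have "\<phi> \<in> ?T" using A(2) TV \<phi> by auto
    moreover have "?T \<subseteq> {\<phi> \<in> topspace Y. \<phi> ` K \<subseteq> U}"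
    proof
      fix \<psi> assume \<psi>: "\<psi> \<in> ?T"
      have "\<psi> y \<in> U" if y: "y \<in> K" for y
      proof -
        obtain x where x: "x \<in> A" "y \<in> V x" using A(3) y by blast
        then have "\<psi> \<in> T x" using \<psi> by blast
        then show ?thesis using TV[of x] x A(2) y by blast
      qed
      then show "\<psi> \<in> {\<phi> \<in> topspace Y. \<phi> ` K \<subseteq> U}" using \<psi> by auto
    qed
    ultimately show "\<exists>T. openin Y T \<and> \<phi> \<in> T \<and> T \<subseteq> {\<phi> \<in> topspace Y. \<phi> ` K \<subseteq> U}" by blast
  qed
qed

text \<open>Cutting a compact set into finitely many compact pieces on each of which \<open>\<phi>\<close> is nearly
  constant turns uniform closeness to \<open>\<phi>\<close> into finitely many conditions \<open>\<psi> ` K \<subseteq> U\<close>.\<close>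

lemma compact_open_neighbourhood:
  assumes X: "topspace X = carrier G" and K: "compactin X K" and \<phi>: "\<phi> \<in> carrier (char_group G X)"
  obtains W where "openin (compact_open_topology G X) W" "\<phi> \<in> W"
    "\<And>\<psi> x. \<psi> \<in> W \<Longrightarrow> x \<in> K \<Longrightarrow> cmod (\<psi> x - \<phi> x) < 1"
proof -
  have "0 < (1 / 4 :: real)" by simp
  from finite_net_unit_disc[OF this]
  obtain Z where Z: "finite Z" "\<And>z. cmod z \<le> 1 \<Longrightarrow> \<exists>w\<in>Z. cmod (z - w) < 1 / 4" by metis
  then have "Z \<noteq> {}" using Z(2)[of 0] by auto
  have KG: "K \<subseteq> carrier G" using compactin_subset_topspace[OF K] X by simp
  let ?K = "\<lambda>w. {x \<in> topspace X. \<phi> x \<in> cball w (1 / 4)} \<inter> K"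
  let ?N = "\<lambda>w. {\<psi> \<in> carrier (char_group G X). \<psi> ` ?K w \<subseteq> ball w (1 / 2) \<inter> {z. cmod z = 1}}"
  have "continuous_map X euclidean \<phi>"
    using char_continuous[OF \<phi>] by (simp add: continuous_map_circle_iff)
  then have "compactin X (?K w)" for w
    by (intro closed_Int_compactin K closedin_continuous_map_preimage[where Y = euclidean]) simp_all
  then have "openin (compact_open_topology G X) (?N w)" for w
    by (intro openin_compact_open_topology openin_circle_topology_ball)
  then have op: "openin (compact_open_topology G X) (\<Inter>(?N ` Z))"
    using Z(1) \<open>Z \<noteq> {}\<close> by (intro openin_Inter) auto
  show thesis
  proof (rule that[OF op])
    have "\<phi> x \<in> ball w (1 / 2) \<inter> {z. cmod z = 1}" if x: "x \<in> ?K w" for x w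
      using x char_norm[OF \<phi>, of x] KG by auto
    then show "\<phi> \<in> \<Inter>(?N ` Z)" using \<phi> by blast
    fix \<psi> x assume \<psi>: "\<psi> \<in> \<Inter>(?N ` Z)" and x: "x \<in> K"
    have xG: "x \<in> carrier G" using x KG by blast
    obtain w where w: "w \<in> Z" "cmod (\<phi> x - w) < 1 / 4"
      using Z(2)[of "\<phi> x"] char_norm[OF \<phi> xG] by auto
    then have "x \<in> ?K w" using x xG X by (simp add: dist_norm norm_minus_commute)
    moreover have "\<psi> \<in> ?N w" using \<psi> w(1) by blast
    ultimately have "\<psi> x \<in> ball w (1 / 2)" by blast
    then have "cmod (w - \<psi> x) < 1 / 2" by (simp add: dist_norm)
    then show "cmod (\<psi> x - \<phi> x) < 1"
      using w(2) norm_triangle_ineq[of "\<phi> x - w" "w - \<psi> x"] norm_minus_commute[of "\<phi> x" "\<psi> x"] by simp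
  qed
qed

context metric_ab_group
begin

section \<open>Topological reflexivity\<close>

text \<open>Characters of bounded value are equicontinuous, so that evaluation is jointly continuous on
  a ball of the dual with the topology of pointwise convergence, for which the ball is compact.\<close>

lemma compactin_dual_ball_compact_open:
  assumes r: "0 \<le> r"
  shows "compactin (compact_open_topology G (value_topology G p))
    {\<phi> \<in> carrier (dual_group G p). dual_value G p \<phi> \<le> r}"
proof -
  let ?P = "product_topology (\<lambda>_. euclidean :: complex topology) (carrier G)"
  define B where "B = {\<phi> \<in> carrier (dual_group G p). dual_value G p \<phi> \<le> r}"
  let ?Y = "subtopology ?P B"
  have cpt: "compactin ?P B" unfolding B_def by (rule compactin_dual_ball_pointwise[OF r])
  have top: "topspace ?Y = B" using compactin_subset_topspace[OF cpt] by (simp add: Int_absorb1)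
  have BG: "\<psi> \<in> carrier (dual_group G p)" "dual_value G p \<psi> \<le> r" if "\<psi> \<in> B" for \<psi>
    using that by (auto simp: B_def)
  have "continuous_map ?Y (compact_open_topology G (value_topology G p)) (\<lambda>\<phi>. \<phi>)"
  proof (rule compact_open_coarser)
    show "topspace ?Y \<subseteq> carrier (char_group G (value_topology G p))"
      unfolding top using BG(1) by (auto simp: dual_group_def)
    fix \<phi> x and e :: real assume "\<phi> \<in> topspace ?Y" and x: "x \<in> carrier G" and e: "0 < e"
    then have \<phi>: "\<phi> \<in> B" using top by simp
    let ?d = "e / 2 / (2 * pi * (r + 1))"
    have pos: "0 < 2 * pi * (r + 1)" using r by (intro mult_pos_pos) auto
    then have d: "0 < ?d" using e by simp
    let ?T = "{\<psi> \<in> B. \<psi> x \<in> ball (\<phi> x) (e / 2) \<inter> {z. cmod z = 1}}"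
    have "openin ?Y ?T"
    proof (rule openin_pointwise_preimage[OF x openin_circle_topology_ball])
      show "B \<subseteq> extensional (carrier G)" using compactin_subset_topspace[OF cpt] by (auto simp: PiE_def)
      show "cmod (\<xi> x) = 1" if "\<xi> \<in> B" for \<xi> by (rule dual_char_norm[OF BG(1)[OF that] x])
    qed
    moreover have "\<phi> \<in> ?T" using \<phi> e dual_char_norm[OF BG(1)[OF \<phi>] x] by simp
    moreover have "openin (value_topology G p) (met.mball x ?d)" by (simp add: value_topology_eq)
    moreover have "x \<in> met.mball x ?d" using x d by simp
    moreover have "\<forall>\<psi>\<in>?T. \<forall>y\<in>met.mball x ?d. cmod (\<psi> y - \<phi> x) < e"
    proof (intro ballI)
      fix \<psi> y assume \<psi>: "\<psi> \<in> ?T" and y: "y \<in> met.mball x ?d"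
      have \<psi>B: "\<psi> \<in> B" and near: "cmod (\<phi> x - \<psi> x) < e / 2" using \<psi> by (auto simp: dist_norm)
      have yG: "y \<in> carrier G" and dist: "value_dist G p x y < ?d" using y by auto
      have "cmod (\<psi> y - \<psi> x) = cmod (\<psi> (inv x \<otimes> y) - 1)"
        using char_inv_mult_dist[of \<psi> "value_topology G p" x y] BG(1)[OF \<psi>B] x yG by (simp add: dual_group_def)
      also have "\<dots> \<le> 2 * pi * (dual_value G p \<psi> * p (inv x \<otimes> y))"
        using x yG by (intro cmod_char_diff_1_le BG(1)[OF \<psi>B]) simp
      also have "\<dots> \<le> 2 * pi * ((r + 1) * p (inv x \<otimes> y))"
        using BG(2)[OF \<psi>B] x yG value_nonneg by (intro mult_left_mono mult_right_mono) auto
      also have "\<dots> = 2 * pi * (r + 1) * value_dist G p x y" using x yG by (simp add: value_dist_eq)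
      also have "\<dots> < e / 2" by (rule mult_less_of_less_divide[OF pos dist])
      finally show "cmod (\<psi> y - \<phi> x) < e"
        using near norm_triangle_ineq[of "\<psi> y - \<psi> x" "\<psi> x - \<phi> x"] norm_minus_commute[of "\<phi> x" "\<psi> x"] by simp
    qed
    ultimately show "\<exists>T V. openin ?Y T \<and> \<phi> \<in> T \<and> openin (value_topology G p) V \<and> x \<in> V \<and>
        (\<forall>\<psi>\<in>T. \<forall>y\<in>V. cmod (\<psi> y - \<phi> x) < e)"
      by (intro exI[of _ ?T] exI[of _ "met.mball x ?d"] conjI)
  qed simp
  moreover have "compactin ?Y B" using cpt by (simp add: compactin_subtopology)
  ultimately have "compactin (compact_open_topology G (value_topology G p)) ((\<lambda>\<phi>. \<phi>) ` B)"
    by (rule image_compactin[rotated])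
  then show ?thesis by (simp add: B_def)
qed

text \<open>Near \<open>x\<close> the value is bounded, so a small distance in \<open>G'\<close> makes characters uniformly close
  there.\<close>

lemma compact_open_coarser_than_dual_value:
  "continuous_map (value_topology (dual_group G p) (dual_value G p))
    (compact_open_topology G (value_topology G p)) (\<lambda>\<phi>. \<phi>)"
proof (rule compact_open_coarser)
  interpret dual: metric_ab_group "dual_group G p" "dual_value G p" by (rule metric_ab_group_dual)
  let ?Y = "value_topology (dual_group G p) (dual_value G p)"
  show "topspace ?Y \<subseteq> carrier (char_group G (value_topology G p))"
    using dual.topspace_value_topology by (simp add: dual_group_def)
  fix \<phi> x and e :: real assume "\<phi> \<in> topspace ?Y" and x: "x \<in> carrier G" and e: "0 < e"
  then have \<phi>: "\<phi> \<in> carrier (dual_group G p)" by simp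
  let ?c = "e / 2 / (2 * pi * (p x + 1))"
  have pos: "0 < 2 * pi * (p x + 1)" using value_nonneg[OF x] by (intro mult_pos_pos) auto
  then have c: "0 < ?c" using e by simp
  let ?V = "met.mball x 1 \<inter> {y \<in> carrier G. \<phi> y \<in> ball (\<phi> x) (e / 2)}"
  have "continuous_map (value_topology G p) euclidean \<phi>"
    using char_continuous[of \<phi> G "value_topology G p"] \<phi> by (simp add: continuous_map_circle_iff dual_group_def)
  then have "openin (value_topology G p) {y \<in> carrier G. \<phi> y \<in> ball (\<phi> x) (e / 2)}"
    using openin_continuous_map_preimage[of "value_topology G p" euclidean \<phi> "ball (\<phi> x) (e / 2)"] by simp
  then have "openin (value_topology G p) ?V" by (intro openin_Int) (simp add: value_topology_eq)
  moreover have "x \<in> ?V" using x e by simp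
  moreover have "openin ?Y (dual.met.mball \<phi> ?c)" by (simp add: dual.value_topology_eq)
  moreover have "\<phi> \<in> dual.met.mball \<phi> ?c" using \<phi> c by simp
  moreover have "\<forall>\<psi>\<in>dual.met.mball \<phi> ?c. \<forall>y\<in>?V. cmod (\<psi> y - \<phi> x) < e"
  proof (intro ballI)
    fix \<psi> y assume \<psi>: "\<psi> \<in> dual.met.mball \<phi> ?c" and y: "y \<in> ?V"
    have \<psi>G: "\<psi> \<in> carrier (dual_group G p)"
      and dist: "value_dist (dual_group G p) (dual_value G p) \<phi> \<psi> < ?c" using \<psi> by auto
    have yG: "y \<in> carrier G" and "value_dist G p x y < 1" and near: "cmod (\<phi> x - \<phi> y) < e / 2"
      using y by (auto simp: dist_norm)
    have "p y \<le> p x + 1"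
      using met.triangle[OF one_closed x yG] \<open>value_dist G p x y < 1\<close> x yG by (simp add: value_dist_one)
    have "cmod (\<psi> y - \<phi> y) \<le> 2 * pi * (value_dist (dual_group G p) (dual_value G p) \<phi> \<psi> * p y)"
      by (rule cmod_char_diff_le[OF \<phi> \<psi>G yG])
    also have "\<dots> \<le> 2 * pi * (value_dist (dual_group G p) (dual_value G p) \<phi> \<psi> * (p x + 1))"
      using \<open>p y \<le> p x + 1\<close> by (intro mult_left_mono) auto
    also have "\<dots> = 2 * pi * (p x + 1) * value_dist (dual_group G p) (dual_value G p) \<phi> \<psi>" by simp
    also have "\<dots> < e / 2" by (rule mult_less_of_less_divide[OF pos dist])
    finally show "cmod (\<psi> y - \<phi> x) < e"
      using near norm_triangle_ineq[of "\<psi> y - \<phi> y" "\<phi> y - \<phi> x"] norm_minus_commute[of "\<phi> x" "\<phi> y"] by simp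
  qed
  ultimately show "\<exists>T V. openin ?Y T \<and> \<phi> \<in> T \<and> openin (value_topology G p) V \<and> x \<in> V \<and>
      (\<forall>\<psi>\<in>T. \<forall>y\<in>V. cmod (\<psi> y - \<phi> x) < e)"
    by (intro exI[of _ "dual.met.mball \<phi> ?c"] exI[of _ ?V] conjI)
qed simp

lemma canonical_hom_mem_topological_bidual:
  assumes x: "x \<in> carrier G"
  shows "canonical_hom G p x \<in>
    carrier (char_group (dual_group G p) (compact_open_topology G (value_topology G p)))"
proof -
  interpret dual: metric_ab_group "dual_group G p" "dual_value G p" by (rule metric_ab_group_dual)
  let ?X1 = "compact_open_topology G (value_topology G p)"
  have \<kappa>: "canonical_hom G p x \<in> carrier (dual_group (dual_group G p) (dual_value G p))"
    using canonical_hom_closed[OF x] by (simp add: bidual_group_eq)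
  have top: "topspace ?X1 = carrier (dual_group G p)" by (simp add: dual_group_def)
  have "continuous_map ?X1 circle_topology (canonical_hom G p x)"
    unfolding continuous_map_def
  proof (intro conjI allI impI)
    show "canonical_hom G p x \<in> topspace ?X1 \<rightarrow> topspace circle_topology"
      unfolding top using dual.dual_char_norm[OF \<kappa>] by simp
    fix U assume U: "openin circle_topology U"
    have "compactin (value_topology G p) {x}" using x by simp
    from openin_compact_open_topology[OF this U, of G]
    have "openin ?X1 {\<phi> \<in> carrier (dual_group G p). \<phi> ` {x} \<subseteq> U}" by (simp add: dual_group_def)
    moreover have "{\<phi> \<in> topspace ?X1. canonical_hom G p x \<phi> \<in> U} = {\<phi> \<in> carrier (dual_group G p). \<phi> ` {x} \<subseteq> U}"
      unfolding top using canonical_hom_apply[of _ x] by auto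
    ultimately show "openin ?X1 {\<phi> \<in> topspace ?X1. canonical_hom G p x \<phi> \<in> U}" by simp
  qed
  then show ?thesis
    using \<kappa> unfolding dual_group_def[of "dual_group G p"] mem_char_group_iff by blast
qed

text \<open>Otherwise some \<open>y\<^sub>n\<close> tend to \<open>x\<close> while \<open>\<phi>\<^sub>n(y\<^sub>n)\<close> lies outside \<open>U\<close> for characters \<open>\<phi>\<^sub>n\<close> of
  the compact set. A cluster point \<open>\<psi>\<close> of these maps \<open>x\<close> into \<open>U\<close>, hence also a tail of the sequence
  together with its limit, which is a compact set \<open>L\<close>. So some \<open>\<phi>\<^sub>n\<close> maps \<open>L\<close> into \<open>U\<close> as well.\<close>

lemma canonical_hom_continuous_compact_open:
  "continuous_map (value_topology G p)
    (compact_open_topology (dual_group G p) (compact_open_topology G (value_topology G p)))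
    (canonical_hom G p)"
proof (rule continuous_map_into_compact_open_topology)
  let ?X1 = "compact_open_topology G (value_topology G p)"
  show "canonical_hom G p ` topspace (value_topology G p) \<subseteq> carrier (char_group (dual_group G p) ?X1)"
    using canonical_hom_mem_topological_bidual by auto
  fix C U assume C: "compactin ?X1 C" and U: "openin circle_topology U"
  have CG: "C \<subseteq> carrier (dual_group G p)" using compactin_subset_topspace[OF C] by (simp add: dual_group_def)
  have eq: "{x \<in> topspace (value_topology G p). canonical_hom G p x ` C \<subseteq> U} = {x \<in> carrier G. \<forall>\<phi>\<in>C. \<phi> x \<in> U}"
    using CG canonical_hom_apply by (auto simp: subset_iff)
  have "\<exists>r>0. met.mball x r \<subseteq> {x \<in> carrier G. \<forall>\<phi>\<in>C. \<phi> x \<in> U}"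
    if x: "x \<in> carrier G" and xU: "\<And>\<phi>. \<phi> \<in> C \<Longrightarrow> \<phi> x \<in> U" for x
  proof (rule ccontr)
    assume contra: "\<not> ?thesis"
    have "\<exists>z. fst z \<in> met.mball x (1 / real (Suc n)) \<and> snd z \<in> C \<and> snd z (fst z) \<notin> U" for n
    proof -
      have "0 < 1 / real (Suc n)" by simp
      then have "\<not> met.mball x (1 / real (Suc n)) \<subseteq> {x \<in> carrier G. \<forall>\<phi>\<in>C. \<phi> x \<in> U}"
        using contra by blast
      then show ?thesis by auto
    qed
    then have "\<forall>n. \<exists>z. fst z \<in> met.mball x (1 / real (Suc n)) \<and> snd z \<in> C \<and> snd z (fst z) \<notin> U"
      by (rule allI)
    from choice[OF this] obtain f where f: "\<forall>n. fst (f n) \<in> met.mball x (1 / real (Suc n)) \<and>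
        snd (f n) \<in> C \<and> snd (f n) (fst (f n)) \<notin> U" ..
    define y \<phi> where "y = (\<lambda>n. fst (f n))" and "\<phi> = (\<lambda>n. snd (f n))"
    have y: "y n \<in> met.mball x (1 / real (Suc n))" and \<phi>: "\<phi> n \<in> C" and bad: "\<phi> n (y n) \<notin> U" for n
      using spec[OF f, of n] unfolding y_def \<phi>_def by blast+
    have y_near: "\<exists>N. \<forall>n\<ge>N. y n \<in> met.mball x r" if r: "0 < r" for r
    proof -
      from nat_approx_posE[OF r] obtain N where N: "1 / real (Suc N) < r" .
      have "y n \<in> met.mball x r" if "N \<le> n" for n
      proof -
        have "1 / real (Suc n) \<le> 1 / real (Suc N)" using that by (simp add: frac_le)
        then show ?thesis using y[of n] N by auto
      qed
      then show ?thesis by blast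
    qed
    obtain \<psi> where \<psi>: "\<psi> \<in> C" and cluster: "\<And>V N. openin ?X1 V \<Longrightarrow> \<psi> \<in> V \<Longrightarrow> \<exists>n\<ge>N. \<phi> n \<in> V"
      using compactin_cluster_point[OF C, of \<phi>] \<phi> by metis
    have \<psi>G: "\<psi> \<in> carrier (char_group G (value_topology G p))" using \<psi> CG by (auto simp: dual_group_def)
    have "openin met.mtopology {z \<in> carrier G. \<psi> z \<in> U}"
      using openin_continuous_map_preimage[OF char_continuous[OF \<psi>G] U] by (simp add: value_topology_eq)
    moreover have "x \<in> {z \<in> carrier G. \<psi> z \<in> U}" using x xU[OF \<psi>] by simp
    ultimately obtain r where r: "0 < r" "met.mball x r \<subseteq> {z \<in> carrier G. \<psi> z \<in> U}"
      unfolding met.openin_mtopology by blast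
    obtain N where N: "\<And>n. N \<le> n \<Longrightarrow> y n \<in> met.mball x r" using y_near[OF r(1)] by blast
    let ?L = "insert x (y ` {N..})"
    have "limitin met.mtopology y x sequentially"
      unfolding met.limitin_metric
    proof (intro conjI allI impI x)
      fix e :: real assume "0 < e"
      then obtain N where "\<forall>n\<ge>N. y n \<in> met.mball x e" using y_near by blast
      then show "\<forall>\<^sub>F n in sequentially. y n \<in> carrier G \<and> value_dist G p (y n) x < e"
        unfolding eventually_sequentially by (intro exI[of _ N]) (simp add: met.commute)
    qed
    then have "compactin met.mtopology ?L"
      by (rule compactin_sequence_with_limit) (use y in auto)
    then have "openin ?X1 {\<phi> \<in> carrier (char_group G (value_topology G p)). \<phi> ` ?L \<subseteq> U}"
      by (intro openin_compact_open_topology U) (simp add: value_topology_eq)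
    moreover have "\<psi> (y n) \<in> U" if "N \<le> n" for n
      using subsetD[OF r(2) N[OF that]] by simp
    then have "\<psi> \<in> {\<phi> \<in> carrier (char_group G (value_topology G p)). \<phi> ` ?L \<subseteq> U}"
      using \<psi>G xU[OF \<psi>] by auto
    ultimately obtain n where "N \<le> n" "\<phi> n \<in> {\<phi> \<in> carrier (char_group G (value_topology G p)). \<phi> ` ?L \<subseteq> U}"
      using cluster[of _ N] by blast
    then have "\<phi> n (y n) \<in> U" by auto
    then show False using bad by blast
  qed
  then have "openin met.mtopology {x \<in> carrier G. \<forall>\<phi>\<in>C. \<phi> x \<in> U}"
    unfolding met.openin_mtopology by blast
  then show "openin (value_topology G p) {x \<in> topspace (value_topology G p). canonical_hom G p x ` C \<subseteq> U}"
    unfolding eq by (simp add: value_topology_eq)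
qed

end

context reflexive_group
begin

lemma carrier_topological_bidual:
  "carrier (char_group (dual_group G p) (compact_open_topology G (value_topology G p))) =
    canonical_hom G p ` carrier G"
proof
  let ?X1 = "compact_open_topology G (value_topology G p)"
  show "carrier (char_group (dual_group G p) ?X1) \<subseteq> canonical_hom G p ` carrier G"
  proof
    fix \<xi> assume \<xi>: "\<xi> \<in> carrier (char_group (dual_group G p) ?X1)"
    have "continuous_map (value_topology (dual_group G p) (dual_value G p)) circle_topology (\<xi> \<circ> (\<lambda>\<phi>. \<phi>))"
      by (rule continuous_map_compose[OF compact_open_coarser_than_dual_value char_continuous[OF \<xi>]])
    then have "\<xi> \<in> carrier (char_group (dual_group G p) (value_topology (dual_group G p) (dual_value G p)))"
      using \<xi> unfolding mem_char_group_iff by (simp add: o_def)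
    then show "\<xi> \<in> canonical_hom G p ` carrier G"
      unfolding canonical_hom_surj bidual_group_eq dual_group_def[of "dual_group G p"] .
  qed
qed (use canonical_hom_mem_topological_bidual in blast)

text \<open>The inverse of the canonical homomorphism is continuous because the balls of \<open>G'\<close> are compact:
  an element that all characters of value at most \<open>2/r\<close> map to within distance \<open>1\<close> of \<open>1\<close> has
  value at most \<open>r/2\<close>.\<close>

lemma canonical_hom_open_compact_open:
  "open_map (value_topology G p)
    (compact_open_topology (dual_group G p) (compact_open_topology G (value_topology G p)))
    (canonical_hom G p)"
  unfolding open_map_def
proof (intro allI impI)
  let ?X1 = "compact_open_topology G (value_topology G p)"
  let ?X2 = "compact_open_topology (dual_group G p) ?X1"
  interpret dual: metric_ab_group "dual_group G p" "dual_value G p" by (rule metric_ab_group_dual)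
  fix U assume "openin (value_topology G p) U"
  then have U: "openin met.mtopology U" by (simp add: value_topology_eq)
  show "openin ?X2 (canonical_hom G p ` U)"
    unfolding openin_subopen[of ?X2 "canonical_hom G p ` U"]
  proof
    fix \<xi> assume "\<xi> \<in> canonical_hom G p ` U"
    then obtain x where x: "x \<in> U" "\<xi> = canonical_hom G p x" by blast
    then obtain r where r: "0 < r" "met.mball x r \<subseteq> U" using U unfolding met.openin_mtopology by blast
    have xG: "x \<in> carrier G" using U x(1) unfolding met.openin_mtopology by blast
    let ?C = "{\<phi> \<in> carrier (dual_group G p). dual_value G p \<phi> \<le> 2 / r}"
    have top: "topspace ?X1 = carrier (dual_group G p)" by (simp add: dual_group_def)
    have C: "compactin ?X1 ?C" using r(1) by (intro compactin_dual_ball_compact_open) simp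
    obtain W where W: "openin ?X2 W" "canonical_hom G p x \<in> W"
      and near: "\<And>\<eta> \<phi>. \<eta> \<in> W \<Longrightarrow> \<phi> \<in> ?C \<Longrightarrow> cmod (\<eta> \<phi> - canonical_hom G p x \<phi>) < 1"
    proof (rule compact_open_neighbourhood[OF top C canonical_hom_mem_topological_bidual[OF xG]])
      fix W assume "openin ?X2 W" "canonical_hom G p x \<in> W"
        "\<And>\<eta> \<phi>. \<eta> \<in> W \<Longrightarrow> \<phi> \<in> ?C \<Longrightarrow> cmod (\<eta> \<phi> - canonical_hom G p x \<phi>) < 1"
      then show thesis by (rule that)
    qed
    have "W \<subseteq> canonical_hom G p ` U"
    proof
      fix \<eta> assume \<eta>: "\<eta> \<in> W"
      then have "\<eta> \<in> canonical_hom G p ` carrier G"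
        using openin_subset[OF W(1)] carrier_topological_bidual by auto
      then obtain y where y: "y \<in> carrier G" "\<eta> = canonical_hom G p y" by blast
      have "bidual_value G p (canonical_hom G p (inv x \<otimes> y)) \<le> 1 / (2 / r)"
        unfolding bidual_value_eq
      proof (rule dual.dual_value_le_of_near_one_on_ball)
        show "canonical_hom G p (inv x \<otimes> y) \<in> carrier (dual_group (dual_group G p) (dual_value G p))"
          using canonical_hom_closed[of "inv x \<otimes> y"] xG y(1) by (simp add: bidual_group_eq)
        fix \<phi> assume \<phi>: "\<phi> \<in> carrier (dual_group G p)" "dual_value G p \<phi> \<le> 2 / r"
        have "cmod (\<phi> (inv x \<otimes> y) - 1) = cmod (\<phi> y - \<phi> x)"
          using char_inv_mult_dist[of \<phi> "value_topology G p" x y] \<phi>(1) xG y(1) by (simp add: dual_group_def)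
        also have "\<dots> < 1" using near[OF \<eta>, of \<phi>] \<phi> y(2) by (simp add: canonical_hom_apply)
        finally show "cmod (canonical_hom G p (inv x \<otimes> y) \<phi> - 1) < 1"
          using \<phi>(1) by (simp add: canonical_hom_apply)
      qed (use r(1) in simp)
      then have "value_dist G p x y < r"
        using bidual_value_canonical_hom[of "inv x \<otimes> y"] xG y(1) r(1) by (simp add: value_dist_eq)
      then have "y \<in> U" using r(2) xG y(1) by auto
      then show "\<eta> \<in> canonical_hom G p ` U" using y(2) by blast
    qed
    then show "\<exists>T. openin ?X2 T \<and> \<xi> \<in> T \<and> T \<subseteq> canonical_hom G p ` U"
      using W unfolding x(2) by blast
  qed
qed

theorem topologically_reflexive_value_topology: "topologically_reflexive G (value_topology G p)"
proof -
  let ?X1 = "compact_open_topology G (value_topology G p)"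
  let ?X2 = "compact_open_topology (dual_group G p) ?X1"
  have "canonical_hom G p (x \<otimes> y) =
      canonical_hom G p x \<otimes>\<^bsub>char_group (dual_group G p) ?X1\<^esub> canonical_hom G p y"
    if "x \<in> carrier G" "y \<in> carrier G" for x y
    using that dual_char_mult by (auto simp: canonical_hom_eq fun_eq_iff restrict_def)
  then have "canonical_hom G p \<in> iso G (char_group (dual_group G p) ?X1)"
    using canonical_hom_inj carrier_topological_bidual
    by (auto simp: iso_def hom_def bij_betw_def)
  moreover have "homeomorphic_map (value_topology G p) ?X2 (canonical_hom G p)"
    using canonical_hom_continuous_compact_open canonical_hom_open_compact_open canonical_hom_inj
      carrier_topological_bidual by (intro bijective_open_imp_homeomorphic_map) simp_all
  ultimately show ?thesis
    by (simp add: topologically_reflexive_def Let_def canonical_hom_def dual_group_def)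
qed

end

section \<open>The theorem\<close>

theorem theorem4p1:
  fixes G :: "('a, 'b) monoid_scheme" and p :: "'a \<Rightarrow> real"
  assumes "metric_abelian_group G p"
    and "metrically_reflexive G p"
  shows "value_topology (dual_group G p) (dual_value G p) =
           uniform_convergence_topology (carrier (dual_group G p))
             {K. compactin (weak_topology G p) K} \<and>
         weight (value_topology G p) =o
           weight (value_topology (dual_group G p) (dual_value G p)) \<and>
         topologically_reflexive G (value_topology G p) \<and>
         (polish_topology (value_topology G p) \<longrightarrow>
           polish_topology (value_topology (dual_group G p) (dual_value G p)))"
proof -
  interpret reflexive_group G p
    using assms by unfold_locales
  show ?thesis
    using dual_topology_eq_uniform_convergence weight_dual topologically_reflexive_value_topology
      polish_dual by blast
qed

end
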